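(* Let $X$ be a complex manifold, $Y\subset X$ a compact Kähler submanifold, and $L$ a holomorphic line bundle on $X$ such that the restriction $L|_Y$ is topologically trivial. Assume that $u_1(Y,X,L)\neq 0$ in $H^1(Y,N_{Y/X}^* )$. Then $L$ is not semi-positive.
   Context: $L$ is semi-positive if it admits a $C^\infty$ Hermitian metric $h$ whose Chern curvature satisfies $\sqrt{-1}\Theta_h\geq 0$ at every point of $X$. Definition of $u_1(Y,X,L)\in H^1(Y,N_{Y/X}^* )$. Let $\dim Y=d$, $\dim X=d+r$ with $d,r\geq 1$. A line bundle is unitary flat if it admits a system of local frames whose transition functions are constants in $\mathrm{U}(1)=\{t\in\mathbb{C}: |t|=1\}$. Since $Y$ is compact Kähler and $L|_Y$ is topologically trivial, $L|_Y$ is unitary flat. Take a sufficiently fine finite open covering $\{U_j\}$ of $Y$ with coordinates $z_j=(z_j^1,\dots,z_j^d)$ on $U_j$, sufficiently small Stein open subsets $V_j\subset X$ with $V_j\cap Y=U_j$, holomorphic local defining functions $w_j=(w_j^1,\dots,w_j^r)\colon V_j\to\mathbb{C}^r$ of $Y$ (so $U_j=\{w_j=0\}$ transversally), and a holomorphic surjection (retraction) ${\rm Pr}_{U_j}\colon V_j\to U_j$ such that $(z_j\circ{\rm Pr}_{U_j},w_j)$ are coordinates on $V_j$. Functions on $U_j$ are regarded as functions on $V_j$ via pull-back by ${\rm Pr}_{U_j}$. Take local holomorphic frames $e_j$ of $L$ on $V_j$ and constants $t_{jk}\in\mathrm{U}(1)$ with $t_{jk}^{-1}e_k|_{U_{jk}}=e_j|_{U_{jk}}$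 on $U_{jk}:=U_j\cap U_k$. Expand near $U_{jk}$ $$\frac{t_{jk}^{-1}e_k}{e_j}=1+\sum_{|\alpha|\geq 1}f_{kj,\alpha}(z_j)\cdot w_j^\alpha ,$$ with multi-indices $\alpha\in(\mathbb{Z}_{\geq 0})^r$ and $f_{kj,\alpha}$ holomorphic on $U_{jk}$. Then $\{(U_{jk},\sum_{|\alpha|=1}f_{kj,\alpha}(z_j)\,dw_j^\alpha)\}$ is a $1$-cocycle with values in the conormal bundle $N_{Y/X}^*$ (for $|\alpha|=1$, $dw_j^\alpha$ is the corresponding $dw_j^\lambda$), and $u_1(Y,X,L)$ is its class in $H^1(Y,N_{Y/X}^* )$; it does not depend on the choices made. *)

theory Defs
  imports "HOL-Analysis.Analysis"
begin

section \<open>Holomorphic and smooth functions on open sets of complex n-space\<close>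

text \<open>Complex differentiability: the real Frechet derivative exists and is complex linear
  (\<open>*s\<close> is multiplication by complex scalars). Only used for open \<open>S\<close>.\<close>

definition cholo_on :: "(complex^'n \<Rightarrow> complex) \<Rightarrow> (complex^'n) set \<Rightarrow> bool" where
  "cholo_on f S \<longleftrightarrow>
     (\<forall>x\<in>S. \<exists>f'. (f has_derivative f') (at x) \<and> (\<forall>c v. f' (c *s v) = c * f' v))"

fun Ck_on :: "nat \<Rightarrow> 'a::real_normed_vector set \<Rightarrow> ('a \<Rightarrow> 'b::real_normed_vector) \<Rightarrow> bool" where
  "Ck_on 0 S f \<longleftrightarrow> continuous_on S f"
| "Ck_on (Suc k) S f \<longleftrightarrow>
     (\<forall>x\<in>S. f differentiable (at x)) \<and>
     (\<forall>v. Ck_on k S (\<lambda>x. frechet_derivative f (at x) v))"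

definition Cinf_on :: "'a::real_normed_vector set \<Rightarrow> ('a \<Rightarrow> 'b::real_normed_vector) \<Rightarrow> bool" where
  "Cinf_on S f \<longleftrightarrow> (\<forall>k. Ck_on k S f)"

text \<open>The Wirtinger operators \<open>\<partial>/\<partial>x\<^sub>i\<close> and \<open>\<partial>/\<partial>\<close>(conjugate of \<open>x\<^sub>i\<close>).\<close>

definition wirt :: "'n \<Rightarrow> (complex^'n \<Rightarrow> complex) \<Rightarrow> complex^'n \<Rightarrow> complex" where
  "wirt i f x =
     (frechet_derivative f (at x) (axis i 1) - \<i> * frechet_derivative f (at x) (axis i \<i>)) / 2"

definition wirt_bar :: "'n \<Rightarrow> (complex^'n \<Rightarrow> complex) \<Rightarrow> complex^'n \<Rightarrow> complex" where
  "wirt_bar i f x =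
     (frechet_derivative f (at x) (axis i 1) + \<i> * frechet_derivative f (at x) (axis i \<i>)) / 2"

section \<open>Complex manifolds\<close>

text \<open>A manifold is a subset \<open>M\<close> of a second countable Hausdorff space, with the subspace
  topology, together with an atlas of charts \<open>(U, \<phi>)\<close>. Chart maps are total functions whose values
  outside \<open>U\<close> are irrelevant.\<close>

type_synonym ('x, 'n) chart = "'x set \<times> ('x \<Rightarrow> complex^'n)"

definition complex_chart :: "'x::topological_space set \<Rightarrow> ('x, 'n::finite) chart \<Rightarrow> bool" where
  "complex_chart M = (\<lambda>(U, \<phi>).
     openin (top_of_set M) U \<and> open (\<phi> ` U) \<and> homeomorphism U (\<phi> ` U) \<phi> (inv_into U \<phi>))"

definition chart_change_holo :: "('x, 'n::finite) chart \<Rightarrow> ('x, 'n) chart \<Rightarrow> bool" where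
  "chart_change_holo = (\<lambda>(U, \<phi>) (U', \<phi>').
     \<forall>i. cholo_on (\<lambda>x. \<phi>' (inv_into U \<phi> x) $ i) (\<phi> ` (U \<inter> U')))"

definition complex_manifold :: "'x::topological_space set \<Rightarrow> ('x, 'n::finite) chart set \<Rightarrow> bool" where
  "complex_manifold M A \<longleftrightarrow>
     (\<Union>c\<in>A. fst c) = M \<and> (\<forall>c\<in>A. complex_chart M c) \<and>
     (\<forall>c\<in>A. \<forall>c'\<in>A. chart_change_holo c c')"

text \<open>The charts of the maximal atlas generated by \<open>A\<close>.\<close>

definition holo_chart ::
  "'x::topological_space set \<Rightarrow> ('x, 'n::finite) chart set \<Rightarrow> ('x, 'n) chart \<Rightarrow> bool" where
  "holo_chart M A c \<longleftrightarrow>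
     complex_chart M c \<and> (\<forall>c'\<in>A. chart_change_holo c c' \<and> chart_change_holo c' c)"

definition mholo_on :: "('x, 'n::finite) chart set \<Rightarrow> ('x \<Rightarrow> complex) \<Rightarrow> 'x set \<Rightarrow> bool" where
  "mholo_on A f V \<longleftrightarrow> (\<forall>(U, \<phi>)\<in>A. cholo_on (f \<circ> inv_into U \<phi>) (\<phi> ` (U \<inter> V)))"

definition msmooth_on ::
  "('x, 'n::finite) chart set \<Rightarrow> ('x \<Rightarrow> 'b::real_normed_vector) \<Rightarrow> 'x set \<Rightarrow> bool" where
  "msmooth_on A f V \<longleftrightarrow> (\<forall>(U, \<phi>)\<in>A. Cinf_on (\<phi> ` (U \<inter> V)) (f \<circ> inv_into U \<phi>))"

text \<open>Stein open subsets: holomorphically convex (on a nonempty compact \<open>K\<close> the supremum of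
  \<open>|f|\<close> is attained, so the set below is the holomorphic hull of \<open>K\<close>) and holomorphically
  separable.\<close>

definition stein_open ::
  "'x::topological_space set \<Rightarrow> ('x, 'n::finite) chart set \<Rightarrow> 'x set \<Rightarrow> bool" where
  "stein_open M A V \<longleftrightarrow>
     openin (top_of_set M) V \<and>
     (\<forall>K. K \<subseteq> V \<and> compact K \<longrightarrow>
        compact {p\<in>V. \<forall>f. mholo_on A f V \<longrightarrow> (\<exists>q\<in>K. cmod (f p) \<le> cmod (f q))}) \<and>
     (\<forall>p\<in>V. \<forall>q\<in>V. p \<noteq> q \<longrightarrow> (\<exists>f. mholo_on A f V \<and> f p \<noteq> f q))"

text \<open>The holomorphic tangent space at \<open>p\<close> is identified with the model space by means of a
  preferred chart of \<open>A\<close> at \<open>p\<close>; cotangent vectors are represented by their components in the same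
  chart. \<open>coord_vec A c i p\<close> is the tangent vector \<open>\<partial>/\<partial>\<phi>\<^sub>i\<close> of the chart \<open>c = (U, \<phi>)\<close>, and
  \<open>covec A f p\<close> is the differential \<open>df\<close> at \<open>p\<close> of a holomorphic function \<open>f\<close>.\<close>

definition chart_at :: "('x, 'n::finite) chart set \<Rightarrow> 'x \<Rightarrow> ('x, 'n) chart" where
  "chart_at A p = (SOME c. c \<in> A \<and> p \<in> fst c)"

definition coord_vec ::
  "('x, 'n::finite) chart set \<Rightarrow> ('x, 'n) chart \<Rightarrow> 'n \<Rightarrow> 'x \<Rightarrow> complex^'n" where
  "coord_vec A = (\<lambda>(U, \<phi>) i p.
     frechet_derivative (snd (chart_at A p) \<circ> inv_into U \<phi>) (at (\<phi> p)) (axis i 1))"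

definition covec :: "('x, 'n::finite) chart set \<Rightarrow> ('x \<Rightarrow> complex) \<Rightarrow> 'x \<Rightarrow> complex^'n" where
  "covec A f p = (let (U, \<phi>) = chart_at A p in
     (\<chi> i. frechet_derivative (f \<circ> inv_into U \<phi>) (at (\<phi> p)) (axis i 1)))"

section \<open>Kaehler manifolds\<close>

definition metric_coeff ::
  "('x, 'n::finite) chart set \<Rightarrow> ('x \<Rightarrow> complex^'n \<Rightarrow> complex^'n \<Rightarrow> complex) \<Rightarrow>
   ('x, 'n) chart \<Rightarrow> 'n \<Rightarrow> 'n \<Rightarrow> complex^'n \<Rightarrow> complex" where
  "metric_coeff A G = (\<lambda>(U, \<phi>) i j x.
     let p = inv_into U \<phi> x in G p (coord_vec A (U, \<phi>) i p) (coord_vec A (U, \<phi>) j p))"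

text \<open>The last clause says that the fundamental form, a constant multiple of
  \<open>\<i> \<Sum> g\<^sub>i\<^sub>j dx\<^sub>i \<and> d\<close>(conjugate of \<open>x\<^sub>j\<close>), is \<open>d\<close>-closed: it is the vanishing of its \<open>\<partial>\<close>, and the
  other half is the complex conjugate.\<close>

definition kaehler_metric ::
  "'x::topological_space set \<Rightarrow> ('x, 'n::finite) chart set \<Rightarrow>
   ('x \<Rightarrow> complex^'n \<Rightarrow> complex^'n \<Rightarrow> complex) \<Rightarrow> bool" where
  "kaehler_metric M A G \<longleftrightarrow>
     (\<forall>p\<in>M. (\<forall>u u' v. G p (u + u') v = G p u v + G p u' v) \<and>
             (\<forall>a u v. G p (a *s u) v = a * G p u v) \<and>
             (\<forall>u v. G p v u = cnj (G p u v)) \<and>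
             (\<forall>u. u \<noteq> 0 \<longrightarrow> Re (G p u u) > 0)) \<and>
     (\<forall>c\<in>A. \<forall>i j. Cinf_on (snd c ` fst c) (metric_coeff A G c i j)) \<and>
     (\<forall>c\<in>A. \<forall>i j k. \<forall>x\<in>snd c ` fst c.
        wirt k (metric_coeff A G c i j) x = wirt i (metric_coeff A G c k j) x)"

definition kaehler_manifold :: "'x::topological_space set \<Rightarrow> ('x, 'n::finite) chart set \<Rightarrow> bool" where
  "kaehler_manifold M A \<longleftrightarrow> complex_manifold M A \<and> (\<exists>G. kaehler_metric M A G)"

section \<open>Submanifolds and the conormal sheaf\<close>

text \<open>The ambient manifold has dimension \<open>d + r\<close> and is modelled on \<open>complex^('d + 'r)\<close>; the
  submanifold has dimension \<open>d\<close> and is cut out by the last \<open>r\<close> coordinates of suitable charts.\<close>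

definition slice_chart ::
  "'x::topological_space set \<Rightarrow> ('x, 'd::finite + 'r::finite) chart set \<Rightarrow> 'x set \<Rightarrow>
   ('x, 'd + 'r) chart \<Rightarrow> bool" where
  "slice_chart X A Y c \<longleftrightarrow>
     holo_chart X A c \<and> fst c \<inter> Y = {p\<in>fst c. \<forall>l. snd c p $ Inr l = 0}"

definition complex_submanifold ::
  "'x::topological_space set \<Rightarrow> ('x, 'd::finite + 'r::finite) chart set \<Rightarrow> 'x set \<Rightarrow> bool" where
  "complex_submanifold X A Y \<longleftrightarrow> Y \<subseteq> X \<and> (\<forall>p\<in>Y. \<exists>c. slice_chart X A Y c \<and> p \<in> fst c)"

definition sub_atlas ::
  "'x::topological_space set \<Rightarrow> ('x, 'd::finite + 'r::finite) chart set \<Rightarrow> 'x set \<Rightarrow>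
   ('x, 'd) chart set" where
  "sub_atlas X A Y =
     {(U \<inter> Y, \<lambda>p. \<chi> a. \<phi> p $ Inl a) | U \<phi>. slice_chart X A Y (U, \<phi>)}"

definition sub_tangent ::
  "'x::topological_space set \<Rightarrow> ('x, 'd::finite + 'r::finite) chart set \<Rightarrow> 'x set \<Rightarrow> 'x \<Rightarrow>
   (complex^('d + 'r)) set" where
  "sub_tangent X A Y p =
     {v. \<forall>U \<phi> l. slice_chart X A Y (U, \<phi>) \<and> p \<in> U \<longrightarrow>
           (\<Sum>i\<in>UNIV. covec A (\<lambda>q. \<phi> q $ Inr l) p $ i * v $ i) = 0}"

text \<open>Sections over an open subset \<open>U\<close> of \<open>Y\<close> of the conormal bundle: holomorphic sections of the
  cotangent bundle of \<open>X\<close> restricted to \<open>Y\<close> (i.e. locally \<open>\<Sum> g\<^sub>i d\<phi>\<^sub>i\<close> with \<open>g\<^sub>i\<close> holomorphic on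
  \<open>Y\<close>) which annihilate the tangent spaces of \<open>Y\<close>. Values outside \<open>U\<close> are irrelevant.\<close>

definition conormal_sheaf ::
  "'x::topological_space set \<Rightarrow> ('x, 'd::finite + 'r::finite) chart set \<Rightarrow> 'x set \<Rightarrow>
   'x set \<Rightarrow> ('x \<Rightarrow> complex^('d + 'r)) set" where
  "conormal_sheaf X A Y U =
     {\<xi>. (\<forall>p\<in>U. \<forall>v\<in>sub_tangent X A Y p. (\<Sum>i\<in>UNIV. \<xi> p $ i * v $ i) = 0) \<and>
         (\<forall>p\<in>U. \<exists>W \<phi> g. holo_chart X A (W, \<phi>) \<and> p \<in> W \<and>
            (\<forall>i. mholo_on (sub_atlas X A Y) (g i) (U \<inter> W)) \<and>
            (\<forall>q\<in>U \<inter> W. \<xi> q = (\<Sum>i\<in>UNIV. g i q *s covec A (\<lambda>q'. \<phi> q' $ i) q)))}"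

section \<open>First Cech cohomology of a compact space\<close>

text \<open>\<open>F U\<close> is the set of sections over \<open>U\<close> of a sheaf of abelian groups, represented by functions
  that matter only on \<open>U\<close>. A triple \<open>(n, U, \<xi>)\<close> is a finite open covering \<open>U 0, \<dots>, U (n - 1)\<close> with
  a 1-cochain on it. Finite coverings suffice for the direct limit over all coverings because the
  base is compact. Cocycles are equivalent iff they become cohomologous on a common
  refinement.\<close>

type_synonym ('x, 'v) cochain1 = "nat \<times> (nat \<Rightarrow> 'x set) \<times> (nat \<Rightarrow> nat \<Rightarrow> 'x \<Rightarrow> 'v)"

definition finite_open_cover ::
  "'x::topological_space set \<Rightarrow> nat \<Rightarrow> (nat \<Rightarrow> 'x set) \<Rightarrow> bool" where
  "finite_open_cover Y n U \<longleftrightarrow> (\<forall>i<n. openin (top_of_set Y) (U i)) \<and> (\<Union>i<n. U i) = Y"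

definition cech_Z1 ::
  "'x::topological_space set \<Rightarrow> ('x set \<Rightarrow> ('x \<Rightarrow> 'v::ab_group_add) set) \<Rightarrow>
   ('x, 'v) cochain1 set" where
  "cech_Z1 Y F = {(n, U, \<xi>). finite_open_cover Y n U \<and>
     (\<forall>i<n. \<forall>j<n. \<xi> i j \<in> F (U i \<inter> U j)) \<and>
     (\<forall>i<n. \<forall>j<n. \<forall>k<n. \<forall>p\<in>U i \<inter> U j \<inter> U k. \<xi> i j p + \<xi> j k p = \<xi> i k p)}"

definition cech_rel1 ::
  "'x::topological_space set \<Rightarrow> ('x set \<Rightarrow> ('x \<Rightarrow> 'v::ab_group_add) set) \<Rightarrow>
   (('x, 'v) cochain1 \<times> ('x, 'v) cochain1) set" where
  "cech_rel1 Y F = {((n, U, \<xi>), (m, V, \<eta>)).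
     (n, U, \<xi>) \<in> cech_Z1 Y F \<and> (m, V, \<eta>) \<in> cech_Z1 Y F \<and>
     (\<exists>k W \<sigma> \<tau> \<zeta>. finite_open_cover Y k W \<and>
        (\<forall>i<k. \<sigma> i < n \<and> W i \<subseteq> U (\<sigma> i) \<and> \<tau> i < m \<and> W i \<subseteq> V (\<tau> i) \<and> \<zeta> i \<in> F (W i)) \<and>
        (\<forall>i<k. \<forall>j<k. \<forall>p\<in>W i \<inter> W j.
           \<xi> (\<sigma> i) (\<sigma> j) p - \<eta> (\<tau> i) (\<tau> j) p = \<zeta> j p - \<zeta> i p))}"

definition cech_H1 ::
  "'x::topological_space set \<Rightarrow> ('x set \<Rightarrow> ('x \<Rightarrow> 'v::ab_group_add) set) \<Rightarrow>
   ('x, 'v) cochain1 set set" where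
  "cech_H1 Y F = cech_Z1 Y F // cech_rel1 Y F"

definition H1_class ::
  "'x::topological_space set \<Rightarrow> ('x set \<Rightarrow> ('x \<Rightarrow> 'v::ab_group_add) set) \<Rightarrow>
   ('x, 'v) cochain1 \<Rightarrow> ('x, 'v) cochain1 set" where
  "H1_class Y F c = cech_rel1 Y F `` {c}"

lemma H1_class_in_cech_H1: "c \<in> cech_Z1 Y F \<Longrightarrow> H1_class Y F c \<in> cech_H1 Y F"
  by (simp add: cech_H1_def H1_class_def quotientI)

definition H1_zero ::
  "'x::topological_space set \<Rightarrow> ('x set \<Rightarrow> ('x \<Rightarrow> 'v::ab_group_add) set) \<Rightarrow>
   ('x, 'v) cochain1 set" where
  "H1_zero Y F = H1_class Y F (1, \<lambda>_. Y, \<lambda>_ _ _. 0)"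

section \<open>Line bundles\<close>

text \<open>A line bundle is given by its projection \<open>pr\<close> from the total space and a set \<open>T\<close> of local
  trivializations \<open>(U, \<psi>)\<close>, where \<open>\<psi>\<close> maps each fibre over a point of \<open>U\<close> bijectively onto the
  complex numbers. The vector space structure of the fibres, and the holomorphic structure of the
  total space, are those transported by the trivializations.\<close>

type_synonym ('x, 'l) triv = "'x set \<times> ('l \<Rightarrow> complex)"

definition holo_line_bundle ::
  "'x::topological_space set \<Rightarrow> ('x, 'n::finite) chart set \<Rightarrow> ('l \<Rightarrow> 'x) \<Rightarrow> ('x, 'l) triv set \<Rightarrow> bool"
  where
  "holo_line_bundle X A pr T \<longleftrightarrow>
     (\<Union>c\<in>T. fst c) = X \<and>
     (\<forall>(U, \<psi>)\<in>T. openin (top_of_set X) U \<and> (\<forall>x\<in>U. bij_betw \<psi> {v. pr v = x} UNIV)) \<and>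
     (\<forall>(U, \<psi>)\<in>T. \<forall>(U', \<psi>')\<in>T. \<exists>g. mholo_on A g (U \<inter> U') \<and> (\<forall>x\<in>U \<inter> U'. g x \<noteq> 0) \<and>
        (\<forall>v. pr v \<in> U \<inter> U' \<longrightarrow> \<psi>' v = g (pr v) * \<psi> v))"

text \<open>\<open>\<tau>\<close> is the fibre component of a global topological trivialization of the bundle over \<open>Y\<close>.\<close>

definition topologically_trivial_on ::
  "'x::topological_space set \<Rightarrow> ('l \<Rightarrow> 'x) \<Rightarrow> ('x, 'l) triv set \<Rightarrow> bool" where
  "topologically_trivial_on Y pr T \<longleftrightarrow>
     (\<exists>\<tau>. \<forall>(U, \<psi>)\<in>T. \<exists>g. continuous_on (U \<inter> Y) g \<and> (\<forall>x\<in>U \<inter> Y. g x \<noteq> (0::complex)) \<and>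
        (\<forall>v. pr v \<in> U \<inter> Y \<longrightarrow> \<tau> v = g (pr v) * \<psi> v))"

definition holo_frame ::
  "'x::topological_space set \<Rightarrow> ('x, 'n::finite) chart set \<Rightarrow> ('l \<Rightarrow> 'x) \<Rightarrow> ('x, 'l) triv set \<Rightarrow>
   'x set \<Rightarrow> ('x \<Rightarrow> 'l) \<Rightarrow> bool" where
  "holo_frame X A pr T V e \<longleftrightarrow>
     openin (top_of_set X) V \<and> (\<forall>p\<in>V. pr (e p) = p) \<and>
     (\<forall>(U, \<psi>)\<in>T. mholo_on A (\<psi> \<circ> e) (U \<inter> V) \<and> (\<forall>p\<in>U \<inter> V. \<psi> (e p) \<noteq> 0))"

text \<open>The quotient \<open>s / s'\<close> of two local sections, computed in any trivialization.\<close>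

definition section_quot ::
  "('x, 'l) triv set \<Rightarrow> ('x \<Rightarrow> 'l) \<Rightarrow> ('x \<Rightarrow> 'l) \<Rightarrow> 'x \<Rightarrow> complex" where
  "section_quot T s s' p =
     (let (U, \<psi>) = (SOME c. c \<in> T \<and> p \<in> fst c) in \<psi> (s p) / \<psi> (s' p))"

section \<open>Hermitian metrics and semi-positivity\<close>

text \<open>\<open>h u v\<close> is the Hermitian inner product of two vectors in the same fibre; in a trivialization
  it is \<open>H \<psi>(u) cnj \<psi>(v)\<close> with a positive \<open>C\<^sup>\<infinity>\<close> function \<open>H\<close> on the base.\<close>

definition hermitian_metric ::
  "('x, 'n::finite) chart set \<Rightarrow> ('l \<Rightarrow> 'x) \<Rightarrow> ('x, 'l) triv set \<Rightarrow> ('l \<Rightarrow> 'l \<Rightarrow> complex) \<Rightarrow> bool"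
  where
  "hermitian_metric A pr T h \<longleftrightarrow>
     (\<forall>(U, \<psi>)\<in>T. \<exists>H::'x \<Rightarrow> real. msmooth_on A H U \<and> (\<forall>x\<in>U. H x > 0) \<and>
        (\<forall>u v. pr u \<in> U \<and> pr v = pr u \<longrightarrow>
           h u v = of_real (H (pr u)) * \<psi> u * cnj (\<psi> v)))"

text \<open>With \<open>H = h(e, e)\<close> for a holomorphic frame \<open>e\<close>, the Chern connection form is
  \<open>\<theta> = H\<^sup>-\<^sup>1 \<partial>H\<close> and the curvature is its \<open>\<partial>\<close>-bar; \<open>chern_curv\<close> is the coefficient of
  \<open>dx\<^sub>i \<and> d\<close>(conjugate of \<open>x\<^sub>j\<close>), whence the minus sign.\<close>

definition chern_conn ::
  "('l \<Rightarrow> 'l \<Rightarrow> complex) \<Rightarrow> ('x \<Rightarrow> 'l) \<Rightarrow> ('x, 'n::finite) chart \<Rightarrow> 'n \<Rightarrow> complex^'n \<Rightarrow> complex" where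
  "chern_conn h e = (\<lambda>(U, \<phi>) i x.
     let H = (\<lambda>y. h (e (inv_into U \<phi> y)) (e (inv_into U \<phi> y))) in wirt i H x / H x)"

definition chern_curv ::
  "('l \<Rightarrow> 'l \<Rightarrow> complex) \<Rightarrow> ('x \<Rightarrow> 'l) \<Rightarrow> ('x, 'n::finite) chart \<Rightarrow> 'n \<Rightarrow> 'n \<Rightarrow> complex^'n \<Rightarrow> complex"
  where
  "chern_curv h e c i j x = - wirt_bar j (chern_conn h e c i) x"

text \<open>\<open>\<i> \<Theta> \<ge> 0\<close> means that the coefficient matrix of \<open>\<Theta>\<close> is Hermitian positive
  semidefinite.\<close>

definition semi_positive ::
  "'x::topological_space set \<Rightarrow> ('x, 'n::finite) chart set \<Rightarrow> ('l \<Rightarrow> 'x) \<Rightarrow> ('x, 'l) triv set \<Rightarrow> bool"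
  where
  "semi_positive X A pr T \<longleftrightarrow>
     (\<exists>h. hermitian_metric A pr T h \<and>
        (\<forall>V e. holo_frame X A pr T V e \<longrightarrow>
           (\<forall>c\<in>A. \<forall>x\<in>snd c ` (fst c \<inter> V). \<forall>v.
              (\<Sum>i\<in>UNIV. \<Sum>j\<in>UNIV. chern_curv h e c i j x * v $ i * cnj (v $ j)) \<in> \<real>\<^sub>\<ge>\<^sub>0)))"

section \<open>The obstruction class\<close>

text \<open>The choices entering the definition of the class: coverings, coordinates, retractions,
  defining functions, frames, unitary constants, and the expansion coefficients
  \<open>f\<^sub>k\<^sub>j\<^sub>,\<^sub>\<alpha>\<close> = \<open>coef D k j \<alpha>\<close>.\<close>

record ('x, 'l, 'd, 'r) u1_choice =
  num :: nat
  covY :: "nat \<Rightarrow> 'x set"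
  covX :: "nat \<Rightarrow> 'x set"
  zco :: "nat \<Rightarrow> 'x \<Rightarrow> complex^'d"
  wfun :: "nat \<Rightarrow> 'x \<Rightarrow> complex^'r"
  retr :: "nat \<Rightarrow> 'x \<Rightarrow> 'x"
  frm :: "nat \<Rightarrow> 'x \<Rightarrow> 'l"
  tcon :: "nat \<Rightarrow> nat \<Rightarrow> complex"
  coef :: "nat \<Rightarrow> nat \<Rightarrow> ('r \<Rightarrow> nat) \<Rightarrow> 'x \<Rightarrow> complex"

text \<open>The class is independent of the choices; statements about it are made for an arbitrary
  admissible choice. That \<open>(z \<circ> Pr, w)\<close> is a holomorphic chart comprises the holomorphy of
  \<open>w\<close> and of the retraction, and the transversality of \<open>w = 0\<close>. The expansion
  \<open>t\<^sub>j\<^sub>k\<^sup>-\<^sup>1 e\<^sub>k / e\<^sub>j = 1 + \<Sum> f\<^sub>k\<^sub>j\<^sub>,\<^sub>\<alpha>(z\<^sub>j) w\<^sub>j\<^sup>\<alpha>\<close> is required on some neighbourhood \<open>W\<close> of the overlap.\<close>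

definition admissible_u1_choice ::
  "'x::topological_space set \<Rightarrow> ('x, 'd::finite + 'r::finite) chart set \<Rightarrow> 'x set \<Rightarrow>
   ('l \<Rightarrow> 'x) \<Rightarrow> ('x, 'l) triv set \<Rightarrow> ('x, 'l, 'd, 'r) u1_choice \<Rightarrow> bool" where
  "admissible_u1_choice X A Y pr T D \<longleftrightarrow>
     finite_open_cover Y (num D) (covY D) \<and>
     (\<forall>j<num D.
        holo_chart Y (sub_atlas X A Y) (covY D j, zco D j) \<and>
        stein_open X A (covX D j) \<and>
        covX D j \<inter> Y = covY D j \<and>
        retr D j ` covX D j = covY D j \<and> (\<forall>p\<in>covY D j. retr D j p = p) \<and>
        {p\<in>covX D j. wfun D j p = 0} = covY D j \<and>
        holo_chart X A (covX D j,
          \<lambda>p. \<chi> i. case i of Inl a \<Rightarrow> zco D j (retr D j p) $ a | Inr l \<Rightarrow> wfun D j p $ l) \<and>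
        holo_frame X A pr T (covX D j) (frm D j)) \<and>
     (\<forall>j<num D. \<forall>k<num D.
        cmod (tcon D j k) = 1 \<and>
        (\<forall>p\<in>covY D j \<inter> covY D k.
           inverse (tcon D j k) * section_quot T (frm D k) (frm D j) p = 1) \<and>
        (\<forall>\<alpha>. mholo_on (sub_atlas X A Y) (coef D k j \<alpha>) (covY D j \<inter> covY D k)) \<and>
        (\<exists>W. openin (top_of_set X) W \<and> covY D j \<inter> covY D k \<subseteq> W \<and>
             W \<subseteq> covX D j \<inter> covX D k \<and> retr D j ` W \<subseteq> covY D j \<inter> covY D k \<and>
             (\<forall>p\<in>W. ((\<lambda>\<alpha>. coef D k j \<alpha> (retr D j p) * (\<Prod>l\<in>UNIV. wfun D j p $ l ^ \<alpha> l)) has_sum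
                       (inverse (tcon D j k) * section_quot T (frm D k) (frm D j) p - 1))
                     {\<alpha>. (\<Sum>l\<in>UNIV. \<alpha> l) \<ge> 1})))"

text \<open>The multi-index of length one with entry 1 in position \<open>l\<close> is \<open>\<lambda>m. of_bool (m = l)\<close>.\<close>

definition u1_cocycle ::
  "('x, 'd::finite + 'r::finite) chart set \<Rightarrow> ('x, 'l, 'd, 'r) u1_choice \<Rightarrow>
   nat \<Rightarrow> nat \<Rightarrow> 'x \<Rightarrow> complex^('d + 'r)" where
  "u1_cocycle A D j k p =
     (\<Sum>l\<in>UNIV. coef D k j (\<lambda>m. of_bool (m = l)) p *s covec A (\<lambda>q. wfun D j q $ l) p)"

definition u1_class ::
  "'x::topological_space set \<Rightarrow> ('x, 'd::finite + 'r::finite) chart set \<Rightarrow> 'x set \<Rightarrow>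
   ('x, 'l, 'd, 'r) u1_choice \<Rightarrow> ('x, complex^('d + 'r)) cochain1 set" where
  "u1_class X A Y D = H1_class Y (conormal_sheaf X A Y) (num D, covY D, u1_cocycle A D)"

end

theory Submission
  imports Defs "HOL-Complex_Analysis.Cauchy_Integral_Formula"
begin

text \<open>Suppose that \<open>h\<close> is a Hermitian metric whose curvature is nonnegative, and let \<open>e_j\<close> be the
  frames of the given choice. Put \<open>F_j = ln h(e_j, e_j)\<close>. The curvature is minus the complex Hessian of
  \<open>F_j\<close>, so \<open>F_j\<close> is plurisuperharmonic. On the submanifold \<open>Y\<close> the frames differ by unitary constants;
  there the \<open>F_j\<close> agree and form a single function on the compact space \<open>Y\<close>. By the strong maximum
  principle this function is locally constant
  (\<open>local_minimum_principle\<close>, \<open>locally_constant_if_local_minimum_principle\<close>).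

  Consequently the Levi form of \<open>F_j\<close> vanishes on the vectors tangent to \<open>Y\<close>. Since it is
  semi-definite, these vectors lie in its kernel, and this means that the coefficients of the
  (1,0)-form \<open>del F_j\<close> are holomorphic along \<open>Y\<close> (\<open>wirt_holo_along_submanifold\<close>). As \<open>F_j\<close> is locally
  constant on \<open>Y\<close>, the form annihilates the tangent vectors of \<open>Y\<close>. Hence \<open>del F_j\<close> restricts to a
  section of the conormal sheaf over the set \<open>U_j\<close> of the covering of \<open>Y\<close> (\<open>del_conormal\<close>).

  On overlaps \<open>F_k = F_j + ln |g|^2\<close>, where \<open>g = 1 + \<Sum> f_\<alpha> w_j^\<alpha>\<close> is the transition function
  \<open>t_jk^-1 e_k / e_j\<close>. Along \<open>Y\<close> this gives \<open>del F_k - del F_j = dg = \<Sum> f_l dw_j^l\<close>, where \<open>l\<close> runs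
  through the indices of length one (\<open>del_log_norm_diff\<close>, \<open>u1_cocycle_eq_del\<close>). So the cocycle that
  defines the obstruction class is the coboundary of the sections \<open>del F_j\<close>, and the class vanishes
  (\<open>H1_class_coboundary\<close>).

  Two analytic facts carry the argument. First, partial derivatives of holomorphic functions of
  several variables are holomorphic (\<open>cdiff_directional_derivative\<close>); this is used for changes of
  coordinates in the conormal sheaf and for the regularity of \<open>F_j\<close>. Secondly, there is Hopf's form of the
  maximum principle (\<open>strong_maximum_principle_disc\<close>). Curvature is given in the charts of the atlas,
  whereas \<open>Y\<close> is described by slice charts; the two are compared along holomorphic discs
  (\<open>laplacian_along_disc\<close>, \<open>slice_line_disc\<close>), so that the transformation of the Levi form only needs
  derivatives in one variable.\<close>

section \<open>Wirtinger calculus\<close>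

lemma norm_cscale: "norm (c *s v) = cmod c * norm (v::complex^'n)"
  by (simp add: norm_vec_def norm_mult L2_set_right_distrib)

lemma vec_real_expansion:
  "v = (\<Sum>i\<in>UNIV. Re (v$i) *\<^sub>R axis i 1 + Im (v$i) *\<^sub>R axis i \<i>)" for v :: "complex^'n"
  by (auto simp: vec_eq_iff axis_def sum.distrib if_distrib cong: if_cong intro: complex_eqI)

text \<open>Complex differentiability is kept pointwise because the curvature argument on the submanifold
  yields complex linearity of a derivative at one point at a time.\<close>

definition cdiff_at :: "(complex^'n \<Rightarrow> complex) \<Rightarrow> complex^'n \<Rightarrow> bool" where
  "cdiff_at f x \<longleftrightarrow> (\<exists>f'. (f has_derivative f') (at x) \<and> (\<forall>c v. f' (c *s v) = c * f' v))"

lemma cholo_on_alt: "cholo_on f S \<longleftrightarrow> (\<forall>x\<in>S. cdiff_at f x)"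
  by (simp add: cholo_on_def cdiff_at_def)

text \<open>A real linear map is the sum of a complex linear and a conjugate linear one. For a
  derivative the coefficients of the two parts are the Wirtinger derivatives.\<close>

lemma linear_wirtinger_decomposition:
  fixes f' :: "complex^'n \<Rightarrow> complex"
  assumes "linear f'"
  shows "f' v = (\<Sum>i\<in>UNIV. (f' (axis i 1) - \<i> * f' (axis i \<i>)) / 2 * v$i +
                           (f' (axis i 1) + \<i> * f' (axis i \<i>)) / 2 * cnj (v$i))"
proof -
  have "f' v = f' (\<Sum>i\<in>UNIV. Re (v$i) *\<^sub>R axis i 1 + Im (v$i) *\<^sub>R axis i \<i>)"
    by (rule arg_cong[OF vec_real_expansion])
  also have "\<dots> = (\<Sum>i\<in>UNIV. Re (v$i) *\<^sub>R f' (axis i 1) + Im (v$i) *\<^sub>R f' (axis i \<i>))"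
    by (simp add: linear_sum[OF assms] linear_add[OF assms] linear_scale[OF assms])
  also have "\<dots> = (\<Sum>i\<in>UNIV. (f' (axis i 1) - \<i> * f' (axis i \<i>)) / 2 * v$i +
                           (f' (axis i 1) + \<i> * f' (axis i \<i>)) / 2 * cnj (v$i))"
    by (intro sum.cong refl) (simp add: complex_eq_iff field_simps)
  finally show ?thesis .
qed

lemma frechet_wirtinger:
  assumes "f differentiable (at x)"
  shows "frechet_derivative f (at x) v = (\<Sum>i\<in>UNIV. wirt i f x * v$i + wirt_bar i f x * cnj (v$i))"
  using linear_wirtinger_decomposition[OF linear_frechet_derivative[OF assms], of v]
  by (simp add: wirt_def wirt_bar_def)

lemma wirt_of_derivative:
  assumes "(f has_derivative f') (at x)"
  shows "wirt i f x = (f' (axis i 1) - \<i> * f' (axis i \<i>)) / 2"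
    and "wirt_bar i f x = (f' (axis i 1) + \<i> * f' (axis i \<i>)) / 2"
  using frechet_derivative_at[OF assms] by (simp_all add: wirt_def wirt_bar_def)

lemma cdiff_imp_differentiable: "cdiff_at f x \<Longrightarrow> f differentiable (at x)"
  unfolding cdiff_at_def differentiable_def by blast

lemma cdiff_frechet:
  assumes "cdiff_at f x"
  shows "frechet_derivative f (at x) (c *s v) = c * frechet_derivative f (at x) v"
  using assms unfolding cdiff_at_def by (metis frechet_derivative_at)

lemma axis_ii: "axis i \<i> = \<i> *s (axis i 1 :: complex^'n)"
  by (simp add: vec_eq_iff axis_def)

lemma cdiff_wirt:
  assumes "cdiff_at f x"
  shows "wirt_bar i f x = 0" "wirt i f x = frechet_derivative f (at x) (axis i 1)"
  using cdiff_frechet[OF assms, of \<i> "axis i 1"] unfolding wirt_def wirt_bar_def axis_ii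
  by simp_all

text \<open>The Cauchy-Riemann equations: complex linearity of the derivative is the absence of its
  conjugate linear part.\<close>

lemma cdiff_iff_wirt_bar:
  "cdiff_at f x \<longleftrightarrow> f differentiable (at x) \<and> (\<forall>i. wirt_bar i f x = 0)"
proof
  assume "cdiff_at f x"
  then show "f differentiable (at x) \<and> (\<forall>i. wirt_bar i f x = 0)"
    using cdiff_imp_differentiable cdiff_wirt by blast
next
  assume a: "f differentiable (at x) \<and> (\<forall>i. wirt_bar i f x = 0)"
  then have "frechet_derivative f (at x) v = (\<Sum>i\<in>UNIV. wirt i f x * v$i)" for v
    by (simp add: frechet_wirtinger)
  then have "\<forall>c v. frechet_derivative f (at x) (c *s v) = c * frechet_derivative f (at x) v"
    by (simp add: sum_distrib_left mult_ac)
  with a show "cdiff_at f x"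
    unfolding cdiff_at_def using frechet_derivative_works by blast
qed

lemma cdiff_frechet_sum:
  assumes "cdiff_at f x"
  shows "frechet_derivative f (at x) v = (\<Sum>i\<in>UNIV. wirt i f x * v$i)"
  using frechet_wirtinger[OF cdiff_imp_differentiable[OF assms]] cdiff_wirt(1)[OF assms] by simp

lemma cdiff_const: "cdiff_at (\<lambda>_. c) x"
  unfolding cdiff_at_def by (intro exI[of _ "\<lambda>_. 0"]) (auto intro!: derivative_eq_intros)

lemma cdiff_coord: "cdiff_at (\<lambda>x. x $ i) x"
  unfolding cdiff_at_def
  by (intro exI[of _ "\<lambda>v. v $ i"] conjI bounded_linear_imp_has_derivative bounded_linear_vec_nth) auto

lemma cdiff_add: "cdiff_at f x \<Longrightarrow> cdiff_at g x \<Longrightarrow> cdiff_at (\<lambda>x. f x + g x) x"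
  unfolding cdiff_at_def
  by (elim exE conjE, rule exI, intro conjI, erule (1) has_derivative_add) (simp add: algebra_simps)

lemma cdiff_diff: "cdiff_at f x \<Longrightarrow> cdiff_at g x \<Longrightarrow> cdiff_at (\<lambda>x. f x - g x) x"
  unfolding cdiff_at_def
  by (elim exE conjE, rule exI, intro conjI, erule (1) has_derivative_diff) (simp add: algebra_simps)

lemma cdiff_mult: "cdiff_at f x \<Longrightarrow> cdiff_at g x \<Longrightarrow> cdiff_at (\<lambda>x. f x * g x) x"
  unfolding cdiff_at_def
  by (elim exE conjE, rule exI, intro conjI, erule (1) has_derivative_mult) (simp add: algebra_simps)

lemma cdiff_sum: "(\<And>i. i \<in> I \<Longrightarrow> cdiff_at (f i) x) \<Longrightarrow> cdiff_at (\<lambda>x. \<Sum>i\<in>I. f i x) x"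
  by (induction I rule: infinite_finite_induct) (auto intro: cdiff_const cdiff_add)

lemma cdiff_divide:
  assumes "cdiff_at f x" "cdiff_at g x" "g x \<noteq> 0"
  shows "cdiff_at (\<lambda>x. f x / g x) x"
proof -
  obtain f' g' where f: "(f has_derivative f') (at x)" "\<And>c v. f' (c *s v) = c * f' v"
    and g: "(g has_derivative g') (at x)" "\<And>c v. g' (c *s v) = c * g' v"
    using assms unfolding cdiff_at_def by blast
  have "((\<lambda>x. f x / g x) has_derivative
      (\<lambda>h. (f' h * g x - f x * g' h) / (g x * g x))) (at x)"
    by (rule has_derivative_divide'[OF f(1) g(1) assms(3)])
  then show ?thesis unfolding cdiff_at_def
    by (intro exI conjI) (auto simp: f g field_simps)
qed

lemma cdiff_transform:
  assumes "cdiff_at f x" "open S" "x \<in> S" "\<And>y. y \<in> S \<Longrightarrow> f y = g y"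
  shows "cdiff_at g x"
  using assms unfolding cdiff_at_def by (metis has_derivative_transform_within_open)

lemma wirt_transform:
  assumes "f differentiable (at x)" "open S" "x \<in> S" "\<And>y. y \<in> S \<Longrightarrow> f y = g y"
  shows "wirt i f x = wirt i g x" "wirt_bar i f x = wirt_bar i g x"
  unfolding wirt_def wirt_bar_def using frechet_derivative_transform_within_open[OF assms] by simp_all

lemma has_derivative_vec_components:
  fixes \<Psi> :: "'a::real_normed_vector \<Rightarrow> complex^'n"
  assumes "\<And>k. ((\<lambda>y. \<Psi> y $ k) has_derivative (\<lambda>v. D v $ k)) (at x)"
  shows "(\<Psi> has_derivative D) (at x)"
proof (subst has_derivative_componentwise_within, rule ballI)
  fix b :: "complex^'n" assume "b \<in> Basis"
  then obtain k u where b: "b = axis k u" by (auto simp: Basis_vec_def)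
  show "((\<lambda>y. \<Psi> y \<bullet> b) has_derivative (\<lambda>v. D v \<bullet> b)) (at x)"
    unfolding b inner_axis by (intro has_derivative_inner_left assms)
qed

lemma cdiff_map_derivative:
  fixes \<Psi> :: "complex^'m \<Rightarrow> complex^'n"
  assumes "\<And>k. cdiff_at (\<lambda>y. \<Psi> y $ k) x"
  shows "(\<Psi> has_derivative (\<lambda>v. \<chi> k. \<Sum>i\<in>UNIV. wirt i (\<lambda>y. \<Psi> y $ k) x * v $ i)) (at x)"
proof (rule has_derivative_vec_components)
  fix k
  have "frechet_derivative (\<lambda>y. \<Psi> y $ k) (at x) = (\<lambda>v. \<Sum>i\<in>UNIV. wirt i (\<lambda>y. \<Psi> y $ k) x * v $ i)"
    using cdiff_frechet_sum[OF assms] by blast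
  then show "((\<lambda>y. \<Psi> y $ k) has_derivative
      (\<lambda>v. (\<chi> k. \<Sum>i\<in>UNIV. wirt i (\<lambda>y. \<Psi> y $ k) x * v $ i) $ k)) (at x)"
    using cdiff_imp_differentiable[OF assms, of k] unfolding frechet_derivative_works by simp
qed

text \<open>The derivative of a holomorphic inner map is complex linear, hence it does not mix the
  complex linear and the conjugate linear part of the derivative of the outer function.\<close>

lemma wirt_chain:
  fixes \<Psi> :: "complex^'m \<Rightarrow> complex^'n"
  assumes \<Psi>: "\<And>k. cdiff_at (\<lambda>y. \<Psi> y $ k) x" and f: "f differentiable (at (\<Psi> x))"
  shows "(f \<circ> \<Psi>) differentiable (at x)"
    and "wirt i (f \<circ> \<Psi>) x = (\<Sum>k\<in>UNIV. wirt k f (\<Psi> x) * wirt i (\<lambda>y. \<Psi> y $ k) x)"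
    and "wirt_bar i (f \<circ> \<Psi>) x = (\<Sum>k\<in>UNIV. wirt_bar k f (\<Psi> x) * cnj (wirt i (\<lambda>y. \<Psi> y $ k) x))"
proof -
  define D :: "complex^'m \<Rightarrow> complex^'n" where
    "D = (\<lambda>v. \<chi> k. \<Sum>i\<in>UNIV. wirt i (\<lambda>y. \<Psi> y $ k) x * v $ i)"
  have D: "(\<Psi> has_derivative D) (at x)"
    unfolding D_def by (rule cdiff_map_derivative[OF \<Psi>])
  have Dax: "D (axis i u) $ k = wirt i (\<lambda>y. \<Psi> y $ k) x * u" for i u k
    by (simp add: D_def axis_def if_distrib cong: if_cong)
  have fd: "(f has_derivative frechet_derivative f (at (\<Psi> x))) (at (\<Psi> x))"
    using f frechet_derivative_works by blast
  have comp: "(f \<circ> \<Psi> has_derivative (frechet_derivative f (at (\<Psi> x)) \<circ> D)) (at x)"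
    using D fd by (rule diff_chain_at)
  then show "(f \<circ> \<Psi>) differentiable (at x)"
    unfolding differentiable_def by blast
  have "wirt i (f \<circ> \<Psi>) x = (frechet_derivative f (at (\<Psi> x)) (D (axis i 1))
      - \<i> * frechet_derivative f (at (\<Psi> x)) (D (axis i \<i>))) / 2"
    using wirt_of_derivative(1)[OF comp, of i] by (simp only: o_apply)
  then show "wirt i (f \<circ> \<Psi>) x = (\<Sum>k\<in>UNIV. wirt k f (\<Psi> x) * wirt i (\<lambda>y. \<Psi> y $ k) x)"
    unfolding frechet_wirtinger[OF f] Dax sum_distrib_left sum_subtractf[symmetric] sum_divide_distrib
    by (simp add: algebra_simps)
  have "wirt_bar i (f \<circ> \<Psi>) x = (frechet_derivative f (at (\<Psi> x)) (D (axis i 1))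
      + \<i> * frechet_derivative f (at (\<Psi> x)) (D (axis i \<i>))) / 2"
    using wirt_of_derivative(2)[OF comp, of i] by (simp only: o_apply)
  then show "wirt_bar i (f \<circ> \<Psi>) x = (\<Sum>k\<in>UNIV. wirt_bar k f (\<Psi> x) * cnj (wirt i (\<lambda>y. \<Psi> y $ k) x))"
    unfolding frechet_wirtinger[OF f] Dax sum_distrib_left sum.distrib[symmetric] sum_divide_distrib
    by (simp add: algebra_simps)
qed

lemma cdiff_compose:
  fixes \<Psi> :: "complex^'m \<Rightarrow> complex^'n"
  assumes \<Psi>: "\<And>k. cdiff_at (\<lambda>y. \<Psi> y $ k) x" and f: "cdiff_at f (\<Psi> x)"
  shows "cdiff_at (f \<circ> \<Psi>) x"
  using wirt_chain[OF \<Psi> cdiff_imp_differentiable[OF f]] cdiff_wirt(1)[OF f]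
  by (auto simp: cdiff_iff_wirt_bar)

section \<open>Derivatives of holomorphic functions of several variables\<close>

lemma cdiff_line_derivative:
  assumes "cdiff_at f (x + \<zeta> *s k)"
  shows "((\<lambda>\<zeta>. f (x + \<zeta> *s k)) has_field_derivative frechet_derivative f (at (x + \<zeta> *s k)) k) (at \<zeta>)"
proof -
  have "((\<lambda>\<zeta>. x + \<zeta> *s k) has_derivative (\<lambda>h. h *s k)) (at \<zeta>)"
    by (rule has_derivative_vec_components) (auto intro!: derivative_eq_intros)
  moreover have "(f has_derivative frechet_derivative f (at (x + \<zeta> *s k))) (at (x + \<zeta> *s k))"
    using cdiff_imp_differentiable[OF assms] frechet_derivative_works by blast
  ultimately have "(f \<circ> (\<lambda>\<zeta>. x + \<zeta> *s k) has_derivative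
      (frechet_derivative f (at (x + \<zeta> *s k)) \<circ> (\<lambda>h. h *s k))) (at \<zeta>)"
    by (rule diff_chain_at)
  then show ?thesis
    unfolding has_field_derivative_def o_def cdiff_frechet[OF assms] by (simp add: mult.commute[of _ "frechet_derivative f _ k"] )
qed

text \<open>Taylor's formula at \<open>0\<close>, evaluated at \<open>1\<close>. The second derivative is bounded on the disc of
  radius \<open>R/2\<close>, which contains \<open>1\<close>, by Cauchy's estimate on discs of radius \<open>R/4\<close>; the constant is
  \<open>64 = 2! * 2 * 16\<close>, where one factor \<open>2\<close> makes the bound on \<open>g\<close> strict.\<close>

lemma holomorphic_linear_approximation:
  assumes hol: "g holomorphic_on ball 0 R" and bd: "\<And>z. z \<in> ball 0 R \<Longrightarrow> cmod (g z) \<le> M"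
    and R: "2 \<le> R" and M: "0 < M"
  shows "cmod (g 1 - g 0 - deriv g 0) \<le> 64 * M / R\<^sup>2"
proof -
  define S :: "complex set" where "S = cball 0 (R/2)"
  have R0: "0 < R" using R by simp
  have sub: "S \<subseteq> ball 0 R" using R0 by (auto simp: S_def)
  have hold: "deriv g holomorphic_on ball 0 R" using hol by (rule holomorphic_deriv) simp
  have B: "cmod (deriv (deriv g) z) \<le> 64 * M / R\<^sup>2" if "z \<in> S" for z
  proof -
    have b: "cball z (R/4) \<subseteq> ball 0 R"
    proof
      fix y assume "y \<in> cball z (R/4)"
      then have "cmod y \<le> cmod z + R/4"
        using norm_triangle_sub[of y z] by (simp add: dist_norm norm_minus_commute)
      then show "y \<in> ball 0 R" using that R0 by (simp add: S_def)
    qed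
    have "cmod ((deriv ^^ 2) g z) \<le> fact 2 * (2 * M) / (R/4)^2"
    proof (rule Cauchy_higher_deriv_bound)
      show "g holomorphic_on ball z (R/4)"
        using hol b ball_subset_cball by (meson holomorphic_on_subset order_trans)
      show "continuous_on (cball z (R/4)) g"
        using holomorphic_on_imp_continuous_on[OF hol] b by (rule continuous_on_subset)
      show "g w \<in> ball 0 (2 * M)" if "w \<in> ball z (R/4)" for w
        using bd[of w] that b M by force
    qed (use R0 in auto)
    also have "\<dots> = 64 * M / R\<^sup>2" by (simp add: power2_eq_square)
    finally show ?thesis by (simp add: numeral_2_eq_2)
  qed
  have "cmod ((deriv ^^ 0) g 1 - (\<Sum>i\<le>1. (deriv ^^ i) g 0 * (1 - 0) ^ i / fact i))
      \<le> 64 * M / R\<^sup>2 * cmod (1 - 0) ^ Suc 1 / fact 1"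
  proof (rule field_Taylor[where S = S])
    fix i :: nat and x assume x: "x \<in> S" and i: "i \<le> 1"
    have "(deriv ^^ i) g holomorphic_on ball 0 R" by (rule holomorphic_higher_deriv[OF hol]) simp
    then show "((deriv ^^ i) g has_field_derivative (deriv ^^ Suc i) g x) (at x within S)"
      using holomorphic_derivI[OF _ open_ball subsetD[OF sub x]] by simp
  qed (use R B in \<open>auto simp: S_def\<close>)
  then show ?thesis by (simp add: algebra_simps)
qed

text \<open>The point of this form is uniformity: the error is quadratic in \<open>k\<close> with a constant that
  depends on the direction of \<open>k\<close> and on \<open>x\<close> only through the bound \<open>M\<close>.\<close>

lemma line_linear_approximation:
  fixes Q :: "complex^'n \<Rightarrow> complex"
  assumes hol: "(\<lambda>\<zeta>. Q (x + \<zeta> *s k)) holomorphic_on {\<zeta>. cmod \<zeta> * norm k < 2 * \<rho>}"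
    and bd: "\<And>y. y \<in> ball x (2 * \<rho>) \<Longrightarrow> cmod (Q y) \<le> M"
    and k: "k \<noteq> 0" "norm k \<le> \<rho>" and M: "0 < M"
  shows "cmod (Q (x + k) - Q x - deriv (\<lambda>\<zeta>. Q (x + \<zeta> *s k)) 0) \<le> 16 * M / \<rho>\<^sup>2 * (norm k)\<^sup>2"
proof -
  have nk: "0 < norm k" using k by simp
  have set: "{\<zeta>. cmod \<zeta> * norm k < 2 * \<rho>} = ball 0 (2 * \<rho> / norm k)"
    using nk by (auto simp: field_simps)
  have "cmod (Q (x + 1 *s k) - Q (x + 0 *s k) - deriv (\<lambda>\<zeta>. Q (x + \<zeta> *s k)) 0)
      \<le> 64 * M / (2 * \<rho> / norm k)\<^sup>2"
  proof (rule holomorphic_linear_approximation)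
    show "(\<lambda>\<zeta>. Q (x + \<zeta> *s k)) holomorphic_on ball 0 (2 * \<rho> / norm k)" using hol set by simp
    show "cmod (Q (x + z *s k)) \<le> M" if "z \<in> ball 0 (2 * \<rho> / norm k)" for z
    proof (rule bd)
      have "z \<in> {\<zeta>. cmod \<zeta> * norm k < 2 * \<rho>}" using that unfolding set .
      then show "x + z *s k \<in> ball x (2 * \<rho>)" by (simp add: dist_norm norm_cscale)
    qed
    show "2 \<le> 2 * \<rho> / norm k" using k nk by (simp add: field_simps)
  qed fact
  then show ?thesis by (simp add: power_divide power_mult_distrib)
qed

text \<open>Holomorphy on complex lines gives derivatives in all directions \<open>k\<close>. The approximation by them
  is uniform in \<open>k\<close>, so they form a Frechet derivative as soon as they depend linearly on \<open>k\<close>.\<close>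

lemma cdiff_if_holo_on_lines:
  fixes Q :: "complex^'n \<Rightarrow> complex"
  assumes \<rho>: "0 < \<rho>"
    and der: "\<And>k \<zeta>. cmod \<zeta> * norm k < 2 * \<rho> \<Longrightarrow> (\<lambda>\<zeta>. Q (x + \<zeta> *s k)) field_differentiable (at \<zeta>)"
    and bd: "\<And>y. y \<in> ball x (2 * \<rho>) \<Longrightarrow> cmod (Q y) \<le> M"
    and l: "\<And>k. deriv (\<lambda>\<zeta>. Q (x + \<zeta> *s k)) 0 = l k"
    and add: "\<And>k k'. l (k + k') = l k + l k'"
    and scale: "\<And>c k. l (c *s k) = c * l k"
  shows "cdiff_at Q x"
proof -
  define M' where "M' = max M 1"
  have M': "0 < M'" by (simp add: M'_def)
  have "linear l"
    by (rule linearI) (simp_all add: add scale scalar_mult_eq_scaleR[symmetric]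
        scaleR_vec_def vector_scalar_mult_def scale[of "of_real _", unfolded vector_scalar_mult_def] scaleR_conv_of_real)
  then have bl: "bounded_linear l" by (simp add: linear_conv_bounded_linear)
  have l0: "l 0 = 0" using add[of 0 0] by simp
  have est: "cmod (Q (x + k) - Q x - l k) \<le> 16 * M' / \<rho>\<^sup>2 * (norm k)\<^sup>2" if "norm k \<le> \<rho>" for k
  proof (cases "k = 0")
    case False
    show ?thesis
      unfolding l[symmetric]
    proof (rule line_linear_approximation[OF _ _ False that M'])
      show "(\<lambda>\<zeta>. Q (x + \<zeta> *s k)) holomorphic_on {\<zeta>. cmod \<zeta> * norm k < 2 * \<rho>}"
        unfolding holomorphic_on_def using der field_differentiable_at_within by blast
      show "cmod (Q y) \<le> M'" if "y \<in> ball x (2 * \<rho>)" for y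
        using bd[OF that] by (simp add: M'_def)
    qed
  qed (simp add: l0)
  have "(Q has_derivative l) (at x)"
  proof (rule has_derivativeI_sandwich[OF \<rho> bl, where H = "\<lambda>y. 16 * M' / \<rho>\<^sup>2 * norm (y - x)"])
    fix y assume y: "y \<noteq> x" "dist y x < \<rho>"
    have "cmod (Q y - Q x - l (y - x)) \<le> 16 * M' / \<rho>\<^sup>2 * (norm (y - x))\<^sup>2"
      using est[of "y - x"] y by (simp add: dist_norm)
    then show "norm (Q y - Q x - l (y - x)) / norm (y - x) \<le> 16 * M' / \<rho>\<^sup>2 * norm (y - x)"
      using y by (simp add: divide_le_eq power2_eq_square mult.assoc)
  next
    show "((\<lambda>y. 16 * M' / \<rho>\<^sup>2 * norm (y - x)) \<longlongrightarrow> 0) (at x)"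
      by (intro tendsto_mult_right_zero tendsto_norm_zero LIM_zero tendsto_ident_at)
  qed
  with scale show ?thesis unfolding cdiff_at_def by blast
qed

text \<open>Differentiability of the derivative. The difference quotients of \<open>f\<close> in the direction \<open>v\<close> with
  steps \<open>1/m\<close> converge uniformly near \<open>x0\<close>, because the linear approximation of \<open>f\<close> is uniform. On a
  complex line the limit is therefore holomorphic, and its derivative is the limit of the derivatives
  of the quotients; these are complex linear in the direction of the line, hence so is the limit.\<close>

theorem cdiff_directional_derivative:
  fixes f :: "complex^'n \<Rightarrow> complex"
  assumes S: "open S" and f: "\<And>x. x \<in> S \<Longrightarrow> cdiff_at f x" and x0: "x0 \<in> S"
  shows "cdiff_at (\<lambda>x. frechet_derivative f (at x) v) x0"
proof -
  obtain e where e: "0 < e" "cball x0 e \<subseteq> S" using S x0 open_contains_cball by blast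
  define \<rho> where "\<rho> = e / 4"
  have \<rho>: "0 < \<rho>" using e by (simp add: \<rho>_def)
  have inS: "y \<in> S" if "norm (y - x0) < 4 * \<rho>" for y
    using that e(2) by (auto simp: \<rho>_def dist_norm norm_minus_commute)
  have "continuous_on (cball x0 e) f"
    using f e(2) by (intro continuous_at_imp_continuous_on ballI)
      (meson cdiff_imp_differentiable differentiable_imp_continuous_within subsetD)
  then have "bounded (f ` cball x0 e)"
    by (intro compact_imp_bounded compact_continuous_image) auto
  then obtain M where M: "0 < M" "\<And>y. y \<in> cball x0 e \<Longrightarrow> cmod (f y) \<le> M"
    by (force simp: bounded_pos)
  \<comment> \<open>The steps start at \<open>1/N\<close>, so that all of them stay inside the ball where \<open>f\<close> is bounded.\<close>
  obtain N :: nat where N: "0 < N" "norm v \<le> \<rho> * N"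
  proof -
    obtain N :: nat where "norm v / \<rho> < N" using reals_Archimedean2 by blast
    then show ?thesis using \<rho> that[of "Suc N"] by (simp add: field_simps)
  qed
  define q where "q x = frechet_derivative f (at x) v" for x
  define m :: "nat \<Rightarrow> real" where "m n = real (n + N)" for n
  have m: "0 < m n" for n using N(1) by (simp add: m_def)
  define v' where "v' n = (1 / m n) *\<^sub>R v" for n
  have v': "norm (v' n) \<le> \<rho>" for n
  proof -
    have "norm v \<le> \<rho> * m n" using N(2) \<rho> unfolding m_def
      by (smt (verit) mult_left_mono of_nat_le_iff le_add2)
    then show ?thesis using m[of n] by (simp add: v'_def field_simps)
  qed
  define F where "F n x = of_real (m n) * (f (x + v' n) - f x)" for n x
  have lin: "linear (frechet_derivative f (at x))" if "x \<in> S" for x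
    using f[OF that] cdiff_imp_differentiable linear_frechet_derivative by blast
  have approx: "cmod (F n x - q x) \<le> 16 * M / \<rho>\<^sup>2 * (norm v)\<^sup>2 / m n" if x: "norm (x - x0) < 2 * \<rho>" for n x
  proof (cases "v = 0")
    case True
    have "x \<in> S" using x \<rho> by (intro inS) simp
    then show ?thesis using True lin linear_0 by (auto simp: F_def q_def v'_def)
  next
    case False
    have xS: "x \<in> S" using x \<rho> by (intro inS) simp
    have mem: "y \<in> cball x0 e" "y \<in> S" if "y \<in> ball x (2 * \<rho>)" for y
    proof -
      have "norm (y - x0) < 4 * \<rho>"
        using that x norm_triangle_ineq[of "y - x" "x - x0"] by (simp add: dist_norm norm_minus_commute)
      then show "y \<in> S" "y \<in> cball x0 e" using inS by (auto simp: \<rho>_def dist_norm norm_minus_commute)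
    qed
    have ld: "((\<lambda>\<zeta>. f (x + \<zeta> *s v' n)) has_field_derivative frechet_derivative f (at (x + \<zeta> *s v' n)) (v' n)) (at \<zeta>)"
      if "cmod \<zeta> * norm (v' n) < 2 * \<rho>" for \<zeta>
      by (rule cdiff_line_derivative, rule f, rule mem(2)) (use that in \<open>simp add: dist_norm norm_cscale\<close>)
    have "deriv (\<lambda>\<zeta>. f (x + \<zeta> *s v' n)) 0 = frechet_derivative f (at x) (v' n)"
      using DERIV_imp_deriv[OF ld[of 0]] \<rho> by simp
    also have "\<dots> = of_real (1 / m n) * q x"
      unfolding v'_def q_def linear_scale[OF lin[OF xS]] by (simp only: scaleR_conv_of_real)
    finally have d: "deriv (\<lambda>\<zeta>. f (x + \<zeta> *s v' n)) 0 = of_real (1 / m n) * q x" .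
    have "cmod (f (x + v' n) - f x - of_real (1 / m n) * q x) \<le> 16 * M / \<rho>\<^sup>2 * (norm (v' n))\<^sup>2"
      unfolding d[symmetric]
    proof (rule line_linear_approximation[OF _ _ _ v' M(1)])
      show "(\<lambda>\<zeta>. f (x + \<zeta> *s v' n)) holomorphic_on {\<zeta>. cmod \<zeta> * norm (v' n) < 2 * \<rho>}"
        unfolding holomorphic_on_def using ld
        by (auto simp: field_differentiable_def intro: has_field_derivative_at_within)
      show "v' n \<noteq> 0" using False m[of n] by (simp add: v'_def)
    qed (use M(2) mem in blast)
    then have "m n * cmod (f (x + v' n) - f x - of_real (1 / m n) * q x)
        \<le> m n * (16 * M / \<rho>\<^sup>2 * (norm (v' n))\<^sup>2)"
      by (rule mult_left_mono[OF _ less_imp_le[OF m]])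
    also have "m n * cmod (f (x + v' n) - f x - of_real (1 / m n) * q x)
        = cmod (of_real (m n) * (f (x + v' n) - f x - of_real (1 / m n) * q x))"
      using m[of n] by (simp add: norm_mult)
    also have "of_real (m n) * (f (x + v' n) - f x - of_real (1 / m n) * q x) = F n x - q x"
      using m[of n] by (simp add: F_def algebra_simps)
    also have "m n * (16 * M / \<rho>\<^sup>2 * (norm (v' n))\<^sup>2) = 16 * M / \<rho>\<^sup>2 * (norm v)\<^sup>2 / m n"
      using m[of n] by (simp add: v'_def power_divide power2_eq_square)
    finally show ?thesis .
  qed
  have bound_lim: "(\<lambda>n. 16 * M / \<rho>\<^sup>2 * (norm v)\<^sup>2 / m n) \<longlonglongrightarrow> 0"
    unfolding m_def
    by (intro tendsto_divide_0[OF tendsto_const] filterlim_at_top_imp_at_infinity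
        filterlim_compose[OF filterlim_real_sequentially] filterlim_add_const_nat_at_top)
  have unif: "uniform_limit T (\<lambda>n y. F n (g y)) (\<lambda>y. q (g y)) sequentially"
    if "\<And>y. y \<in> T \<Longrightarrow> norm (g y - x0) < 2 * \<rho>" for T :: "complex set" and g
  proof (rule uniform_limitI)
    fix \<epsilon> :: real assume "0 < \<epsilon>"
    then have "\<forall>\<^sub>F n in sequentially. 16 * M / \<rho>\<^sup>2 * (norm v)\<^sup>2 / m n < \<epsilon>"
      using order_tendstoD(2)[OF bound_lim] by blast
    then show "\<forall>\<^sub>F n in sequentially. \<forall>y\<in>T. dist (F n (g y)) (q (g y)) < \<epsilon>"
    proof (rule eventually_mono, intro ballI)
      fix n y assume a: "16 * M / \<rho>\<^sup>2 * (norm v)\<^sup>2 / m n < \<epsilon>" and y: "y \<in> T"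
      show "dist (F n (g y)) (q (g y)) < \<epsilon>"
        using approx[OF that[OF y], of n] a by (simp add: dist_norm)
    qed
  qed
  define L where "L n k = of_real (m n) * (frechet_derivative f (at (x0 + v' n)) k - frechet_derivative f (at x0) k)" for n k
  have line: "\<exists>g'. \<forall>\<eta>\<in>{\<eta>. cmod \<eta> * norm k < 2 * \<rho>}.
      ((\<lambda>\<eta>. q (x0 + \<eta> *s k)) has_field_derivative g' \<eta>) (at \<eta>) \<and>
      ((\<lambda>n. of_real (m n) * (frechet_derivative f (at (x0 + v' n + \<eta> *s k)) k
              - frechet_derivative f (at (x0 + \<eta> *s k)) k)) \<longlonglongrightarrow> g' \<eta>)" for k
  proof (rule has_complex_derivative_uniform_sequence[where f = "\<lambda>n \<eta>. F n (x0 + \<eta> *s k)"])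
    show op: "open {\<eta>. cmod \<eta> * norm k < 2 * \<rho>}"
      by (intro open_Collect_less continuous_intros)
    show "((\<lambda>\<eta>. F n (x0 + \<eta> *s k)) has_field_derivative
        of_real (m n) * (frechet_derivative f (at (x0 + v' n + \<eta> *s k)) k
              - frechet_derivative f (at (x0 + \<eta> *s k)) k)) (at \<eta>)"
      if "\<eta> \<in> {\<eta>. cmod \<eta> * norm k < 2 * \<rho>}" for n \<eta>
    proof -
      have eta: "norm (\<eta> *s k) < 2 * \<rho>" using that by (simp add: norm_cscale)
      have "x0 + v' n + \<eta> *s k \<in> S"
        using eta v'[of n] norm_triangle_ineq[of "v' n" "\<eta> *s k"] \<rho> by (intro inS) (simp add: add.assoc)
      moreover have "x0 + \<eta> *s k \<in> S" using eta \<rho> by (intro inS) simp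
      ultimately have "((\<lambda>\<eta>. f (x0 + v' n + \<eta> *s k)) has_field_derivative
          frechet_derivative f (at (x0 + v' n + \<eta> *s k)) k) (at \<eta>)"
        "((\<lambda>\<eta>. f (x0 + \<eta> *s k)) has_field_derivative
          frechet_derivative f (at (x0 + \<eta> *s k)) k) (at \<eta>)"
        by (auto intro!: cdiff_line_derivative f)
      from DERIV_cmult[OF DERIV_diff[OF this]] show ?thesis
        by (simp add: F_def add_ac)
    qed
    fix \<eta> assume h: "\<eta> \<in> {\<eta>. cmod \<eta> * norm k < 2 * \<rho>}"
    then obtain d where d: "0 < d" "cball \<eta> d \<subseteq> {\<eta>. cmod \<eta> * norm k < 2 * \<rho>}"
      using op open_contains_cball by blast
    have "uniform_limit (cball \<eta> d) (\<lambda>n \<eta>. F n (x0 + \<eta> *s k)) (\<lambda>\<eta>. q (x0 + \<eta> *s k)) sequentially"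
      by (rule unif) (use d in \<open>auto simp: norm_cscale\<close>)
    with d show "\<exists>d>0. cball \<eta> d \<subseteq> {\<eta>. cmod \<eta> * norm k < 2 * \<rho>} \<and>
       uniform_limit (cball \<eta> d) (\<lambda>n \<eta>. F n (x0 + \<eta> *s k)) (\<lambda>\<eta>. q (x0 + \<eta> *s k)) sequentially"
      by blast
  qed
  define l where "l k = deriv (\<lambda>\<eta>. q (x0 + \<eta> *s k)) 0" for k
  have lim: "(\<lambda>n. L n k) \<longlonglongrightarrow> l k" for k
  proof -
    obtain g' where g': "((\<lambda>\<eta>. q (x0 + \<eta> *s k)) has_field_derivative g' 0) (at 0)"
      "(\<lambda>n. of_real (m n) * (frechet_derivative f (at (x0 + v' n + 0 *s k)) k
              - frechet_derivative f (at (x0 + 0 *s k)) k)) \<longlonglongrightarrow> g' 0"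
      using line[of k] \<rho> by force
    then show ?thesis using DERIV_imp_deriv[OF g'(1)] by (simp add: l_def L_def)
  qed
  have vS: "x0 + v' n \<in> S" for n using v'[of n] \<rho> by (intro inS) simp
  have "cdiff_at q x0"
  proof (rule cdiff_if_holo_on_lines[OF \<rho>, where l = l])
    show "(\<lambda>\<zeta>. q (x0 + \<zeta> *s k)) field_differentiable at \<zeta>" if "cmod \<zeta> * norm k < 2 * \<rho>" for k \<zeta>
      using line[of k] that unfolding field_differentiable_def by blast
    show "cmod (q y) \<le> m 0 * (2 * M) + 16 * M / \<rho>\<^sup>2 * (norm v)\<^sup>2 / m 0" if "y \<in> ball x0 (2 * \<rho>)" for y
    proof -
      have y: "norm (y - x0) < 2 * \<rho>" using that by (simp add: dist_norm norm_minus_commute)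
      have "y \<in> cball x0 e" "y + v' 0 \<in> cball x0 e"
        using y v'[of 0] norm_triangle_ineq[of "y - x0" "v' 0"] \<rho>
        by (auto simp: \<rho>_def dist_norm norm_minus_commute algebra_simps)
      then have "cmod (f (y + v' 0) - f y) \<le> 2 * M"
        using M(2)[of y] M(2)[of "y + v' 0"] norm_triangle_ineq4[of "f (y + v' 0)" "f y"] by simp
      then have "cmod (F 0 y) \<le> m 0 * (2 * M)"
        using m[of 0] by (simp add: F_def norm_mult)
      then show ?thesis
        using approx[OF y, of 0] norm_triangle_sub[of "q y" "F 0 y"] by (simp add: norm_minus_commute)
    qed
    show "deriv (\<lambda>\<zeta>. q (x0 + \<zeta> *s k)) 0 = l k" for k by (simp add: l_def)
    show "l (k + k') = l k + l k'" for k k'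
    proof (rule LIMSEQ_unique[OF lim])
      have "L n (k + k') = L n k + L n k'" for n
        by (simp add: L_def linear_add[OF lin[OF vS]] linear_add[OF lin[OF x0]] algebra_simps)
      then show "(\<lambda>n. L n (k + k')) \<longlonglongrightarrow> l k + l k'"
        using tendsto_add[OF lim[of k] lim[of k']] by simp
    qed
    show "l (c *s k) = c * l k" for c k
    proof (rule LIMSEQ_unique[OF lim])
      have "L n (c *s k) = c * L n k" for n
        by (simp add: L_def cdiff_frechet[OF f[OF vS]] cdiff_frechet[OF f[OF x0]] algebra_simps)
      then show "(\<lambda>n. L n (c *s k)) \<longlonglongrightarrow> c * l k"
        using tendsto_mult[OF tendsto_const lim[of k]] by simp
    qed
  qed
  then show ?thesis unfolding q_def .
qed

section \<open>The strong maximum principle for subharmonic functions\<close>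

lemma no_max_if_pos_second_derivative:
  fixes f :: "real \<Rightarrow> real"
  assumes d: "0 < d" and f1: "\<And>t. \<bar>t\<bar> < d \<Longrightarrow> (f has_real_derivative f' t) (at t)"
    and f2: "(f' has_real_derivative s) (at 0)" and s: "0 < s"
    and max: "\<And>t. \<bar>t\<bar> < d \<Longrightarrow> f t \<le> f 0"
  shows False
proof -
  have f0: "f' 0 = 0"
    by (rule DERIV_local_max[OF f1 d]) (use d max in auto)
  obtain e where e: "0 < e" "\<And>h. 0 < h \<Longrightarrow> h < e \<Longrightarrow> f' 0 < f' (0 + h)"
    using DERIV_pos_inc_right[OF f2 s] by blast
  define t where "t = min d e / 2"
  have t: "0 < t" "t < d" "t < e" using d e(1) by (auto simp: t_def)
  have "\<exists>z>0. z < t \<and> f t - f 0 = (t - 0) * f' z"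
    by (rule MVT2) (use t f1 in auto)
  then obtain z where z: "0 < z" "z < t" "f t - f 0 = t * f' z" by auto
  have "0 < f' z" using e(2)[of z] z t f0 by auto
  then have "0 < t * f' z" using t by simp
  with z have "f 0 < f t" by linarith
  with max[of t] t show False by simp
qed

text \<open>Subharmonicity at a point in terms of one-dimensional derivatives along the two axes: the
  chain rule along a disc produces exactly these, and the second derivative test asks for no more.\<close>

definition laplacian_nonneg_at :: "(complex \<Rightarrow> real) \<Rightarrow> complex \<Rightarrow> bool" where
  "laplacian_nonneg_at u z \<longleftrightarrow> (\<exists>d>0. \<exists>p q s t.
     (\<forall>x. \<bar>x\<bar> < d \<longrightarrow> ((\<lambda>x. u (z + of_real x)) has_real_derivative p x) (at x)) \<and>
     (\<forall>x. \<bar>x\<bar> < d \<longrightarrow> ((\<lambda>x. u (z + \<i> * of_real x)) has_real_derivative q x) (at x)) \<and>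
     (p has_real_derivative s) (at 0) \<and> (q has_real_derivative t) (at 0) \<and> 0 \<le> s + t)"

text \<open>The Laplacian of \<open>exp (-a |z - c|^2)\<close> is \<open>4 a (a |z - c|^2 - 1) exp (-a |z - c|^2)\<close>, which is
  positive where \<open>a |z - c|^2 > 1\<close>. At a maximum neither of the two second derivatives of the sum
  can be positive, whereas their sum is.\<close>

lemma perturbed_subharmonic_no_max:
  assumes u: "laplacian_nonneg_at u z"
    and "0 < \<epsilon>" "0 < a" "1 < a * (cmod (z - c))\<^sup>2"
    and r: "0 < r"
    and max: "\<And>y. cmod (y - z) < r \<Longrightarrow>
       u y + \<epsilon> * exp (- a * (cmod (y - c))\<^sup>2) \<le> u z + \<epsilon> * exp (- a * (cmod (z - c))\<^sup>2)"
  shows False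
proof -
  obtain d p q s t where d: "0 < d"
    and p: "\<And>x. \<bar>x\<bar> < d \<Longrightarrow> ((\<lambda>x. u (z + of_real x)) has_real_derivative p x) (at x)"
    and q: "\<And>x. \<bar>x\<bar> < d \<Longrightarrow> ((\<lambda>x. u (z + \<i> * of_real x)) has_real_derivative q x) (at x)"
    and st: "(p has_real_derivative s) (at 0)" "(q has_real_derivative t) (at 0)" "0 \<le> s + t"
    using u unfolding laplacian_nonneg_at_def by blast
  define A where "A = Re z - Re c"
  define B where "B = Im z - Im c"
  define E where "E = exp (- a * (A\<^sup>2 + B\<^sup>2))"
  have nrm: "(cmod (z - c))\<^sup>2 = A\<^sup>2 + B\<^sup>2"
    "(cmod (z + of_real x - c))\<^sup>2 = (A + x)\<^sup>2 + B\<^sup>2"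
    "(cmod (z + \<i> * of_real x - c))\<^sup>2 = A\<^sup>2 + (B + x)\<^sup>2" for x
    by (simp_all add: cmod_power2 A_def B_def algebra_simps)
  define f where "f x = u (z + of_real x) + \<epsilon> * exp (- a * ((A + x)\<^sup>2 + B\<^sup>2))" for x
  define g where "g x = u (z + \<i> * of_real x) + \<epsilon> * exp (- a * (A\<^sup>2 + (B + x)\<^sup>2))" for x
  define f' where "f' x = p x + \<epsilon> * (exp (- a * ((A + x)\<^sup>2 + B\<^sup>2)) * (- a * (2 * (A + x))))" for x
  define g' where "g' x = q x + \<epsilon> * (exp (- a * (A\<^sup>2 + (B + x)\<^sup>2)) * (- a * (2 * (B + x))))" for x
  define sf where "sf = s + \<epsilon> * (E * (4 * a\<^sup>2 * A\<^sup>2 - 2 * a))"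
  define sg where "sg = t + \<epsilon> * (E * (4 * a\<^sup>2 * B\<^sup>2 - 2 * a))"
  have f1: "(f has_real_derivative f' x) (at x)" if "\<bar>x\<bar> < d" for x
    unfolding f_def f'_def by (rule derivative_eq_intros p that refl | simp add: algebra_simps)+
  have g1: "(g has_real_derivative g' x) (at x)" if "\<bar>x\<bar> < d" for x
    unfolding g_def g'_def by (rule derivative_eq_intros q that refl | simp add: algebra_simps)+
  have f2: "(f' has_real_derivative sf) (at 0)"
    unfolding f'_def sf_def E_def
    by (rule derivative_eq_intros st refl | simp add: algebra_simps power2_eq_square)+
  have g2: "(g' has_real_derivative sg) (at 0)"
    unfolding g'_def sg_def E_def
    by (rule derivative_eq_intros st refl | simp add: algebra_simps power2_eq_square)+
  define d' where "d' = min d r"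
  have d': "0 < d'" "d' \<le> d" "d' \<le> r" using d r by (auto simp: d'_def)
  have fm: "f x \<le> f 0" if "\<bar>x\<bar> < d'" for x
    using max[of "z + of_real x"] that d' unfolding nrm f_def by simp
  have gm: "g x \<le> g 0" if "\<bar>x\<bar> < d'" for x
    using max[of "z + \<i> * of_real x"] that d' unfolding nrm g_def by (simp add: norm_mult)
  have "\<not> 0 < sf"
    by (intro notI no_max_if_pos_second_derivative[OF d'(1) f1 f2 _ fm]) (use d' in auto)
  moreover have "\<not> 0 < sg"
    by (intro notI no_max_if_pos_second_derivative[OF d'(1) g1 g2 _ gm]) (use d' in auto)
  moreover have "sf + sg = s + t + \<epsilon> * (E * (4 * a * (a * (A\<^sup>2 + B\<^sup>2) - 1)))"
    by (simp add: sf_def sg_def algebra_simps power2_eq_square)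
  moreover have "0 < \<epsilon> * (E * (4 * a * (a * (A\<^sup>2 + B\<^sup>2) - 1)))"
    using assms(2-4) unfolding nrm by (simp add: E_def)
  ultimately show False using st(3) by linarith
qed

text \<open>Hopf's argument. If \<open>u y < u 0\<close>, enlarge a disc about \<open>y\<close> until its circle first meets the set
  where \<open>u\<close> takes its maximum \<open>M\<close>, at \<open>x0\<close>, say. The disc that has \<open>y\<close> and \<open>x0\<close> as opposite points of its
  circle meets this set in \<open>x0\<close> only. A Gaussian about its centre is smaller outside that disc than at
  \<open>x0\<close>; a small multiple of it, added to \<open>u\<close> on a small disc about \<open>x0\<close>, gives a function with an
  interior maximum, which the preceding lemma excludes. The bound \<open>R/2\<close> keeps the touching disc inside.\<close>

lemma strong_maximum_principle_disc:
  fixes u :: "complex \<Rightarrow> real"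
  assumes cont: "continuous_on (ball 0 R) u"
    and sub: "\<And>z. z \<in> ball 0 R \<Longrightarrow> laplacian_nonneg_at u z"
    and max: "\<And>z. z \<in> ball 0 R \<Longrightarrow> u z \<le> u 0"
    and y: "cmod y < R / 2"
  shows "u y = u 0"
proof (rule ccontr)
  define M where "M = u 0"
  assume "u y \<noteq> u 0"
  moreover have "y \<in> ball 0 R" using y norm_ge_zero[of y] unfolding mem_ball_0 by linarith
  ultimately have uy: "u y < M" using max[of y] by (simp add: M_def)
  have y0: "y \<noteq> 0" using uy by (auto simp: M_def)
  define Z where "Z = {z \<in> cball y (cmod y). u z = M}"
  have in_ball: "cball y (cmod y) \<subseteq> ball 0 R"
  proof
    fix z assume "z \<in> cball y (cmod y)"
    then have "cmod (y - z) \<le> cmod y" by (simp add: dist_norm)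
    moreover have "cmod z \<le> cmod y + cmod (y - z)" by (metis norm_minus_commute norm_triangle_sub add.commute)
    ultimately show "z \<in> ball 0 R" using y by simp
  qed
  have "closed Z"
    unfolding Z_def
    by (rule continuous_closed_preimage_constant[OF continuous_on_subset[OF cont in_ball] closed_cball])
  moreover have "0 \<in> Z" by (simp add: Z_def M_def)
  ultimately obtain x0 where x0: "x0 \<in> Z" "\<And>z. z \<in> Z \<Longrightarrow> dist y x0 \<le> dist y z"
    using distance_attains_inf[of Z y] by blast
  define r where "r = dist y x0 / 2"
  define c where "c = (y + x0) / 2"
  have ux0: "u x0 = M" and x0y: "dist y x0 \<le> cmod y" using x0(1) by (auto simp: Z_def)
  have r: "0 < r" using uy ux0 unfolding r_def by auto
  have x0c: "cmod (x0 - c) = r"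
  proof -
    have "x0 - c = (x0 - y) / 2" by (simp add: c_def field_simps)
    then have "cmod (x0 - c) = cmod (x0 - y) / 2" by (simp only: norm_divide) simp
    then show ?thesis by (simp add: r_def dist_norm norm_minus_commute)
  qed
  have yc: "cmod (y - c) = r"
  proof -
    have "y - c = (y - x0) / 2" by (simp add: c_def field_simps)
    then have "cmod (y - c) = cmod (y - x0) / 2" by (simp only: norm_divide) simp
    then show ?thesis by (simp add: r_def dist_norm)
  qed
  have less: "u z < M" if "cmod (z - c) \<le> r" "z \<noteq> x0" for z
  proof -
    have le: "dist y z \<le> 2 * r"
      using norm_triangle_ineq4[of "y - c" "z - c"] yc that(1) by (simp add: dist_norm)
    have "dist y z \<noteq> 2 * r"
    proof
      assume eq: "dist y z = 2 * r"
      have "(y - c) + (c - z) = y - z" by simp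
      then have "cmod ((y - c) + (c - z)) = cmod (y - c) + cmod (c - z)"
        using eq yc that(1) norm_triangle_ineq[of "y - c" "c - z"]
        by (simp add: dist_norm norm_minus_commute)
      then have "cmod (y - c) *\<^sub>R (c - z) = cmod (c - z) *\<^sub>R (y - c)"
        unfolding norm_triangle_eq .
      moreover have "cmod (c - z) = r"
        using eq yc that(1) norm_triangle_ineq[of "y - c" "c - z"]
        by (simp add: dist_norm norm_minus_commute)
      ultimately have "c - z = y - c" using yc r by simp
      then have "z = x0" by (simp add: c_def field_simps)
      with that(2) show False by simp
    qed
    with le have lt: "dist y z < dist y x0" by (simp add: r_def)
    then have "z \<in> cball y (cmod y)" using x0y by simp
    moreover from this have "z \<in> ball 0 R" using in_ball by blast
    moreover have "z \<notin> Z" using x0(2)[of z] lt by auto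
    ultimately show ?thesis using max[of z] by (auto simp: Z_def M_def)
  qed
  have "x0 \<in> ball 0 R" using x0(1) in_ball by (auto simp: Z_def)
  then obtain e where e: "0 < e" "ball x0 e \<subseteq> ball 0 R" using open_contains_ball by blast
  define \<delta> where "\<delta> = min (e/2) (r / 2)"
  have \<delta>: "0 < \<delta>" "\<delta> \<le> r / 2" "cball x0 \<delta> \<subseteq> ball 0 R"
    using e r by (auto simp: \<delta>_def intro!: order_trans[OF _ e(2)])
  define K where "K = cball x0 \<delta>"
  \<comment> \<open>Points of \<open>K\<close> have distance at least \<open>r/2\<close> from \<open>c\<close>, so that \<open>a * |z - c|^2 \<ge> 2\<close> on \<open>K\<close>.\<close>
  define a where "a = 8 / r\<^sup>2"
  have a: "0 < a" using r by (simp add: a_def)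
  define v where "v z = exp (- a * (cmod (z - c))\<^sup>2)" for z
  define S where "S = sphere x0 \<delta> \<inter> cball c r"
  have "compact S" unfolding S_def by (intro compact_Int) auto
  have contK: "continuous_on K u" using cont \<delta>(3) continuous_on_subset unfolding K_def by blast
  have SK: "S \<subseteq> K" by (auto simp: S_def K_def)
  \<comment> \<open>On the part of the small circle inside the disc, \<open>u\<close> stays below its maximum by a fixed amount.\<close>
  obtain m where m: "m < M" "\<And>z. z \<in> S \<Longrightarrow> u z \<le> m"
  proof (cases "S = {}")
    case True
    then show ?thesis using that[of "M - 1"] by simp
  next
    case False
    obtain s where "s \<in> S" "\<And>z. z \<in> S \<Longrightarrow> u z \<le> u s"
      using continuous_attains_sup[OF \<open>compact S\<close> False continuous_on_subset[OF contK SK]] by blast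
    moreover have "u s < M"
      by (rule less) (use \<open>s \<in> S\<close> \<delta>(1) in \<open>auto simp: S_def dist_norm norm_minus_commute\<close>)
    ultimately show ?thesis using that by blast
  qed
  define \<epsilon> where "\<epsilon> = (M - m) / 2"
  have \<epsilon>: "0 < \<epsilon>" using m(1) by (simp add: \<epsilon>_def)
  define w where "w z = u z + \<epsilon> * v z" for z
  have "continuous_on K w"
    unfolding w_def v_def by (intro continuous_intros contK)
  then obtain z where z: "z \<in> K" "\<And>y. y \<in> K \<Longrightarrow> w y \<le> w z"
    using continuous_attains_sup[of K w] \<delta>(1) by (auto simp: K_def)
  have wx0: "w x0 \<le> w z" using z(2)[of x0] \<delta>(1) by (simp add: K_def)
  have v_le1: "v z \<le> 1" for z using a by (simp add: v_def)
  have vpos: "0 < v z" for z by (simp add: v_def)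
  have "z \<in> ball x0 \<delta>"
  proof (rule ccontr)
    assume "z \<notin> ball x0 \<delta>"
    then have zs: "z \<in> sphere x0 \<delta>" using z(1) by (auto simp: K_def)
    have "w z < w x0"
    proof (cases "z \<in> cball c r")
      case True
      then have "u z \<le> m" using m zs by (auto simp: S_def)
      moreover have "\<epsilon> * v z \<le> \<epsilon> * 1" using v_le1 \<epsilon> by (intro mult_left_mono) auto
      moreover have "0 < \<epsilon> * v x0" using vpos \<epsilon> by simp
      moreover have "m + \<epsilon> < M" using m(1) by (simp add: \<epsilon>_def field_simps)
      ultimately show ?thesis using ux0 unfolding w_def by linarith
    next
      case False
      then have "r < cmod (z - c)" by (simp add: dist_norm norm_minus_commute)
      then have "r\<^sup>2 < (cmod (z - c))\<^sup>2" using r by (simp add: power_strict_mono)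
      then have "v z < v x0" using a unfolding v_def x0c by simp
      then have "\<epsilon> * v z < \<epsilon> * v x0" using \<epsilon> by simp
      moreover have "u z \<le> M" using max[of z] z(1) \<delta>(3) unfolding K_def M_def by blast
      ultimately show ?thesis using ux0 unfolding w_def by simp
    qed
    with wx0 show False by simp
  qed
  then obtain \<rho> where \<rho>: "0 < \<rho>" "ball z \<rho> \<subseteq> ball x0 \<delta>"
    using open_contains_ball[of "ball x0 \<delta>"] open_ball by meson
  show False
  proof (rule perturbed_subharmonic_no_max[of u z \<epsilon> a c \<rho>])
    show "laplacian_nonneg_at u z" using sub z(1) \<delta>(3) by (auto simp: K_def)
    show "0 < \<epsilon>" "0 < a" "0 < \<rho>" by fact+
    have "cmod (x0 - z) \<le> r / 2" using z(1) \<delta>(2) by (simp add: K_def dist_norm)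
    then have "r / 2 \<le> cmod (z - c)"
      using norm_triangle_ineq[of "x0 - z" "z - c"] x0c by simp
    then have "(r / 2)\<^sup>2 \<le> (cmod (z - c))\<^sup>2" using r by (intro power_mono) auto
    then have "a * (r / 2)\<^sup>2 \<le> a * (cmod (z - c))\<^sup>2" using a by simp
    moreover have "a * (r / 2)\<^sup>2 = 2" using r by (simp add: a_def power_divide)
    ultimately show "1 < a * (cmod (z - c))\<^sup>2" by simp
    show "u y + \<epsilon> * exp (- a * (cmod (y - c))\<^sup>2) \<le> u z + \<epsilon> * exp (- a * (cmod (z - c))\<^sup>2)"
      if "cmod (y - z) < \<rho>" for y
    proof -
      have "y \<in> ball z \<rho>" using that by (simp add: dist_norm norm_minus_commute)
      then have "y \<in> K" using \<rho>(2) unfolding K_def by (meson ball_subset_cball subsetD)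
      then show ?thesis using z(2)[of y] by (simp add: w_def v_def)
    qed
  qed
qed

section \<open>Levi forms\<close>

lemma quadratic_nonneg_imp_linear_zero:
  fixes b c :: real
  assumes "\<And>t. 0 \<le> t * b + t\<^sup>2 * c"
  shows "b = 0"
proof (rule ccontr)
  assume b: "b \<noteq> 0"
  define c' where "c' = \<bar>c\<bar> + 1"
  have c': "c' > 0" "c < c'" by (auto simp: c'_def)
  have "0 \<le> (- b / c') * b + (- b / c')\<^sup>2 * c" by (rule assms)
  also have "\<dots> = (b / c')\<^sup>2 * (c - c')" using c'(1) by (simp add: field_simps power2_eq_square)
  also have "\<dots> < 0" using b c' by (simp add: mult_pos_neg)
  finally show False by simp
qed

text \<open>Along \<open>a + t e_k\<close> the form equals a real linear function of \<open>t\<close> plus a multiple of \<open>|t|^2\<close>. Since it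
  is nowhere negative and vanishes at \<open>t = 0\<close>, the linear function is zero; real and imaginary \<open>t\<close> together
  separate its complex linear part, which is the claim, from the conjugate linear one.\<close>

lemma psd_form_kernel:
  fixes m :: "'n::finite \<Rightarrow> 'n \<Rightarrow> complex"
  assumes psd: "\<And>v::complex^'n. (\<Sum>i\<in>UNIV. \<Sum>j\<in>UNIV. m i j * v $ i * cnj (v $ j)) \<in> \<real>\<^sub>\<ge>\<^sub>0"
    and a: "(\<Sum>i\<in>UNIV. \<Sum>j\<in>UNIV. m i j * a $ i * cnj (a $ j)) = 0"
  shows "(\<Sum>j\<in>UNIV. m k j * cnj (a $ j)) = 0"
proof -
  define Q where "Q v = (\<Sum>i\<in>UNIV. \<Sum>j\<in>UNIV. m i j * v $ i * cnj (v $ j))" for v :: "complex^'n"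
  define B1 where "B1 = (\<Sum>j\<in>UNIV. m k j * cnj (a $ j))"
  define B2 where "B2 = (\<Sum>i\<in>UNIV. m i k * a $ i)"
  have ax: "axis k (t::complex) $ i = (if i = k then t else 0)" for t i by (auto simp: axis_def)
  have Q: "Q (a + axis k t) = t * B1 + cnj t * B2 + t * cnj t * m k k" for t
  proof -
    have "Q (a + axis k t) = Q a
      + (\<Sum>i\<in>UNIV. \<Sum>j\<in>UNIV. m i j * (if i = k then t else 0) * cnj (a $ j))
      + (\<Sum>i\<in>UNIV. \<Sum>j\<in>UNIV. m i j * a $ i * cnj (if j = k then t else 0))
      + (\<Sum>i\<in>UNIV. \<Sum>j\<in>UNIV. m i j * (if i = k then t else 0) * cnj (if j = k then t else 0))"
      unfolding Q_def sum.distrib[symmetric] by (simp add: ax algebra_simps)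
    also have "(\<Sum>i\<in>UNIV. \<Sum>j\<in>UNIV. m i j * (if i = k then t else 0) * cnj (a $ j)) = t * B1"
    proof -
      have "(\<Sum>i\<in>UNIV. \<Sum>j\<in>UNIV. m i j * (if i = k then t else 0) * cnj (a $ j))
          = (\<Sum>i\<in>UNIV. if i = k then (\<Sum>j\<in>UNIV. m i j * t * cnj (a $ j)) else 0)"
        by (intro sum.cong refl) auto
      then show ?thesis by (simp add: B1_def sum_distrib_left mult_ac)
    qed
    also have "(\<Sum>i\<in>UNIV. \<Sum>j\<in>UNIV. m i j * a $ i * cnj (if j = k then t else 0)) = cnj t * B2"
      by (simp add: B2_def sum_distrib_left mult_ac if_distrib cong: if_cong)
    also have "(\<Sum>i\<in>UNIV. \<Sum>j\<in>UNIV. m i j * (if i = k then t else 0) * cnj (if j = k then t else 0)) = t * cnj t * m k k"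
    proof -
      have "(\<Sum>j\<in>UNIV. m i j * (if i = k then t else 0) * cnj (if j = k then t else 0))
          = (if i = k then m i k * t * cnj t else 0)" for i
        by (auto simp: if_distrib cong: if_cong)
      then show ?thesis by (simp add: mult_ac)
    qed
    finally show ?thesis using a by (simp add: Q_def)
  qed
  have ge: "0 \<le> Re (Q v)" "Im (Q v) = 0" for v
    using psd[of v] unfolding Q_def[symmetric] complex_nonneg_Reals_iff by blast+
  have "Im (B1 + B2 + m k k) = 0" using ge(2)[of "a + axis k 1"] unfolding Q by simp
  moreover have "Im (- B1 - B2 + m k k) = 0" using ge(2)[of "a + axis k (-1)"] unfolding Q by simp
  moreover have "Im (\<i> * B1 - \<i> * B2 + m k k) = 0" using ge(2)[of "a + axis k \<i>"] unfolding Q by simp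
  moreover have "Im (- \<i> * B1 + \<i> * B2 + m k k) = 0" using ge(2)[of "a + axis k (-\<i>)"] unfolding Q by simp
  moreover have "Re (B1 + B2) = 0"
  proof (rule quadratic_nonneg_imp_linear_zero[where c = "Re (m k k)"])
    show "0 \<le> t * Re (B1 + B2) + t\<^sup>2 * Re (m k k)" for t
      using ge(1)[of "a + axis k (of_real t)"] unfolding Q by (simp add: algebra_simps power2_eq_square)
  qed
  moreover have "Re (\<i> * B1 - \<i> * B2) = 0"
  proof (rule quadratic_nonneg_imp_linear_zero[where c = "Re (m k k)"])
    show "0 \<le> t * Re (\<i> * B1 - \<i> * B2) + t\<^sup>2 * Re (m k k)" for t
      using ge(1)[of "a + axis k (of_real t * \<i>)"] unfolding Q by (simp add: algebra_simps power2_eq_square)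
  qed
  ultimately show ?thesis unfolding B1_def[symmetric] by (simp add: complex_eq_iff)
qed

text \<open>The second derivatives are only asked to exist at each point, which is all that the pointwise
  maximum principle above consumes.\<close>

definition twice_diff_on :: "'a::real_normed_vector set \<Rightarrow> ('a \<Rightarrow> 'b::real_normed_vector) \<Rightarrow> bool" where
  "twice_diff_on S f \<longleftrightarrow> (\<forall>x\<in>S. f differentiable (at x) \<and>
     (\<forall>v. (\<lambda>y. frechet_derivative f (at y) v) differentiable (at x)))"

lemma differentiable_transform_open:
  assumes "f differentiable (at x)" "open S" "x \<in> S" "\<And>y. y \<in> S \<Longrightarrow> f y = g y"
  shows "g differentiable (at x)"
  using assms unfolding differentiable_def by (metis has_derivative_transform_within_open)

lemma twice_diffI:
  assumes S: "open S"
    and d: "\<And>x. x \<in> S \<Longrightarrow> (f has_derivative f' x) (at x)"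
    and d': "\<And>x v. x \<in> S \<Longrightarrow> (\<lambda>y. f' y v) differentiable (at x)"
  shows "twice_diff_on S f"
  unfolding twice_diff_on_def
proof (intro ballI conjI allI)
  fix x v assume x: "x \<in> S"
  show "f differentiable (at x)" using d[OF x] unfolding differentiable_def by blast
  show "(\<lambda>y. frechet_derivative f (at y) v) differentiable (at x)"
    by (rule differentiable_transform_open[OF d'[OF x, of v] S x])
      (simp add: frechet_derivative_at[OF d, symmetric])
qed

lemma twice_diff_derivative:
  assumes "twice_diff_on S f" "x \<in> S"
  shows "(f has_derivative frechet_derivative f (at x)) (at x)"
    and "(\<lambda>y. frechet_derivative f (at y) v) differentiable (at x)"
  using assms frechet_derivative_works unfolding twice_diff_on_def by blast+

lemma twice_diff_subset: "twice_diff_on S f \<Longrightarrow> T \<subseteq> S \<Longrightarrow> twice_diff_on T f"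
  unfolding twice_diff_on_def by blast

lemma twice_diff_cong:
  assumes "twice_diff_on S f" "open S" "\<And>y. y \<in> S \<Longrightarrow> f y = g y"
  shows "twice_diff_on S g"
proof (rule twice_diffI[OF assms(2)])
  show "(g has_derivative frechet_derivative f (at x)) (at x)" if "x \<in> S" for x
    using has_derivative_transform_within_open[OF twice_diff_derivative(1)[OF assms(1) that] assms(2) that] assms(3)
    by blast
qed (use twice_diff_derivative(2)[OF assms(1)] in blast)

lemma twice_diff_linear:
  assumes L: "bounded_linear L" and f: "twice_diff_on S f" and S: "open S"
  shows "twice_diff_on S (\<lambda>x. L (f x))"
proof (rule twice_diffI[OF S])
  fix x v assume x: "x \<in> S"
  show "((\<lambda>x. L (f x)) has_derivative (\<lambda>v. L (frechet_derivative f (at x) v))) (at x)"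
    by (rule bounded_linear.has_derivative[OF L twice_diff_derivative(1)[OF f x]])
  show "(\<lambda>y. L (frechet_derivative f (at y) v)) differentiable (at x)"
    using twice_diff_derivative(2)[OF f x] bounded_linear.has_derivative[OF L]
    unfolding differentiable_def by blast
qed

lemma twice_diff_mult:
  fixes f g :: "'a::real_normed_vector \<Rightarrow> 'b::real_normed_algebra"
  assumes f: "twice_diff_on S f" and g: "twice_diff_on S g" and S: "open S"
  shows "twice_diff_on S (\<lambda>x. f x * g x)"
proof (rule twice_diffI[OF S])
  fix x v assume x: "x \<in> S"
  show "((\<lambda>x. f x * g x) has_derivative
     (\<lambda>v. f x * frechet_derivative g (at x) v + frechet_derivative f (at x) v * g x)) (at x)"
    by (intro has_derivative_mult twice_diff_derivative(1)[OF f x] twice_diff_derivative(1)[OF g x])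
  show "(\<lambda>y. f y * frechet_derivative g (at y) v + frechet_derivative f (at y) v * g y) differentiable (at x)"
    using f g x unfolding twice_diff_on_def
    by (intro differentiable_add differentiable_mult) auto
qed

lemma cholo_twice_diff:
  assumes "open S" "cholo_on f S"
  shows "twice_diff_on S f"
  unfolding twice_diff_on_def
  using assms cdiff_imp_differentiable cdiff_directional_derivative unfolding cholo_on_alt by blast

lemma cholo_wirt:
  assumes S: "open S" and f: "cholo_on f S"
  shows "cholo_on (wirt i f) S"
  unfolding cholo_on_alt
proof
  fix x assume x: "x \<in> S"
  show "cdiff_at (wirt i f) x"
    by (rule cdiff_transform[OF cdiff_directional_derivative[of S f x "axis i 1"] S x])
      (use assms x in \<open>auto simp: cholo_on_alt cdiff_wirt(2)\<close>)
qed

lemma Cinf_twice_diff: "Cinf_on S f \<Longrightarrow> twice_diff_on S f"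
  unfolding Cinf_on_def twice_diff_on_def using Ck_on.simps(2)[of 1 S f] Ck_on.simps(2)[of 0 S]
  by (metis One_nat_def)

lemma wirt_differentiable:
  assumes "twice_diff_on S f" "x \<in> S"
  shows "wirt i f differentiable (at x)"
proof -
  have "(\<lambda>x. (frechet_derivative f (at x) (axis i 1) - \<i> * frechet_derivative f (at x) (axis i \<i>)) / 2)
     differentiable (at x)"
    using twice_diff_derivative(2)[OF assms] by (intro differentiable_divide differentiable_diff differentiable_mult) auto
  then show ?thesis unfolding wirt_def[abs_def] .
qed

text \<open>The squared norm of a frame is a complex valued function with positive values. Being real on
  an open set it has a real derivative, so the real parts disappear from the logarithmic derivative.\<close>

lemma log_of_twice_diff:
  fixes K :: "complex^'n \<Rightarrow> complex" and k :: "complex^'n \<Rightarrow> real"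
  assumes S: "open S" and K: "twice_diff_on S K"
    and k: "\<And>x. x \<in> S \<Longrightarrow> K x = of_real (k x)" "\<And>x. x \<in> S \<Longrightarrow> 0 < k x"
  shows "twice_diff_on S (\<lambda>x. complex_of_real (ln (Re (K x))))"
    and "x \<in> S \<Longrightarrow> wirt i (\<lambda>x. complex_of_real (ln (Re (K x)))) x = wirt i K x / K x"
proof -
  have D: "((\<lambda>x. complex_of_real (ln (Re (K x)))) has_derivative
      (\<lambda>v. frechet_derivative K (at x) v / K x)) (at x)" if x: "x \<in> S" for x
  proof -
    have dK: "(K has_derivative frechet_derivative K (at x)) (at x)"
      by (rule twice_diff_derivative(1)[OF K x])
    have "((\<lambda>y. of_real (Re (K y))) has_derivative (\<lambda>v. of_real (Re (frechet_derivative K (at x) v)))) (at x)"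
      by (intro has_derivative_of_real has_derivative_Re dK)
    then have "(K has_derivative (\<lambda>v. of_real (Re (frechet_derivative K (at x) v)))) (at x)"
      by (rule has_derivative_transform_within_open[OF _ S x]) (simp add: k)
    from frechet_derivative_at[OF this]
    have re: "complex_of_real (Re (frechet_derivative K (at x) v)) = frechet_derivative K (at x) v" for v
      by (rule fun_cong)
    have pos: "0 < Re (K x)" using k x by simp
    have "((\<lambda>x. complex_of_real (ln (Re (K x)))) has_derivative
      (\<lambda>v. of_real (Re (frechet_derivative K (at x) v) * (1 / Re (K x))))) (at x)"
      by (intro has_derivative_of_real)
        (rule derivative_eq_intros has_derivative_Re dK pos refl | simp add: divide_inverse mult.commute)+
    also have "(\<lambda>v. complex_of_real (Re (frechet_derivative K (at x) v) * (1 / Re (K x))))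
       = (\<lambda>v. frechet_derivative K (at x) v / K x)"
      using re k(1)[OF x] by (auto simp: fun_eq_iff)
    finally show ?thesis .
  qed
  show "twice_diff_on S (\<lambda>x. complex_of_real (ln (Re (K x))))"
  proof (rule twice_diffI[OF S D])
    fix x v assume x: "x \<in> S"
    have "K x \<noteq> 0" using k[OF x] by simp
    then show "(\<lambda>y. frechet_derivative K (at y) v / K y) differentiable (at x)"
      using K x unfolding twice_diff_on_def by (intro differentiable_divide) auto
  qed
  show "wirt i (\<lambda>x. complex_of_real (ln (Re (K x)))) x = wirt i K x / K x" if "x \<in> S"
    unfolding wirt_of_derivative(1)[OF D[OF that]] wirt_def[of i K] by (simp add: diff_divide_distrib mult.commute)
qed

text \<open>The complex Hessian (Levi form) on the diagonal.\<close>

definition levi :: "(complex^'n \<Rightarrow> complex) \<Rightarrow> complex^'n \<Rightarrow> complex^'n \<Rightarrow> complex" where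
  "levi f x v = (\<Sum>i\<in>UNIV. \<Sum>j\<in>UNIV. wirt_bar j (wirt i f) x * v $ i * cnj (v $ j))"

lemma has_real_derivative_twice_Re:
  assumes "(f has_vector_derivative z) (at x)"
  shows "((\<lambda>x. 2 * Re (f x)) has_real_derivative 2 * Re z) (at x)"
  unfolding has_field_derivative_def
  by (rule has_derivative_eq_rhs[OF has_derivative_mult_right[OF has_derivative_Re[OF
          assms[unfolded has_vector_derivative_def]]]]) auto

text \<open>For real \<open>F\<close> the derivative along \<open>t \<mapsto> \<gamma> (\<zeta>0 + u t)\<close> is twice the real part of
  \<open>\<Sum>\<^sub>k g\<^sub>k u \<gamma>\<^sub>k'\<close> with \<open>g\<^sub>k = wirt k f\<close>. Differentiating once more, the holomorphic derivatives of \<open>g\<^sub>k\<close>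
  and \<open>\<gamma>\<^sub>k'\<close> acquire the factor \<open>u^2\<close> and are collected in \<open>Q\<close>, the antiholomorphic derivatives of \<open>g\<^sub>k\<close>
  acquire \<open>|u|^2\<close> and form the complex Hessian. Of \<open>\<gamma>\<close> only derivatives in one variable occur.\<close>

lemma second_derivative_along_disc:
  fixes F :: "complex^'n \<Rightarrow> real" and \<gamma> :: "complex \<Rightarrow> complex^'n"
  defines "f \<equiv> \<lambda>y. complex_of_real (F y)"
  assumes S: "open S" and f: "twice_diff_on S f"
    and D: "open D" "\<zeta>0 \<in> D" and \<gamma>: "\<And>k. (\<lambda>\<zeta>. \<gamma> \<zeta> $ k) holomorphic_on D" "\<gamma> ` D \<subseteq> S"
  defines "a \<equiv> (\<chi> k. deriv (\<lambda>\<zeta>. \<gamma> \<zeta> $ k) \<zeta>0)"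
  shows "\<exists>Q. \<forall>u. \<exists>d>0. \<exists>p.
     (\<forall>x. \<bar>x\<bar> < d \<longrightarrow> ((\<lambda>x. F (\<gamma> (\<zeta>0 + u * of_real x))) has_real_derivative p x) (at x)) \<and>
     (p has_real_derivative 2 * Re (u\<^sup>2 * Q + of_real ((cmod u)\<^sup>2) * levi f (\<gamma> \<zeta>0) a)) (at 0)"
proof -
  define g where "g k = wirt k f" for k
  define \<gamma>' where "\<gamma>' k = deriv (\<lambda>\<zeta>. \<gamma> \<zeta> $ k)" for k
  define Q where "Q = (\<Sum>k\<in>UNIV. (\<Sum>j\<in>UNIV. wirt j (g k) (\<gamma> \<zeta>0) * a $ j) * a $ k + g k (\<gamma> \<zeta>0) * deriv (\<gamma>' k) \<zeta>0)"
  have ak: "a $ k = \<gamma>' k \<zeta>0" for k by (simp add: a_def \<gamma>'_def)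
  have d1: "((\<lambda>\<zeta>. \<gamma> \<zeta> $ k) has_field_derivative \<gamma>' k \<zeta>) (at \<zeta>)" if "\<zeta> \<in> D" for k \<zeta>
    unfolding \<gamma>'_def by (rule holomorphic_derivI[OF \<gamma>(1) D(1) that])
  have d2: "(\<gamma>' k has_field_derivative deriv (\<gamma>' k) \<zeta>) (at \<zeta>)" if "\<zeta> \<in> D" for k \<zeta>
    unfolding \<gamma>'_def by (rule holomorphic_derivI[OF holomorphic_deriv[OF \<gamma>(1) D(1)] D(1) that])
  obtain e where e: "0 < e" "ball \<zeta>0 e \<subseteq> D" using D open_contains_ball by blast
  have Df: "frechet_derivative f (at y) w = of_real (2 * Re (\<Sum>k\<in>UNIV. g k y * w $ k))" if y: "y \<in> S" for y w
  proof -
    have df: "(f has_derivative frechet_derivative f (at y)) (at y)" by (rule twice_diff_derivative(1)[OF f y])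
    have "((\<lambda>y. complex_of_real (Re (f y))) has_derivative (\<lambda>v. of_real (Re (frechet_derivative f (at y) v)))) (at y)"
      by (intro has_derivative_of_real has_derivative_Re df)
    moreover have "(\<lambda>y. complex_of_real (Re (f y))) = f" by (simp add: f_def)
    ultimately have "(f has_derivative (\<lambda>v. of_real (Re (frechet_derivative f (at y) v)))) (at y)" by simp
    from frechet_derivative_at[OF this]
    have re: "frechet_derivative f (at y) v = complex_of_real (Re (frechet_derivative f (at y) v))" for v
      by (rule fun_cong[OF sym])
    have "wirt_bar k f y = cnj (g k y)" for k
      using re[of "axis k 1"] re[of "axis k \<i>"]
      by (simp add: g_def wirt_def wirt_bar_def complex_eq_iff)
    then have "frechet_derivative f (at y) w
        = (\<Sum>k\<in>UNIV. g k y * w $ k) + cnj (\<Sum>k\<in>UNIV. g k y * w $ k)"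
      using frechet_wirtinger[of f y w] f y unfolding twice_diff_on_def
      by (simp add: g_def sum.distrib)
    then have "Re (frechet_derivative f (at y) w) = 2 * Re (\<Sum>k\<in>UNIV. g k y * w $ k)"
      by (simp only: complex_add_cnj Re_complex_of_real)
    then show ?thesis using re[of w] by simp
  qed
  have main: "\<exists>d>0. \<exists>p.
     (\<forall>x. \<bar>x\<bar> < d \<longrightarrow> ((\<lambda>x. F (\<gamma> (\<zeta>0 + u * of_real x))) has_real_derivative p x) (at x)) \<and>
     (p has_real_derivative 2 * Re (u\<^sup>2 * Q + of_real ((cmod u)\<^sup>2) * levi f (\<gamma> \<zeta>0) a)) (at 0)" for u
  proof -
    define d where "d = e / (cmod u + 1)"
    have nz: "0 < cmod u + 1" using norm_ge_zero[of u] by linarith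
    have d: "0 < d" using e(1) nz by (simp add: d_def)
    define c where "c x = \<zeta>0 + u * complex_of_real x" for x
    have cD: "c x \<in> D" if "\<bar>x\<bar> < d" for x
    proof -
      have "(cmod u + 1) * \<bar>x\<bar> < e" using that nz by (simp add: d_def field_simps)
      moreover have "cmod u * \<bar>x\<bar> \<le> (cmod u + 1) * \<bar>x\<bar>" by (intro mult_right_mono) auto
      ultimately have "c x \<in> ball \<zeta>0 e" by (simp add: c_def dist_norm norm_mult)
      then show ?thesis using e by blast
    qed
    have dc: "(c has_vector_derivative u) (at x)" for x
      unfolding c_def has_vector_derivative_def
      by (auto intro!: derivative_eq_intros simp: scaleR_conv_of_real mult.commute)
    have d\<gamma>: "((\<lambda>x. \<gamma> (c x)) has_derivative (\<lambda>h. h *\<^sub>R (\<chi> k. u * \<gamma>' k (c x)))) (at x)" if "\<bar>x\<bar> < d" for x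
    proof (rule has_derivative_vec_components)
      fix k
      show "((\<lambda>x. \<gamma> (c x) $ k) has_derivative (\<lambda>h. (h *\<^sub>R (\<chi> k. u * \<gamma>' k (c x))) $ k)) (at x)"
        using field_vector_diff_chain_at[OF dc d1[OF cD[OF that]], of k]
        by (simp add: has_vector_derivative_def o_def)
    qed
    define p where "p x = 2 * Re (\<Sum>k\<in>UNIV. g k (\<gamma> (c x)) * (u * \<gamma>' k (c x)))" for x
    have p1: "((\<lambda>x. F (\<gamma> (c x))) has_real_derivative p x) (at x)" if x: "\<bar>x\<bar> < d" for x
    proof -
      have yS: "\<gamma> (c x) \<in> S" using cD[OF x] \<gamma>(2) by blast
      have "((\<lambda>x. f (\<gamma> (c x))) has_derivative
          (\<lambda>h. frechet_derivative f (at (\<gamma> (c x))) (h *\<^sub>R (\<chi> k. u * \<gamma>' k (c x))))) (at x)"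
        using diff_chain_at[OF d\<gamma>[OF x] twice_diff_derivative(1)[OF f yS]] by (simp add: o_def)
      from has_derivative_Re[OF this]
      have "((\<lambda>x. Re (f (\<gamma> (c x)))) has_derivative
          (\<lambda>h. Re (complex_of_real (2 * Re (\<Sum>k\<in>UNIV. g k (\<gamma> (c x)) * (h *\<^sub>R (\<chi> k. u * \<gamma>' k (c x))) $ k))))) (at x)"
        unfolding Df[OF yS] .
      moreover have "Re (complex_of_real (2 * Re (\<Sum>k\<in>UNIV. g k (\<gamma> (c x)) * (h *\<^sub>R (\<chi> k. u * \<gamma>' k (c x))) $ k)))
          = p x * h" for h
      proof -
        have "(\<Sum>k\<in>UNIV. g k (\<gamma> (c x)) * (h *\<^sub>R (\<chi> k. u * \<gamma>' k (c x))) $ k)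
            = h *\<^sub>R (\<Sum>k\<in>UNIV. g k (\<gamma> (c x)) * (u * \<gamma>' k (c x)))"
          by (simp add: scaleR_sum_right)
        then show ?thesis by (simp only: p_def Re_complex_of_real scaleR_complex.sel mult_ac)
      qed
      ultimately show ?thesis
        unfolding has_field_derivative_def by (simp add: f_def)
    qed
    have x0: "\<bar>0\<bar> < d" using d by simp
    have c0: "c 0 = \<zeta>0" by (simp add: c_def)
    have yS: "\<gamma> \<zeta>0 \<in> S" using \<gamma>(2) D(2) by blast
    have dgk: "((\<lambda>x. g k (\<gamma> (c x))) has_vector_derivative
        (\<Sum>j\<in>UNIV. wirt j (g k) (\<gamma> \<zeta>0) * (u * a $ j) + wirt_bar j (g k) (\<gamma> \<zeta>0) * cnj (u * a $ j))) (at 0)" for k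
    proof -
      have gd: "g k differentiable (at (\<gamma> \<zeta>0))" unfolding g_def by (rule wirt_differentiable[OF f yS])
      then have "(g k has_derivative frechet_derivative (g k) (at (\<gamma> (c 0)))) (at (\<gamma> (c 0)))"
        using frechet_derivative_works c0 by auto
      from diff_chain_at[OF d\<gamma>[OF x0] this]
      show ?thesis unfolding o_def c0 has_vector_derivative_def frechet_wirtinger[OF gd] vector_scaleR_component
        by (simp add: sum_distrib_left ak mult_ac distrib_left scaleR_sum_right scaleR_add_right scaleR_conv_of_real)
    qed
    have dgam: "((\<lambda>x. \<gamma>' k (c x)) has_vector_derivative u * deriv (\<gamma>' k) \<zeta>0) (at 0)" for k
      using field_vector_diff_chain_at[OF dc d2[OF cD[OF x0]], of k] by (simp add: o_def c0)
    have "((\<lambda>x. \<Sum>k\<in>UNIV. g k (\<gamma> (c x)) * (u * \<gamma>' k (c x))) has_vector_derivative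
        (\<Sum>k\<in>UNIV. g k (\<gamma> \<zeta>0) * (u * (u * deriv (\<gamma>' k) \<zeta>0)) +
          (\<Sum>j\<in>UNIV. wirt j (g k) (\<gamma> \<zeta>0) * (u * a $ j) + wirt_bar j (g k) (\<gamma> \<zeta>0) * cnj (u * a $ j)) * (u * a $ k))) (at 0)"
    proof (rule has_vector_derivative_sum)
      fix k
      have "((\<lambda>x. g k (\<gamma> (c x)) * (u * \<gamma>' k (c x))) has_vector_derivative
        g k (\<gamma> (c 0)) * (u * (u * deriv (\<gamma>' k) \<zeta>0)) +
          (\<Sum>j\<in>UNIV. wirt j (g k) (\<gamma> \<zeta>0) * (u * a $ j) + wirt_bar j (g k) (\<gamma> \<zeta>0) * cnj (u * a $ j)) * (u * \<gamma>' k (c 0))) (at 0)"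
        by (rule has_vector_derivative_mult[OF dgk has_vector_derivative_mult_right[OF dgam]])
      then show "((\<lambda>x. g k (\<gamma> (c x)) * (u * \<gamma>' k (c x))) has_vector_derivative
        g k (\<gamma> \<zeta>0) * (u * (u * deriv (\<gamma>' k) \<zeta>0)) +
          (\<Sum>j\<in>UNIV. wirt j (g k) (\<gamma> \<zeta>0) * (u * a $ j) + wirt_bar j (g k) (\<gamma> \<zeta>0) * cnj (u * a $ j)) * (u * a $ k)) (at 0)"
        by (simp only: c0 ak)
    qed
    also have "(\<Sum>k\<in>UNIV. g k (\<gamma> \<zeta>0) * (u * (u * deriv (\<gamma>' k) \<zeta>0)) +
          (\<Sum>j\<in>UNIV. wirt j (g k) (\<gamma> \<zeta>0) * (u * a $ j) + wirt_bar j (g k) (\<gamma> \<zeta>0) * cnj (u * a $ j)) * (u * a $ k))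
        = u\<^sup>2 * Q + of_real ((cmod u)\<^sup>2) * levi f (\<gamma> \<zeta>0) a"
      unfolding Q_def levi_def g_def[symmetric] complex_norm_square
      by (simp add: sum.distrib sum_distrib_left sum_distrib_right algebra_simps power2_eq_square)
    finally have "((\<lambda>x. \<Sum>k\<in>UNIV. g k (\<gamma> (c x)) * (u * \<gamma>' k (c x))) has_vector_derivative
        u\<^sup>2 * Q + of_real ((cmod u)\<^sup>2) * levi f (\<gamma> \<zeta>0) a) (at 0)" .
    then have "(p has_real_derivative 2 * Re (u\<^sup>2 * Q + of_real ((cmod u)\<^sup>2) * levi f (\<gamma> \<zeta>0) a)) (at 0)"
      unfolding p_def by (rule has_real_derivative_twice_Re)
    with p1 d show ?thesis unfolding c_def by blast
  qed
  then show ?thesis by blast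
qed

text \<open>For \<open>u = 1\<close> and \<open>u = \<i>\<close> the values of \<open>u^2\<close> are opposite. Hence \<open>Q\<close> cancels in the sum of the two
  second derivatives, which is four times the Levi form of \<open>F\<close> at the velocity of the disc.\<close>

lemma laplacian_along_disc:
  fixes F :: "complex^'n \<Rightarrow> real" and \<gamma> :: "complex \<Rightarrow> complex^'n"
  defines "f \<equiv> \<lambda>y. complex_of_real (F y)"
  assumes S: "open S" and f: "twice_diff_on S f"
    and D: "open D" "\<zeta>0 \<in> D" and \<gamma>: "\<And>k. (\<lambda>\<zeta>. \<gamma> \<zeta> $ k) holomorphic_on D" "\<gamma> ` D \<subseteq> S"
  defines "a \<equiv> (\<chi> k. deriv (\<lambda>\<zeta>. \<gamma> \<zeta> $ k) \<zeta>0)"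
  shows "Re (levi f (\<gamma> \<zeta>0) a) \<le> 0 \<Longrightarrow> laplacian_nonneg_at (\<lambda>\<zeta>. - F (\<gamma> \<zeta>)) \<zeta>0"
    and "(\<And>\<zeta>. \<zeta> \<in> D \<Longrightarrow> F (\<gamma> \<zeta>) = C) \<Longrightarrow> Re (levi f (\<gamma> \<zeta>0) a) = 0"
proof -
  define l where "l = Re (levi f (\<gamma> \<zeta>0) a)"
  obtain Q where Q: "\<And>u. \<exists>d>0. \<exists>p.
     (\<forall>x. \<bar>x\<bar> < d \<longrightarrow> ((\<lambda>x. F (\<gamma> (\<zeta>0 + u * of_real x))) has_real_derivative p x) (at x)) \<and>
     (p has_real_derivative 2 * Re (u\<^sup>2 * Q + of_real ((cmod u)\<^sup>2) * levi f (\<gamma> \<zeta>0) a)) (at 0)"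
    using second_derivative_along_disc[OF S f[unfolded f_def] D \<gamma>] unfolding f_def a_def by blast
  obtain d p where p: "0 < d" "\<And>x. \<bar>x\<bar> < d \<Longrightarrow> ((\<lambda>x. F (\<gamma> (\<zeta>0 + of_real x))) has_real_derivative p x) (at x)"
     "(p has_real_derivative 2 * (Re Q + l)) (at 0)"
    using Q[of 1] by (auto simp: l_def)
  obtain e q where q: "0 < e" "\<And>x. \<bar>x\<bar> < e \<Longrightarrow> ((\<lambda>x. F (\<gamma> (\<zeta>0 + \<i> * of_real x))) has_real_derivative q x) (at x)"
     "(q has_real_derivative 2 * (l - Re Q)) (at 0)"
    using Q[of \<i>] by (auto simp: l_def algebra_simps)
  show "laplacian_nonneg_at (\<lambda>\<zeta>. - F (\<gamma> \<zeta>)) \<zeta>0" if "Re (levi f (\<gamma> \<zeta>0) a) \<le> 0"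
    unfolding laplacian_nonneg_at_def
  proof (intro exI conjI allI impI)
    show "0 < min d e" using p q by simp
    show "((\<lambda>x. - F (\<gamma> (\<zeta>0 + of_real x))) has_real_derivative - p x) (at x)" if "\<bar>x\<bar> < min d e" for x
      using p(2)[of x] that by (auto intro: DERIV_minus)
    show "((\<lambda>x. - F (\<gamma> (\<zeta>0 + \<i> * of_real x))) has_real_derivative - q x) (at x)" if "\<bar>x\<bar> < min d e" for x
      using q(2)[of x] that by (auto intro: DERIV_minus)
    show "((\<lambda>x. - p x) has_real_derivative - (2 * (Re Q + l))) (at 0)" using p(3) by (rule DERIV_minus)
    show "((\<lambda>x. - q x) has_real_derivative - (2 * (l - Re Q))) (at 0)" using q(3) by (rule DERIV_minus)
    show "0 \<le> - (2 * (Re Q + l)) + - (2 * (l - Re Q))" using that by (simp add: l_def)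
  qed
  show "Re (levi f (\<gamma> \<zeta>0) a) = 0" if const: "\<And>\<zeta>. \<zeta> \<in> D \<Longrightarrow> F (\<gamma> \<zeta>) = C"
  proof -
    obtain r where r: "0 < r" "ball \<zeta>0 r \<subseteq> D" using D open_contains_ball by blast
    have zero: "s = 0" if d: "0 < d" and u: "cmod u = 1"
      and p: "\<And>x. \<bar>x\<bar> < d \<Longrightarrow> ((\<lambda>x. F (\<gamma> (\<zeta>0 + u * of_real x))) has_real_derivative p x) (at x)"
      and s: "(p has_real_derivative s) (at 0)" for d u p s
    proof -
      define T where "T = ball (0::real) (min d r)"
      have T: "open T" "0 \<in> T" using d r by (auto simp: T_def)
      have "p x = 0" if x: "x \<in> T" for x
      proof (rule DERIV_unique[OF p])
        show "\<bar>x\<bar> < d" using x by (simp add: T_def)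
        have "((\<lambda>_. C) has_real_derivative 0) (at x)" by simp
        then show "((\<lambda>x. F (\<gamma> (\<zeta>0 + u * of_real x))) has_real_derivative 0) (at x)"
        proof (rule has_field_derivative_transform_within_open[OF _ T(1) x])
          fix y assume "y \<in> T"
          then have "\<zeta>0 + u * of_real y \<in> ball \<zeta>0 r" using u by (simp add: T_def dist_norm norm_mult)
          then show "C = F (\<gamma> (\<zeta>0 + u * of_real y))" using const r by auto
        qed
      qed
      moreover have "((\<lambda>_. 0::real) has_real_derivative 0) (at 0)" by simp
      ultimately have "(p has_real_derivative 0) (at 0)"
        by (metis has_field_derivative_transform_within_open T)
      with s show ?thesis using DERIV_unique by blast
    qed
    have "2 * (Re Q + l) = 0" by (rule zero[OF p(1) _ _ p(3), of 1]) (use p(2) in auto)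
    moreover have "2 * (l - Re Q) = 0" by (rule zero[OF q(1) _ _ q(3), of \<i>]) (use q(2) in auto)
    ultimately show ?thesis by (simp add: l_def)
  qed
qed

text \<open>Every point of the ball lies on a complex line through the centre, so the principle on discs
  applies.\<close>

lemma strong_maximum_principle_ball:
  fixes u :: "complex^'n \<Rightarrow> real"
  assumes cont: "continuous_on (ball x0 R) u"
    and sub: "\<And>k \<zeta>. x0 + \<zeta> *s k \<in> ball x0 R \<Longrightarrow> laplacian_nonneg_at (\<lambda>\<zeta>. u (x0 + \<zeta> *s k)) \<zeta>"
    and max: "\<And>x. x \<in> ball x0 R \<Longrightarrow> u x \<le> u x0"
    and y: "y \<in> ball x0 (R / 2)"
  shows "u y = u x0"
proof (cases "y = x0")
  case False
  define k where "k = y - x0"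
  have nk: "0 < norm k" using False by (simp add: k_def)
  have mem: "x0 + \<zeta> *s k \<in> ball x0 R" if "\<zeta> \<in> ball 0 (R / norm k)" for \<zeta>
    using that nk by (simp add: dist_norm norm_cscale field_simps)
  have "u (x0 + 1 *s k) = u (x0 + 0 *s k)"
  proof (rule strong_maximum_principle_disc[where u = "\<lambda>\<zeta>. u (x0 + \<zeta> *s k)"])
    show "continuous_on (ball 0 (R / norm k)) (\<lambda>\<zeta>. u (x0 + \<zeta> *s k))"
    proof (rule continuous_on_compose2[OF cont])
      have "continuous_on UNIV (\<lambda>\<zeta>. x0 + \<zeta> *s k)"
        by (simp add: vector_scalar_mult_def) (intro continuous_intros)
      then show "continuous_on (ball 0 (R / norm k)) (\<lambda>\<zeta>. x0 + \<zeta> *s k)"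
        using continuous_on_subset by blast
    qed (use mem in blast)
    show "cmod 1 < R / norm k / 2"
      using y nk by (simp add: k_def dist_norm norm_minus_commute field_simps)
  qed (use mem sub max in auto)
  then show ?thesis by (simp add: k_def)
qed simp

section \<open>Holomorphic charts and (1,0)-differentials\<close>

lemma complex_chartD:
  assumes "complex_chart X (U, \<phi>)"
  shows "openin (top_of_set X) U" "open (\<phi> ` U)" "inj_on \<phi> U"
    "continuous_on U \<phi>" "continuous_on (\<phi> ` U) (inv_into U \<phi>)" "U \<subseteq> X"
proof -
  have h: "homeomorphism U (\<phi> ` U) \<phi> (inv_into U \<phi>)"
    and o: "openin (top_of_set X) U" "open (\<phi> ` U)"
    using assms by (auto simp: complex_chart_def)
  show "openin (top_of_set X) U" "open (\<phi> ` U)" by fact+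
  show "inj_on \<phi> U" using h unfolding homeomorphism_def by (metis inj_on_inverseI)
  show "continuous_on U \<phi>" "continuous_on (\<phi> ` U) (inv_into U \<phi>)"
    using h by (auto simp: homeomorphism_def)
  show "U \<subseteq> X" using o(1) openin_imp_subset by blast
qed

lemma chart_image_iff:
  assumes "complex_chart X (U, \<phi>)"
  shows "x \<in> \<phi> ` (U \<inter> V) \<longleftrightarrow> x \<in> \<phi> ` U \<and> inv_into U \<phi> x \<in> V"
  using complex_chartD(3)[OF assms] by (auto simp: inv_into_f_f)

lemma chart_image_open:
  assumes c: "complex_chart X (U, \<phi>)" and V: "openin (top_of_set X) V"
  shows "open (\<phi> ` (U \<inter> V))"
proof -
  have h: "homeomorphism U (\<phi> ` U) \<phi> (inv_into U \<phi>)" using c by (auto simp: complex_chart_def)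
  have "openin (top_of_set U) (U \<inter> V)"
    using V complex_chartD(6)[OF c] by (auto simp: openin_open)
  then have "openin (top_of_set (\<phi> ` U)) (\<phi> ` (U \<inter> V))"
    using homeomorphism_imp_open_map[OF h] by blast
  then show ?thesis using complex_chartD(2)[OF c] openin_open_trans by blast
qed

lemma complex_chart_restrict:
  assumes c: "complex_chart X (U, \<phi>)" and N: "openin (top_of_set X) N" "N \<subseteq> U"
  shows "complex_chart X (N, \<phi>)"
    and "x \<in> \<phi> ` N \<Longrightarrow> inv_into N \<phi> x = inv_into U \<phi> x"
proof -
  note cD = complex_chartD[OF c]
  have eq: "inv_into N \<phi> x = inv_into U \<phi> x" if "x \<in> \<phi> ` N" for x
  proof -
    obtain p where p: "p \<in> N" "x = \<phi> p" using \<open>x \<in> \<phi> ` N\<close> by blast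
    have "inj_on \<phi> N" using cD(3) N(2) inj_on_subset by blast
    then show ?thesis using p N(2) cD(3) by (auto simp: inv_into_f_f)
  qed
  then show "x \<in> \<phi> ` N \<Longrightarrow> inv_into N \<phi> x = inv_into U \<phi> x" .
  have UN: "U \<inter> N = N" using N(2) by blast
  have "homeomorphism N (\<phi> ` N) \<phi> (inv_into N \<phi>)"
  proof (rule homeomorphismI)
    show "continuous_on N \<phi>" using cD(4) N(2) continuous_on_subset by blast
    have "continuous_on (\<phi> ` N) (inv_into U \<phi>)"
      using cD(5) N(2) continuous_on_subset by (metis image_mono)
    then show "continuous_on (\<phi> ` N) (inv_into N \<phi>)"
      using eq by (metis (no_types, lifting) continuous_on_cong)
    have "inj_on \<phi> N" using cD(3) N(2) inj_on_subset by blast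
    then show "inv_into N \<phi> ` \<phi> ` N \<subseteq> N" "\<And>x. x \<in> N \<Longrightarrow> inv_into N \<phi> (\<phi> x) = x"
      "\<And>y. y \<in> \<phi> ` N \<Longrightarrow> \<phi> (inv_into N \<phi> y) = y"
      by (auto simp: inv_into_f_f)
  qed auto
  then show "complex_chart X (N, \<phi>)"
    using N(1) chart_image_open[OF c N(1)] UN by (auto simp: complex_chart_def)
qed

lemma holo_chart_restrict:
  assumes c: "holo_chart X A (U, \<phi>)" and N: "openin (top_of_set X) N" "N \<subseteq> U"
  shows "holo_chart X A (N, \<phi>)"
proof -
  have cc: "complex_chart X (U, \<phi>)" using c by (auto simp: holo_chart_def)
  note r = complex_chart_restrict[OF cc N]
  have "chart_change_holo (N, \<phi>) c' \<and> chart_change_holo c' (N, \<phi>)" if c': "c' \<in> A" for c'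
  proof -
    obtain W \<kappa> where W: "c' = (W, \<kappa>)" by (cases c')
    have h: "chart_change_holo (U, \<phi>) (W, \<kappa>)" "chart_change_holo (W, \<kappa>) (U, \<phi>)"
      using c c' W by (auto simp: holo_chart_def)
    have "chart_change_holo (N, \<phi>) (W, \<kappa>)"
      unfolding chart_change_holo_def split cholo_on_alt
    proof (intro allI ballI)
      fix i x assume x: "x \<in> \<phi> ` (N \<inter> W)"
      then obtain p where p: "p \<in> N" "p \<in> W" "x = \<phi> p" by blast
      have "cdiff_at (\<lambda>x. \<kappa> (inv_into U \<phi> x) $ i) x"
        using h(1) x N(2) unfolding chart_change_holo_def split cholo_on_alt by blast
      then show "cdiff_at (\<lambda>x. \<kappa> (inv_into N \<phi> x) $ i) x"
      proof (rule cdiff_transform)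
        show "open (\<phi> ` (N \<inter> N))" by (rule chart_image_open[OF r(1) N(1)])
        show "x \<in> \<phi> ` (N \<inter> N)" using p by blast
      qed (use r(2) in auto)
    qed
    moreover have "chart_change_holo (W, \<kappa>) (N, \<phi>)"
      using h(2) N(2) unfolding chart_change_holo_def split cholo_on_def by blast
    ultimately show ?thesis using W by simp
  qed
  with r(1) show ?thesis by (simp add: holo_chart_def)
qed

definition slice_emb :: "complex^'d::finite \<Rightarrow> complex^('d + 'r::finite)" where
  "slice_emb z = (\<chi> i. case i of Inl a \<Rightarrow> z $ a | Inr l \<Rightarrow> 0)"

definition slice_proj :: "complex^('d::finite + 'r::finite) \<Rightarrow> complex^'d" where
  "slice_proj x = (\<chi> a. x $ Inl a)"

lemma slice_emb_nth [simp]: "slice_emb z $ Inl a = z $ a" "slice_emb z $ Inr l = 0"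
  by (simp_all add: slice_emb_def)

lemma slice_proj_nth [simp]: "slice_proj x $ a = x $ Inl a"
  by (simp add: slice_proj_def)

lemma slice_proj_emb [simp]: "slice_proj (slice_emb z) = z"
  by (simp add: vec_eq_iff)

lemma cdiff_slice_emb: "cdiff_at (\<lambda>z. slice_emb z $ i) z"
  by (cases i) (simp_all add: cdiff_coord cdiff_const)

lemma continuous_slice_emb: "continuous_on S slice_emb"
proof -
  have "continuous (at z) slice_emb" for z :: "complex^'d"
    by (rule has_derivative_continuous[OF cdiff_map_derivative[OF cdiff_slice_emb]])
  then show ?thesis by (intro continuous_at_imp_continuous_on ballI)
qed

lemma continuous_slice_proj: "continuous_on S slice_proj"
  unfolding slice_proj_def[abs_def] by (intro continuous_intros)

lemma mholo_on_subset: "mholo_on A f V \<Longrightarrow> V' \<subseteq> V \<Longrightarrow> mholo_on A f V'"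
  unfolding mholo_on_def cholo_on_def by blast

lemma mholo_on_const: "mholo_on A (\<lambda>_. c) V"
  unfolding mholo_on_def cholo_on_alt by (auto simp: o_def intro: cdiff_const)

lemma mholo_on_diff: "mholo_on A f V \<Longrightarrow> mholo_on A g V \<Longrightarrow> mholo_on A (\<lambda>p. f p - g p) V"
  unfolding mholo_on_def cholo_on_alt o_def by (fast intro: cdiff_diff)

lemma mholo_on_mult: "mholo_on A f V \<Longrightarrow> mholo_on A g V \<Longrightarrow> mholo_on A (\<lambda>p. f p * g p) V"
  unfolding mholo_on_def cholo_on_alt o_def by (fast intro: cdiff_mult)

lemma mholo_on_sum:
  "(\<And>k. k \<in> I \<Longrightarrow> mholo_on A (f k) V) \<Longrightarrow> mholo_on A (\<lambda>p. \<Sum>k\<in>I. f k p) V"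
  unfolding mholo_on_def cholo_on_alt o_def by (fast intro: cdiff_sum)

text \<open>The (1,0)-part of the differential, in the same components as \<open>covec\<close>. Metrics are not
  holomorphic, so \<open>covec\<close>, which takes the derivatives in the real coordinate directions only, does not suffice.\<close>

definition del :: "('x, 'n::finite) chart set \<Rightarrow> ('x \<Rightarrow> complex) \<Rightarrow> 'x \<Rightarrow> complex^'n" where
  "del A f p = (let (U, \<phi>) = chart_at A p in (\<chi> i. wirt i (f \<circ> inv_into U \<phi>) (\<phi> p)))"

locale cmanifold =
  fixes X :: "'x::topological_space set" and A :: "('x, 'n::finite) chart set"
  assumes manifold: "complex_manifold X A"
begin

lemma atlas_chart: "(W, \<kappa>) \<in> A \<Longrightarrow> complex_chart X (W, \<kappa>)"
  using manifold by (auto simp: complex_manifold_def)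

lemma atlas_holo_chart: "c \<in> A \<Longrightarrow> holo_chart X A c"
  using manifold by (auto simp: complex_manifold_def holo_chart_def)

lemma atlas_cover: "p \<in> X \<Longrightarrow> \<exists>W \<kappa>. (W, \<kappa>) \<in> A \<and> p \<in> W"
  using manifold by (force simp: complex_manifold_def)

lemma chart_at_props:
  assumes "p \<in> X" "chart_at A p = (W, \<kappa>)"
  shows "(W, \<kappa>) \<in> A" "p \<in> W"
proof -
  obtain W' \<kappa>' where "(W', \<kappa>') \<in> A" "p \<in> W'" using atlas_cover[OF assms(1)] by blast
  then have "\<exists>c. c \<in> A \<and> p \<in> fst c" by force
  from someI_ex[OF this] show "(W, \<kappa>) \<in> A" "p \<in> W" using assms(2) by (simp_all add: chart_at_def)
qed

lemma holo_chart_complex: "holo_chart X A (U, \<phi>) \<Longrightarrow> complex_chart X (U, \<phi>)"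
  by (simp add: holo_chart_def)

lemma transition_cdiff:
  assumes "holo_chart X A (U, \<phi>)" "(W, \<kappa>) \<in> A" "p \<in> U" "p \<in> W"
  shows "cdiff_at (\<lambda>x. \<kappa> (inv_into U \<phi> x) $ k) (\<phi> p)"
    and "cdiff_at (\<lambda>x. \<phi> (inv_into W \<kappa> x) $ k) (\<kappa> p)"
proof -
  have "chart_change_holo (U, \<phi>) (W, \<kappa>)" "chart_change_holo (W, \<kappa>) (U, \<phi>)"
    using assms by (auto simp: holo_chart_def)
  then show "cdiff_at (\<lambda>x. \<kappa> (inv_into U \<phi> x) $ k) (\<phi> p)"
    "cdiff_at (\<lambda>x. \<phi> (inv_into W \<kappa> x) $ k) (\<kappa> p)"
    using assms unfolding chart_change_holo_def cholo_on_alt by auto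
qed

lemma chart_change_eq:
  assumes "complex_chart X (U, \<phi>)" "complex_chart X (W, \<kappa>)" "x \<in> \<phi> ` (U \<inter> W)"
  shows "((f \<circ> inv_into W \<kappa>) \<circ> (\<lambda>x. \<kappa> (inv_into U \<phi> x))) x = (f \<circ> inv_into U \<phi>) x"
  using assms complex_chartD(3)[OF assms(1)] complex_chartD(3)[OF assms(2)]
  by (auto simp: inv_into_f_f)

lemma inv_chart: "complex_chart X (U, \<phi>) \<Longrightarrow> p \<in> U \<Longrightarrow> inv_into U \<phi> (\<phi> p) = p"
  by (rule inv_into_f_f[OF complex_chartD(3)])

lemma mholo_on_holo_chart:
  assumes f: "mholo_on A f V" and V: "openin (top_of_set X) V" and c: "holo_chart X A (U, \<phi>)"
  shows "cholo_on (f \<circ> inv_into U \<phi>) (\<phi> ` (U \<inter> V))"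
  unfolding cholo_on_alt
proof
  fix x assume "x \<in> \<phi> ` (U \<inter> V)"
  then obtain p where p: "p \<in> U" "p \<in> V" "x = \<phi> p" by blast
  note cc = holo_chart_complex[OF c]
  have "p \<in> X" using complex_chartD(6)[OF cc] p by blast
  then obtain W \<kappa> where W: "(W, \<kappa>) \<in> A" "p \<in> W" using atlas_cover by blast
  note cW = atlas_chart[OF W(1)]
  have "cdiff_at (f \<circ> inv_into W \<kappa>) (\<kappa> p)"
    using f W p unfolding mholo_on_def cholo_on_alt by blast
  then have "cdiff_at ((f \<circ> inv_into W \<kappa>) \<circ> (\<lambda>x. \<kappa> (inv_into U \<phi> x))) (\<phi> p)"
    using inv_chart[OF cc p(1)] by (intro cdiff_compose transition_cdiff(1)[OF c W(1) p(1) W(2)]) simp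
  then show "cdiff_at (f \<circ> inv_into U \<phi>) x"
    unfolding p(3)
  proof (rule cdiff_transform)
    show "open (\<phi> ` (U \<inter> W))" by (rule chart_image_open[OF cc complex_chartD(1)[OF cW]])
  qed (use p W chart_change_eq[OF cc cW] in auto)
qed

lemma holo_charts_mholo:
  assumes c: "holo_chart X A (U, \<phi>)"
  shows "mholo_on A (\<lambda>q. \<phi> q $ k) U"
  unfolding mholo_on_def cholo_on_alt
proof (safe)
  fix W \<kappa> x p assume W: "(W, \<kappa>) \<in> A" and p: "p \<in> W" "p \<in> U"
  show "cdiff_at ((\<lambda>q. \<phi> q $ k) \<circ> inv_into W \<kappa>) (\<kappa> p)"
    using transition_cdiff(2)[OF c W p(2,1)] by (simp add: o_def)
qed

text \<open>Coordinate changes are holomorphic, so the (1,0)-part of a differential can be computed in any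
  chart of the holomorphic structure.\<close>

lemma del_in_chart:
  assumes c: "holo_chart X A (U, \<phi>)" and p: "p \<in> U"
    and f: "(f \<circ> inv_into U \<phi>) differentiable (at (\<phi> p))"
  shows "del A f p = (\<Sum>i\<in>UNIV. wirt i (f \<circ> inv_into U \<phi>) (\<phi> p) *s covec A (\<lambda>q. \<phi> q $ i) p)"
proof -
  note cc = holo_chart_complex[OF c]
  have pX: "p \<in> X" using complex_chartD(6)[OF cc] p by blast
  obtain W \<kappa> where at: "chart_at A p = (W, \<kappa>)" by (cases "chart_at A p")
  note W = chart_at_props[OF pX at]
  note cW = atlas_chart[OF W(1)]
  define \<Psi> where "\<Psi> = (\<lambda>x. \<phi> (inv_into W \<kappa> x))"
  have \<Psi>: "\<Psi> (\<kappa> p) = \<phi> p" using inv_chart[OF cW W(2)] by (simp add: \<Psi>_def)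
  have cd: "cdiff_at (\<lambda>x. \<Psi> x $ k) (\<kappa> p)" for k
    unfolding \<Psi>_def by (rule transition_cdiff(2)[OF c W(1) p W(2)])
  note ch = wirt_chain[where f = "f \<circ> inv_into U \<phi>", OF cd, unfolded \<Psi>, OF f]
  have op: "open (\<kappa> ` (W \<inter> U))" by (rule chart_image_open[OF cW complex_chartD(1)[OF cc]])
  have "wirt j (f \<circ> inv_into W \<kappa>) (\<kappa> p) = wirt j ((f \<circ> inv_into U \<phi>) \<circ> \<Psi>) (\<kappa> p)" for j
    by (rule wirt_transform(1)[OF ch(1) op, symmetric])
      (use W(2) p chart_change_eq[OF cW cc] in \<open>auto simp: \<Psi>_def\<close>)
  moreover have "covec A (\<lambda>q. \<phi> q $ i) p $ j = wirt j (\<lambda>x. \<Psi> x $ i) (\<kappa> p)" for i j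
    unfolding cdiff_wirt(2)[OF cd] by (simp add: covec_def at \<Psi>_def o_def)
  ultimately show ?thesis
    by (simp add: vec_eq_iff del_def at ch(2))
qed

lemma covec_eq_del:
  assumes "mholo_on A f V" "p \<in> V" "p \<in> X"
  shows "covec A f p = del A f p"
proof -
  obtain W \<kappa> where at: "chart_at A p = (W, \<kappa>)" by (cases "chart_at A p")
  note W = chart_at_props[OF assms(3) at]
  have "cdiff_at (f \<circ> inv_into W \<kappa>) (\<kappa> p)"
    using assms W unfolding mholo_on_def cholo_on_alt by blast
  from cdiff_wirt(2)[OF this] show ?thesis by (simp add: covec_def del_def at vec_eq_iff)
qed

end

section \<open>Submanifolds and sections of the conormal sheaf\<close>

locale submanifold = cmanifold X A
  for X :: "'x::topological_space set" and A :: "('x, 'd::finite + 'r::finite) chart set" +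
  fixes Y :: "'x set"
  assumes submfd: "complex_submanifold X A Y"
begin

lemma Y_sub: "Y \<subseteq> X"
  using submfd by (simp add: complex_submanifold_def)

lemma slice_at: "p \<in> Y \<Longrightarrow> \<exists>U \<phi>. slice_chart X A Y (U, \<phi>) \<and> p \<in> U"
  using submfd by (force simp: complex_submanifold_def)

lemma slice_holo: "slice_chart X A Y (U, \<phi>) \<Longrightarrow> holo_chart X A (U, \<phi>)"
  by (simp add: slice_chart_def)

lemma slice_complex: "slice_chart X A Y (U, \<phi>) \<Longrightarrow> complex_chart X (U, \<phi>)"
  by (simp add: slice_chart_def holo_chart_def)

lemma slice_emb_proj:
  assumes "slice_chart X A Y (U, \<phi>)" "p \<in> U" "p \<in> Y"
  shows "slice_emb (slice_proj (\<phi> p)) = \<phi> p"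
proof -
  have "\<phi> p $ Inr l = 0" for l using assms by (auto simp: slice_chart_def)
  then show ?thesis unfolding vec_eq_iff by (metis slice_emb_nth slice_proj_nth sum.exhaust)
qed

lemma slice_inv:
  assumes c: "slice_chart X A Y (U, \<phi>)" and z: "slice_emb z \<in> \<phi> ` U"
  shows "inv_into U \<phi> (slice_emb z) \<in> U \<inter> Y" "\<phi> (inv_into U \<phi> (slice_emb z)) = slice_emb z"
proof -
  obtain p where p: "p \<in> U" "slice_emb z = \<phi> p" using z by blast
  have "p \<in> Y" using c p(1) by (auto simp: slice_chart_def simp flip: p(2))
  then show "inv_into U \<phi> (slice_emb z) \<in> U \<inter> Y" "\<phi> (inv_into U \<phi> (slice_emb z)) = slice_emb z"
    using p inv_chart[OF slice_complex[OF c] p(1)] by auto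
qed

lemma openin_Y_extend:
  assumes "openin (top_of_set Y) V"
  obtains V' where "openin (top_of_set X) V'" "V = Y \<inter> V'"
proof -
  obtain T where "open T" "V = Y \<inter> T" using assms by (auto simp: openin_open)
  then show ?thesis using that[of "X \<inter> T"] Y_sub by (auto simp: openin_open)
qed

lemma slice_open:
  assumes c: "slice_chart X A Y (U, \<phi>)" and V: "openin (top_of_set X) V"
  shows "open {z. slice_emb z \<in> \<phi> ` (U \<inter> V)}"
  using open_vimage[OF chart_image_open[OF slice_complex[OF c] V] continuous_slice_emb]
  by (simp add: vimage_def)

lemma sub_chart_inv:
  assumes c: "slice_chart X A Y (U, \<phi>)" and z: "slice_emb z \<in> \<phi> ` U"
  shows "inv_into (U \<inter> Y) (\<lambda>p. slice_proj (\<phi> p)) z = inv_into U \<phi> (slice_emb z)"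
proof -
  define p where "p = inv_into U \<phi> (slice_emb z)"
  have p: "p \<in> U \<inter> Y" "\<phi> p = slice_emb z" using slice_inv[OF c z] by (auto simp: p_def)
  have "inj_on (\<lambda>p. slice_proj (\<phi> p)) (U \<inter> Y)"
  proof (rule inj_onI)
    fix q q' assume q: "q \<in> U \<inter> Y" "q' \<in> U \<inter> Y" "slice_proj (\<phi> q) = slice_proj (\<phi> q')"
    then have "\<phi> q = \<phi> q'" using slice_emb_proj[OF c] by (metis Int_iff)
    then show "q = q'" using complex_chartD(3)[OF slice_complex[OF c]] q by (meson Int_iff inj_onD)
  qed
  from inv_into_f_f[OF this p(1)] show ?thesis by (simp add: p(2)) (simp add: p_def)
qed

lemma sub_atlas_alt:
  "sub_atlas X A Y = {(U \<inter> Y, \<lambda>p. slice_proj (\<phi> p)) | U \<phi>. slice_chart X A Y (U, \<phi>)}"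
  unfolding sub_atlas_def slice_proj_def ..

text \<open>The charts of \<open>sub_atlas\<close> are projections, and holomorphy refers to their inverses. These are
  replaced by inverses of slice charts along \<open>slice_emb\<close>, to which the chain rule applies directly.\<close>

lemma mholo_sub_iff:
  assumes "V \<subseteq> Y"
  shows "mholo_on (sub_atlas X A Y) f V \<longleftrightarrow>
    (\<forall>U \<phi> p. slice_chart X A Y (U, \<phi>) \<and> p \<in> U \<and> p \<in> V \<longrightarrow>
       cdiff_at (\<lambda>z. f (inv_into U \<phi> (slice_emb z))) (slice_proj (\<phi> p)))"
proof -
  have "cdiff_at (f \<circ> inv_into (U \<inter> Y) (\<lambda>p. slice_proj (\<phi> p))) (slice_proj (\<phi> p))
     \<longleftrightarrow> cdiff_at (\<lambda>z. f (inv_into U \<phi> (slice_emb z))) (slice_proj (\<phi> p))"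
    if c: "slice_chart X A Y (U, \<phi>)" and p: "p \<in> U" "p \<in> V" for U \<phi> p
  proof -
    have op: "open {z. slice_emb z \<in> \<phi> ` U}"
      using slice_open[OF c complex_chartD(1)[OF slice_complex[OF c]]] by simp
    have mem: "slice_proj (\<phi> p) \<in> {z. slice_emb z \<in> \<phi> ` U}"
      using slice_emb_proj[OF c p(1)] p assms by auto
    have eq: "(f \<circ> inv_into (U \<inter> Y) (\<lambda>p. slice_proj (\<phi> p))) z = f (inv_into U \<phi> (slice_emb z))"
      if "z \<in> {z. slice_emb z \<in> \<phi> ` U}" for z
      using sub_chart_inv[OF c, of z] that by simp
    show ?thesis
      by (rule iffI; erule cdiff_transform[OF _ op mem]) (use eq in simp_all)
  qed
  moreover have "mholo_on (sub_atlas X A Y) f V \<longleftrightarrow> (\<forall>U \<phi> p. slice_chart X A Y (U, \<phi>) \<and> p \<in> U \<inter> Y \<inter> V \<longrightarrow>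
      cdiff_at (f \<circ> inv_into (U \<inter> Y) (\<lambda>p. slice_proj (\<phi> p))) (slice_proj (\<phi> p)))"
    unfolding mholo_on_def sub_atlas_alt cholo_on_alt by blast
  moreover have "U \<inter> Y \<inter> V = U \<inter> V" for U using assms by blast
  ultimately show ?thesis by (simp add: conj_ac)
qed

lemma slice_param_cdiff:
  assumes c: "slice_chart X A Y (U, \<phi>)" and W: "(W, \<kappa>) \<in> A" and p: "p \<in> U" "p \<in> Y" "p \<in> W"
  shows "cdiff_at (\<lambda>z. \<kappa> (inv_into U \<phi> (slice_emb z)) $ k) (slice_proj (\<phi> p))"
    and "inv_into U \<phi> (slice_emb (slice_proj (\<phi> p))) = p"
proof -
  note e = slice_emb_proj[OF c p(1,2)]
  show "inv_into U \<phi> (slice_emb (slice_proj (\<phi> p))) = p"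
    unfolding e by (rule inv_chart[OF slice_complex[OF c] p(1)])
  have "cdiff_at ((\<lambda>x. \<kappa> (inv_into U \<phi> x) $ k) \<circ> slice_emb) (slice_proj (\<phi> p))"
    by (rule cdiff_compose[OF cdiff_slice_emb])
      (simp add: e transition_cdiff(1)[OF slice_holo[OF c] W p(1) p(3)])
  then show "cdiff_at (\<lambda>z. \<kappa> (inv_into U \<phi> (slice_emb z)) $ k) (slice_proj (\<phi> p))"
    by (simp add: o_def)
qed

lemma mholo_sub_of_coordinates:
  assumes W: "(W, \<kappa>) \<in> A" and V: "V \<subseteq> Y" "V \<subseteq> W" and G: "\<And>q. q \<in> V \<Longrightarrow> cdiff_at G (\<kappa> q)"
  shows "mholo_on (sub_atlas X A Y) (\<lambda>q. G (\<kappa> q)) V"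
  unfolding mholo_sub_iff[OF V(1)]
proof (intro allI impI, elim conjE)
  fix U \<phi> p assume c: "slice_chart X A Y (U, \<phi>)" and p: "p \<in> U" "p \<in> V"
  have pYW: "p \<in> Y" "p \<in> W" using p V by auto
  have "cdiff_at (G \<circ> (\<lambda>z. \<kappa> (inv_into U \<phi> (slice_emb z)))) (slice_proj (\<phi> p))"
    by (rule cdiff_compose[OF slice_param_cdiff(1)[OF c W p(1) pYW]])
      (simp add: slice_param_cdiff(2)[OF c W p(1) pYW] G p)
  then show "cdiff_at (\<lambda>z. G (\<kappa> (inv_into U \<phi> (slice_emb z)))) (slice_proj (\<phi> p))"
    by (simp add: o_def)
qed

definition conormal_rep_at :: "'x set \<Rightarrow> ('x \<Rightarrow> complex^('d + 'r)) \<Rightarrow> 'x \<Rightarrow> bool" where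
  "conormal_rep_at U \<xi> p \<longleftrightarrow> (\<exists>W \<phi> g. holo_chart X A (W, \<phi>) \<and> p \<in> W \<and>
     (\<forall>i. mholo_on (sub_atlas X A Y) (g i) (U \<inter> W)) \<and>
     (\<forall>q\<in>U \<inter> W. \<xi> q = (\<Sum>i\<in>UNIV. g i q *s covec A (\<lambda>q'. \<phi> q' $ i) q)))"

lemma conormal_rep_atI:
  assumes "holo_chart X A (W, \<phi>)" "p \<in> W" "\<And>i. mholo_on (sub_atlas X A Y) (g i) (U \<inter> W)"
    and "\<And>q. q \<in> U \<inter> W \<Longrightarrow> \<xi> q = (\<Sum>i\<in>UNIV. g i q *s covec A (\<lambda>q'. \<phi> q' $ i) q)"
  shows "conormal_rep_at U \<xi> p"
  unfolding conormal_rep_at_def using assms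
  by (intro exI[of _ W] exI[of _ \<phi>] exI[of _ g]) simp

lemma conormal_sheaf_iff:
  "\<xi> \<in> conormal_sheaf X A Y U \<longleftrightarrow>
     (\<forall>p\<in>U. \<forall>v\<in>sub_tangent X A Y p. (\<Sum>i\<in>UNIV. \<xi> p $ i * v $ i) = 0) \<and> (\<forall>p\<in>U. conormal_rep_at U \<xi> p)"
  unfolding conormal_sheaf_def conormal_rep_at_def mem_Collect_eq ..

text \<open>Sections of the conormal sheaf may be written in different charts, and to add two of them they
  must be brought to a common one. The coefficients change by partial derivatives of holomorphic
  functions, which are holomorphic.\<close>

lemma conormal_rep_in_atlas_chart:
  assumes \<xi>: "\<xi> \<in> conormal_sheaf X A Y U" and U: "U \<subseteq> Y" and p: "p \<in> U" "p \<in> W" and W: "(W, \<kappa>) \<in> A"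
  shows "\<exists>N g. openin (top_of_set X) N \<and> p \<in> N \<and> N \<subseteq> W \<and>
     (\<forall>i. mholo_on (sub_atlas X A Y) (g i) (U \<inter> N)) \<and>
     (\<forall>q\<in>U \<inter> N. \<xi> q = (\<Sum>i\<in>UNIV. g i q *s covec A (\<lambda>q'. \<kappa> q' $ i) q))"
proof -
  obtain W' \<phi> g where c: "holo_chart X A (W', \<phi>)" "p \<in> W'"
    and g: "\<And>i. mholo_on (sub_atlas X A Y) (g i) (U \<inter> W')"
    and eq: "\<And>q. q \<in> U \<inter> W' \<Longrightarrow> \<xi> q = (\<Sum>i\<in>UNIV. g i q *s covec A (\<lambda>q'. \<phi> q' $ i) q)"
    using \<xi> p unfolding conormal_sheaf_iff conormal_rep_at_def by blast
  define N where "N = W \<inter> W'"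
  note cW = atlas_chart[OF W] and cc = holo_chart_complex[OF c(1)]
  have N: "openin (top_of_set X) N" "p \<in> N" "N \<subseteq> W"
    using complex_chartD(1)[OF cW] complex_chartD(1)[OF cc] p c by (auto simp: N_def)
  define G where "G k i = wirt i ((\<lambda>q. \<phi> q $ k) \<circ> inv_into W \<kappa>)" for k i
  have op: "open (\<kappa> ` (W \<inter> W'))" by (rule chart_image_open[OF cW complex_chartD(1)[OF cc]])
  have hol: "cholo_on ((\<lambda>q. \<phi> q $ k) \<circ> inv_into W \<kappa>) (\<kappa> ` (W \<inter> W'))" for k
    by (rule mholo_on_holo_chart[OF holo_charts_mholo[OF c(1)] complex_chartD(1)[OF cc] atlas_holo_chart[OF W]])
  have G: "cdiff_at (G k i) (\<kappa> q)" if "q \<in> N" for q k i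
    using cholo_wirt[OF op hol, of i k] that unfolding G_def cholo_on_alt N_def by blast
  define g' where "g' i q = (\<Sum>k\<in>UNIV. g k q * G k i (\<kappa> q))" for i q
  have "mholo_on (sub_atlas X A Y) (g' i) (U \<inter> N)" for i
    unfolding g'_def
    by (intro mholo_on_sum mholo_on_mult mholo_sub_of_coordinates[OF W] G mholo_on_subset[OF g])
      (use U N(3) in \<open>auto simp: N_def\<close>)
  moreover have "\<xi> q = (\<Sum>i\<in>UNIV. g' i q *s covec A (\<lambda>q'. \<kappa> q' $ i) q)" if q: "q \<in> U \<inter> N" for q
  proof -
    have qX: "q \<in> X" "q \<in> W" "q \<in> W'" using q U Y_sub by (auto simp: N_def)
    have "covec A (\<lambda>q'. \<phi> q' $ k) q = (\<Sum>i\<in>UNIV. G k i (\<kappa> q) *s covec A (\<lambda>q'. \<kappa> q' $ i) q)" for k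
      unfolding G_def covec_eq_del[OF holo_charts_mholo[OF c(1)] qX(3,1)]
      by (rule del_in_chart[OF atlas_holo_chart[OF W] qX(2)], rule cdiff_imp_differentiable)
        (use hol[of k] qX in \<open>auto simp: cholo_on_alt\<close>)
    then have "\<xi> q = (\<Sum>k\<in>UNIV. g k q *s (\<Sum>i\<in>UNIV. G k i (\<kappa> q) *s covec A (\<lambda>q'. \<kappa> q' $ i) q))"
      using eq q by (simp add: N_def)
    also have "\<dots> = (\<Sum>i\<in>UNIV. g' i q *s covec A (\<lambda>q'. \<kappa> q' $ i) q)"
      unfolding vec_eq_iff
    proof
      fix j
      have "(\<Sum>k\<in>UNIV. g k q *s (\<Sum>i\<in>UNIV. G k i (\<kappa> q) *s covec A (\<lambda>q'. \<kappa> q' $ i) q)) $ j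
          = (\<Sum>k\<in>UNIV. \<Sum>i\<in>UNIV. g k q * G k i (\<kappa> q) * covec A (\<lambda>q'. \<kappa> q' $ i) q $ j)"
        by (simp add: sum_distrib_left mult.assoc)
      also have "\<dots> = (\<Sum>i\<in>UNIV. \<Sum>k\<in>UNIV. g k q * G k i (\<kappa> q) * covec A (\<lambda>q'. \<kappa> q' $ i) q $ j)"
        by (rule sum.swap)
      finally show "(\<Sum>k\<in>UNIV. g k q *s (\<Sum>i\<in>UNIV. G k i (\<kappa> q) *s covec A (\<lambda>q'. \<kappa> q' $ i) q)) $ j
          = (\<Sum>i\<in>UNIV. g' i q *s covec A (\<lambda>q'. \<kappa> q' $ i) q) $ j"
        by (simp add: g'_def sum_distrib_right)
    qed
    finally show ?thesis .
  qed
  ultimately show ?thesis using N by blast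
qed

lemma conormal_sheaf_restrict:
  assumes "\<xi> \<in> conormal_sheaf X A Y U" "V \<subseteq> U"
  shows "\<xi> \<in> conormal_sheaf X A Y V"
proof -
  have "conormal_rep_at V \<xi> p" if p: "p \<in> V" for p
  proof -
    have "conormal_rep_at U \<xi> p" using assms p unfolding conormal_sheaf_iff by blast
    then obtain W \<phi> g where c: "holo_chart X A (W, \<phi>)" "p \<in> W"
      and g: "\<And>i. mholo_on (sub_atlas X A Y) (g i) (U \<inter> W)"
      and eq: "\<And>q. q \<in> U \<inter> W \<Longrightarrow> \<xi> q = (\<Sum>i\<in>UNIV. g i q *s covec A (\<lambda>q'. \<phi> q' $ i) q)"
      unfolding conormal_rep_at_def by blast
    show ?thesis
      by (rule conormal_rep_atI[OF c mholo_on_subset[OF g] eq]) (use assms(2) in blast)+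
  qed
  with assms show ?thesis unfolding conormal_sheaf_iff by blast
qed

lemma conormal_sheaf_cong:
  assumes \<xi>: "\<xi> \<in> conormal_sheaf X A Y U" and eq: "\<And>p. p \<in> U \<Longrightarrow> \<xi> p = \<eta> p"
  shows "\<eta> \<in> conormal_sheaf X A Y U"
proof -
  have 1: "(\<forall>q\<in>U \<inter> W. \<xi> q = h q) \<longleftrightarrow> (\<forall>q\<in>U \<inter> W. \<eta> q = h q)" for W h using eq by auto
  have 2: "(\<forall>p\<in>U. \<forall>v\<in>sub_tangent X A Y p. (\<Sum>i\<in>UNIV. \<xi> p $ i * v $ i) = 0)
     \<longleftrightarrow> (\<forall>p\<in>U. \<forall>v\<in>sub_tangent X A Y p. (\<Sum>i\<in>UNIV. \<eta> p $ i * v $ i) = 0)" using eq by simp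
  show ?thesis using \<xi> unfolding conormal_sheaf_def mem_Collect_eq 1 2 .
qed

lemma conormal_sheaf_zero:
  assumes "U \<subseteq> Y"
  shows "(\<lambda>_. 0) \<in> conormal_sheaf X A Y U"
proof -
  have "conormal_rep_at U (\<lambda>_. 0) p" if p: "p \<in> U" for p
  proof -
    obtain W \<kappa> where W: "(W, \<kappa>) \<in> A" "p \<in> W" using atlas_cover Y_sub assms p by blast
    show ?thesis
      by (rule conormal_rep_atI[OF atlas_holo_chart[OF W(1)] W(2) mholo_on_const[of _ 0]]) simp
  qed
  then show ?thesis unfolding conormal_sheaf_iff by simp
qed

lemma conormal_sheaf_diff:
  assumes \<xi>: "\<xi> \<in> conormal_sheaf X A Y U" and \<eta>: "\<eta> \<in> conormal_sheaf X A Y U" and U: "U \<subseteq> Y"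
  shows "(\<lambda>p. \<xi> p - \<eta> p) \<in> conormal_sheaf X A Y U"
proof -
  have "conormal_rep_at U (\<lambda>p. \<xi> p - \<eta> p) p" if p: "p \<in> U" for p
  proof -
    obtain W \<kappa> where W: "(W, \<kappa>) \<in> A" "p \<in> W" using atlas_cover Y_sub U p by blast
    obtain N g where N: "openin (top_of_set X) N" "p \<in> N" "N \<subseteq> W"
      and g: "\<And>i. mholo_on (sub_atlas X A Y) (g i) (U \<inter> N)"
        "\<And>q. q \<in> U \<inter> N \<Longrightarrow> \<xi> q = (\<Sum>i\<in>UNIV. g i q *s covec A (\<lambda>q'. \<kappa> q' $ i) q)"
      using conormal_rep_in_atlas_chart[OF \<xi> U p W(2,1)] by blast
    obtain N' g' where N': "openin (top_of_set X) N'" "p \<in> N'" "N' \<subseteq> W"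
      and g': "\<And>i. mholo_on (sub_atlas X A Y) (g' i) (U \<inter> N')"
        "\<And>q. q \<in> U \<inter> N' \<Longrightarrow> \<eta> q = (\<Sum>i\<in>UNIV. g' i q *s covec A (\<lambda>q'. \<kappa> q' $ i) q)"
      using conormal_rep_in_atlas_chart[OF \<eta> U p W(2,1)] by blast
    have "holo_chart X A (N \<inter> N', \<kappa>)"
      using holo_chart_restrict[OF atlas_holo_chart[OF W(1)]] N N' by (meson Int_lower1 openin_Int order_trans)
    moreover have "mholo_on (sub_atlas X A Y) (\<lambda>q. g i q - g' i q) (U \<inter> (N \<inter> N'))" for i
      by (intro mholo_on_diff mholo_on_subset[OF g(1)] mholo_on_subset[OF g'(1)]) auto
    moreover have "\<xi> q - \<eta> q = (\<Sum>i\<in>UNIV. (g i q - g' i q) *s covec A (\<lambda>q'. \<kappa> q' $ i) q)"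
      if "q \<in> U \<inter> (N \<inter> N')" for q
      using g(2)[of q] g'(2)[of q] that
      by (simp add: vec_eq_iff left_diff_distrib sum_subtractf)
    ultimately show ?thesis
      using N(2) N'(2) by (intro conormal_rep_atI[where W = "N \<inter> N'"]) auto
  qed
  moreover have "(\<Sum>i\<in>UNIV. (\<xi> p - \<eta> p) $ i * v $ i) = 0" if "p \<in> U" "v \<in> sub_tangent X A Y p" for p v
    using \<xi> \<eta> that unfolding conormal_sheaf_iff by (simp add: left_diff_distrib sum_subtractf)
  ultimately show ?thesis unfolding conormal_sheaf_iff by blast
qed

end

section \<open>Local minimum principles on compact spaces\<close>

text \<open>On the connected component of \<open>p\<close> the function attains its minimum. The set where it does is
  closed, and open by the local principle: the connected set \<open>B\<close> stays inside the component, and on the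
  smaller set \<open>B'\<close> the function is constant if the minimum is attained at its centre. So this set is the
  whole component.\<close>

lemma locally_constant_if_local_minimum_principle:
  fixes f :: "'x::topological_space \<Rightarrow> real"
  assumes Y: "compact Y" and f: "continuous_on Y f"
    and B: "\<And>p. p \<in> Y \<Longrightarrow> \<exists>B B'. openin (top_of_set Y) B' \<and> connected B \<and> B \<subseteq> Y \<and> p \<in> B' \<and> B' \<subseteq> B \<and>
       ((\<forall>q\<in>B. f p \<le> f q) \<longrightarrow> (\<forall>q\<in>B'. f q = f p))"
    and p: "p \<in> Y"
  shows "\<exists>B. openin (top_of_set Y) B \<and> p \<in> B \<and> (\<forall>q\<in>B. f q = f p)"
proof -
  define C where "C = connected_component_set Y p"
  have C: "connected C" "C \<subseteq> Y" "p \<in> C" "closedin (top_of_set Y) C"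
    using p by (auto simp: C_def connected_component_subset closedin_connected_component)
  have maxC: "B \<subseteq> C" if "connected B" "B \<subseteq> Y" "q \<in> B" "q \<in> C" for B q
    using that connected_component_maximal[of q B Y] connected_component_eq[of q Y p] by (auto simp: C_def)
  have "compact C" using closedin_compact[OF Y C(4)] .
  then obtain q0 where q0: "q0 \<in> C" "\<And>q. q \<in> C \<Longrightarrow> f q0 \<le> f q"
    using continuous_attains_inf[of C f] C continuous_on_subset[OF f C(2)] by blast
  define S where "S = {q \<in> C. f q = f q0}"
  have loc: "\<exists>B. openin (top_of_set Y) B \<and> q \<in> B \<and> B \<subseteq> C \<and> (f q = f q0 \<longrightarrow> B \<subseteq> S)" if q: "q \<in> C" for q
  proof -
    have qY: "q \<in> Y" using q C(2) by blast
    obtain B B' where B: "openin (top_of_set Y) B'" "connected B" "B \<subseteq> Y" "q \<in> B'" "B' \<subseteq> B"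
      "(\<forall>q'\<in>B. f q \<le> f q') \<longrightarrow> (\<forall>q'\<in>B'. f q' = f q)" using B[OF qY] by blast
    have "B \<subseteq> C" using maxC[OF B(2,3) _ q] B(4,5) by blast
    moreover have "B' \<subseteq> S" if fq: "f q = f q0"
    proof
      fix x assume x: "x \<in> B'"
      have "\<forall>q'\<in>B. f q \<le> f q'" using q0(2) \<open>B \<subseteq> C\<close> fq by (simp add: subset_iff)
      then have "f x = f q" using B(6) x by blast
      moreover have "x \<in> C" using x B(5) \<open>B \<subseteq> C\<close> by blast
      ultimately show "x \<in> S" using fq by (simp add: S_def)
    qed
    ultimately show ?thesis using B(1,4,5) by (intro exI[of _ B']) blast
  qed
  have "openin (top_of_set C) S"
  proof (subst openin_subopen, intro ballI)
    fix q assume "q \<in> S"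
    then have "q \<in> C" "f q = f q0" by (auto simp: S_def)
    then obtain B where "openin (top_of_set Y) B" "q \<in> B" "B \<subseteq> S" "B \<subseteq> C" using loc by blast
    moreover from this have "openin (top_of_set C) B" using C(2) openin_subset_trans by blast
    ultimately show "\<exists>T. openin (top_of_set C) T \<and> q \<in> T \<and> T \<subseteq> S" by blast
  qed
  moreover have "closedin (top_of_set C) S"
    unfolding S_def by (rule continuous_closedin_preimage_constant[OF continuous_on_subset[OF f C(2)]])
  moreover have "S \<noteq> {}" using q0 by (auto simp: S_def)
  ultimately have SC: "S = C" using C(1) unfolding connected_clopen by blast
  obtain B where "openin (top_of_set Y) B" "p \<in> B" "B \<subseteq> C" using loc[OF C(3)] by blast
  with SC C(3) show ?thesis unfolding S_def by (metis (mono_tags, lifting) mem_Collect_eq subset_iff)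
qed

section \<open>Coboundaries in Cech cohomology\<close>

lemma minuend_minus_difference: "x - h = r \<Longrightarrow> x = s \<Longrightarrow> h = s - r" for x h r s :: "'v::ab_group_add"
  by auto

text \<open>Any two coboundaries are cohomologous to the same cocycles. The refinement for the first one is
  refined further by the covering of the second one, and the 0-cochain is corrected by the difference
  of the two 0-cochains that trivialize the coboundaries.\<close>

lemma cech_rel1_of_coboundaries:
  fixes F :: "'x::topological_space set \<Rightarrow> ('x \<Rightarrow> 'v::ab_group_add) set"
  assumes restr: "\<And>U V s. s \<in> F U \<Longrightarrow> V \<subseteq> U \<Longrightarrow> s \<in> F V"
    and cong: "\<And>U s t. s \<in> F U \<Longrightarrow> (\<And>p. p \<in> U \<Longrightarrow> s p = t p) \<Longrightarrow> t \<in> F U"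
    and diff: "\<And>U s t. U \<subseteq> Y \<Longrightarrow> s \<in> F U \<Longrightarrow> t \<in> F U \<Longrightarrow> (\<lambda>p. s p - t p) \<in> F U"
    and c1: "\<And>i. i < n1 \<Longrightarrow> \<zeta>1 i \<in> F (U1 i)"
      "\<And>i j p. i < n1 \<Longrightarrow> j < n1 \<Longrightarrow> p \<in> U1 i \<inter> U1 j \<Longrightarrow> \<xi>1 i j p = \<zeta>1 j p - \<zeta>1 i p"
    and c2: "finite_open_cover Y n2 U2" "\<And>i. i < n2 \<Longrightarrow> \<zeta>2 i \<in> F (U2 i)"
      "\<And>i j p. i < n2 \<Longrightarrow> j < n2 \<Longrightarrow> p \<in> U2 i \<inter> U2 j \<Longrightarrow> \<xi>2 i j p = \<zeta>2 j p - \<zeta>2 i p"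
    and rel: "((n1, U1, \<xi>1), y) \<in> cech_rel1 Y F"
  shows "((n2, U2, \<xi>2), y) \<in> cech_rel1 Y F"
proof -
  obtain m V \<eta> where y: "y = (m, V, \<eta>)" by (cases y)
  obtain k W \<sigma> \<tau> \<zeta> where yZ: "(m, V, \<eta>) \<in> cech_Z1 Y F"
    and W: "finite_open_cover Y k W"
    and ref: "\<And>i. i < k \<Longrightarrow> \<sigma> i < n1 \<and> W i \<subseteq> U1 (\<sigma> i) \<and> \<tau> i < m \<and> W i \<subseteq> V (\<tau> i) \<and> \<zeta> i \<in> F (W i)"
    and eq: "\<And>i j p. i < k \<Longrightarrow> j < k \<Longrightarrow> p \<in> W i \<inter> W j \<Longrightarrow> \<xi>1 (\<sigma> i) (\<sigma> j) p - \<eta> (\<tau> i) (\<tau> j) p = \<zeta> j p - \<zeta> i p"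
    using rel unfolding y cech_rel1_def by blast
  have U2Y: "U2 i \<subseteq> Y" if "i < n2" for i
    using c2(1) that unfolding finite_open_cover_def by blast
  have WY: "W i \<subseteq> Y" if "i < k" for i
    using W that unfolding finite_open_cover_def by blast
  have Z2: "(n2, U2, \<xi>2) \<in> cech_Z1 Y F"
  proof -
    have "\<xi>2 i j \<in> F (U2 i \<inter> U2 j)" if "i < n2" "j < n2" for i j
    proof (rule cong)
      show "(\<lambda>p. \<zeta>2 j p - \<zeta>2 i p) \<in> F (U2 i \<inter> U2 j)"
        using U2Y[OF that(1)] by (intro diff restr[OF c2(2)[OF that(1)]] restr[OF c2(2)[OF that(2)]]) auto
    qed (use c2(3)[OF that] in simp)
    moreover have "\<xi>2 i j p + \<xi>2 j l p = \<xi>2 i l p"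
      if "i < n2" "j < n2" "l < n2" "p \<in> U2 i \<inter> U2 j \<inter> U2 l" for i j l p
      using c2(3)[of i j p] c2(3)[of j l p] c2(3)[of i l p] that by simp
    ultimately show ?thesis using c2(1) unfolding cech_Z1_def by simp
  qed
  \<comment> \<open>Pairs (refining set, set of the second covering) are enumerated by division with remainder.\<close>
  define a where "a i = i div n2" for i :: nat
  define b where "b i = i mod n2" for i :: nat
  define W' where "W' i = W (a i) \<inter> U2 (b i)" for i
  define \<zeta>' where "\<zeta>' i = (\<lambda>p. \<zeta>2 (b i) p - (\<zeta>1 (\<sigma> (a i)) p - \<zeta> (a i) p))" for i
  have ab: "a i < k" "b i < n2" if "i < k * n2" for i
  proof -
    have "0 < n2" using that by (cases n2) auto
    then show "b i < n2" by (simp add: b_def)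
    show "a i < k" using that by (simp add: a_def less_mult_imp_div_less)
  qed
  have cover: "finite_open_cover Y (k * n2) W'"
    unfolding finite_open_cover_def
  proof (intro conjI allI impI)
    fix i assume "i < k * n2"
    then show "openin (top_of_set Y) (W' i)"
      using ab[of i] W c2(1) unfolding W'_def finite_open_cover_def by (intro openin_Int) auto
  next
    show "(\<Union>i<k * n2. W' i) = Y"
    proof (intro equalityI subsetI)
      fix p assume "p \<in> (\<Union>i<k * n2. W' i)"
      then obtain i where "i < k * n2" "p \<in> W' i" by blast
      then show "p \<in> Y" using WY[OF ab(1)] by (auto simp: W'_def)
    next
      fix p assume "p \<in> Y"
      then obtain i j where i: "i < k" "p \<in> W i" and j: "j < n2" "p \<in> U2 j"
        using W c2(1) unfolding finite_open_cover_def by blast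
      have "i * n2 + j < Suc i * n2" using j(1) by simp
      also have "\<dots> \<le> k * n2" using i(1) by (intro mult_right_mono) auto
      finally have "i * n2 + j < k * n2" .
      moreover have "p \<in> W' (i * n2 + j)" using i j by (simp add: W'_def a_def b_def)
      ultimately show "p \<in> (\<Union>i<k * n2. W' i)" by blast
    qed
  qed
  have "b i < n2 \<and> W' i \<subseteq> U2 (b i) \<and> \<tau> (a i) < m \<and> W' i \<subseteq> V (\<tau> (a i)) \<and> \<zeta>' i \<in> F (W' i)"
    if i: "i < k * n2" for i
  proof -
    note r = ref[OF ab(1)[OF i]]
    have "W' i \<subseteq> Y" using WY[OF ab(1)[OF i]] by (auto simp: W'_def)
    moreover have "\<zeta>2 (b i) \<in> F (W' i)" by (rule restr[OF c2(2)[OF ab(2)[OF i]]]) (simp add: W'_def)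
    moreover have "\<zeta>1 (\<sigma> (a i)) \<in> F (W' i)" by (rule restr[OF c1(1)]) (use r in \<open>auto simp: W'_def\<close>)
    moreover have "\<zeta> (a i) \<in> F (W' i)" by (rule restr[of _ "W (a i)"]) (use r in \<open>auto simp: W'_def\<close>)
    ultimately have "\<zeta>' i \<in> F (W' i)" unfolding \<zeta>'_def by (intro diff)
    with r ab[OF i] show ?thesis by (auto simp: W'_def)
  qed
  moreover have "\<xi>2 (b i) (b j) p - \<eta> (\<tau> (a i)) (\<tau> (a j)) p = \<zeta>' j p - \<zeta>' i p"
    if "i < k * n2" "j < k * n2" "p \<in> W' i \<inter> W' j" for i j p
  proof -
    note abi = ab[OF that(1)] and abj = ab[OF that(2)]
    have x2: "\<xi>2 (b i) (b j) p = \<zeta>2 (b j) p - \<zeta>2 (b i) p"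
      using c2(3)[OF abi(2) abj(2)] that(3) by (simp add: W'_def)
    have x1: "\<xi>1 (\<sigma> (a i)) (\<sigma> (a j)) p = \<zeta>1 (\<sigma> (a j)) p - \<zeta>1 (\<sigma> (a i)) p"
      using ref[OF abi(1)] ref[OF abj(1)] that(3) by (intro c1(2)) (auto simp: W'_def)
    have x3: "\<xi>1 (\<sigma> (a i)) (\<sigma> (a j)) p - \<eta> (\<tau> (a i)) (\<tau> (a j)) p = \<zeta> (a j) p - \<zeta> (a i) p"
      using eq[OF abi(1) abj(1)] that(3) by (simp add: W'_def)
    show ?thesis
      unfolding x2 minuend_minus_difference[OF x3 x1] \<zeta>'_def by (simp add: algebra_simps)
  qed
  ultimately have all: "\<forall>i<k * n2. b i < n2 \<and> W' i \<subseteq> U2 (b i) \<and> \<tau> (a i) < m \<and> W' i \<subseteq> V (\<tau> (a i)) \<and> \<zeta>' i \<in> F (W' i)"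
    "\<forall>i<k * n2. \<forall>j<k * n2. \<forall>p\<in>W' i \<inter> W' j.
       \<xi>2 (b i) (b j) p - \<eta> (\<tau> (a i)) (\<tau> (a j)) p = \<zeta>' j p - \<zeta>' i p"
    by simp_all
  have "\<exists>k W \<sigma> \<tau> \<zeta>. finite_open_cover Y k W \<and>
        (\<forall>i<k. \<sigma> i < n2 \<and> W i \<subseteq> U2 (\<sigma> i) \<and> \<tau> i < m \<and> W i \<subseteq> V (\<tau> i) \<and> \<zeta> i \<in> F (W i)) \<and>
        (\<forall>i<k. \<forall>j<k. \<forall>p\<in>W i \<inter> W j. \<xi>2 (\<sigma> i) (\<sigma> j) p - \<eta> (\<tau> i) (\<tau> j) p = \<zeta> j p - \<zeta> i p)"
    by (intro exI[of _ "k * n2"] exI[of _ W'] exI[of _ b] exI[of _ "\<lambda>i. \<tau> (a i)"] exI[of _ \<zeta>'] conjI cover all)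
  then show ?thesis unfolding y cech_rel1_def using Z2 yZ by blast
qed

lemma H1_class_coboundary:
  fixes F :: "'x::topological_space set \<Rightarrow> ('x \<Rightarrow> 'v::ab_group_add) set"
  assumes restr: "\<And>U V s. s \<in> F U \<Longrightarrow> V \<subseteq> U \<Longrightarrow> s \<in> F V"
    and cong: "\<And>U s t. s \<in> F U \<Longrightarrow> (\<And>p. p \<in> U \<Longrightarrow> s p = t p) \<Longrightarrow> t \<in> F U"
    and diff: "\<And>U s t. U \<subseteq> Y \<Longrightarrow> s \<in> F U \<Longrightarrow> t \<in> F U \<Longrightarrow> (\<lambda>p. s p - t p) \<in> F U"
    and zero: "(\<lambda>_. 0) \<in> F Y"
    and cover: "finite_open_cover Y n U"
    and \<zeta>: "\<And>i. i < n \<Longrightarrow> \<zeta> i \<in> F (U i)"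
      "\<And>i j p. i < n \<Longrightarrow> j < n \<Longrightarrow> p \<in> U i \<inter> U j \<Longrightarrow> \<xi> i j p = \<zeta> j p - \<zeta> i p"
  shows "H1_class Y F (n, U, \<xi>) = H1_zero Y F"
proof -
  \<comment> \<open>The zero class is represented by a coboundary too, so the preceding lemma applies in both directions.\<close>
  have c0: "finite_open_cover Y 1 (\<lambda>_. Y)"
    unfolding finite_open_cover_def by auto
  have "((n, U, \<xi>), y) \<in> cech_rel1 Y F \<longleftrightarrow> ((1, \<lambda>_. Y, \<lambda>_ _ _. 0), y) \<in> cech_rel1 Y F" for y
  proof
    assume rel: "((n, U, \<xi>), y) \<in> cech_rel1 Y F"
    show "((1, \<lambda>_. Y, \<lambda>_ _ _. 0), y) \<in> cech_rel1 Y F"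
    proof (rule cech_rel1_of_coboundaries[OF _ _ _ \<zeta> c0 _ _ rel])
      show "(\<lambda>_. 0) \<in> F Y" "\<And>p. (0::'v) = 0 - 0" using zero by auto
    qed (use restr cong diff in \<open>blast+\<close>)
  next
    assume rel: "((1, \<lambda>_. Y, \<lambda>_ _ _. 0), y) \<in> cech_rel1 Y F"
    show "((n, U, \<xi>), y) \<in> cech_rel1 Y F"
    proof (rule cech_rel1_of_coboundaries[OF _ _ _ _ _ cover \<zeta> rel])
      show "(\<lambda>_. 0) \<in> F Y" "\<And>p. (0::'v) = 0 - 0" using zero by auto
    qed (use restr cong diff in \<open>blast+\<close>)
  qed
  then show ?thesis unfolding H1_class_def H1_zero_def by blast
qed

section \<open>Plurisuperharmonic functions near a submanifold\<close>

lemma laplacian_nonneg_cong: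
  assumes u: "laplacian_nonneg_at u z" and D: "open D" "z \<in> D" and eq: "\<And>y. y \<in> D \<Longrightarrow> u y = v y"
  shows "laplacian_nonneg_at v z"
proof -
  obtain r where r: "0 < r" "ball z r \<subseteq> D" using D open_contains_ball by blast
  obtain d p q s t where d: "0 < d"
    and p: "\<And>x. \<bar>x\<bar> < d \<Longrightarrow> ((\<lambda>x. u (z + of_real x)) has_real_derivative p x) (at x)"
    and q: "\<And>x. \<bar>x\<bar> < d \<Longrightarrow> ((\<lambda>x. u (z + \<i> * of_real x)) has_real_derivative q x) (at x)"
    and st: "(p has_real_derivative s) (at 0)" "(q has_real_derivative t) (at 0)" "0 \<le> s + t"
    using u unfolding laplacian_nonneg_at_def by blast
  define d' where "d' = min d r"
  have T: "open (ball (0::real) r)" by simp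
  have "((\<lambda>x. v (z + of_real x)) has_real_derivative p x) (at x)" if x: "\<bar>x\<bar> < d'" for x
  proof (rule has_field_derivative_transform_within_open[OF p T])
    fix y assume "y \<in> ball (0::real) r"
    then have "z + of_real y \<in> ball z r" by (simp add: dist_norm)
    then show "u (z + of_real y) = v (z + of_real y)" using eq r by blast
  qed (use x in \<open>auto simp: d'_def\<close>)
  moreover have "((\<lambda>x. v (z + \<i> * of_real x)) has_real_derivative q x) (at x)" if x: "\<bar>x\<bar> < d'" for x
  proof (rule has_field_derivative_transform_within_open[OF q T])
    fix y assume "y \<in> ball (0::real) r"
    then have "z + \<i> * of_real y \<in> ball z r" by (simp add: dist_norm norm_mult)
    then show "u (z + \<i> * of_real y) = v (z + \<i> * of_real y)" using eq r by blast
  qed (use x in \<open>auto simp: d'_def\<close>)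
  moreover have "0 < d'" using d r by (simp add: d'_def)
  ultimately show ?thesis unfolding laplacian_nonneg_at_def using st by blast
qed

context submanifold
begin

text \<open>A complex line in the parameters of the submanifold, seen in a chart of the atlas, is a
  holomorphic disc. Along such discs a Levi form that is known in the charts of the atlas is evaluated on
  vectors tangent to the submanifold.\<close>

lemma slice_line_disc:
  fixes V :: "'x set" and z k :: "complex^'d"
  assumes c: "slice_chart X A Y (U, \<phi>)" and W: "(W, \<kappa>) \<in> A" and V: "openin (top_of_set X) V"
  defines "\<gamma> \<equiv> \<lambda>z. \<kappa> (inv_into U \<phi> (slice_emb z))"
    and "D \<equiv> {\<zeta>. slice_emb (z + \<zeta> *s k) \<in> \<phi> ` (U \<inter> (V \<inter> W))}"
  shows "open D"
    and "(\<lambda>\<zeta>. \<gamma> (z + \<zeta> *s k) $ m) holomorphic_on D"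
    and "(\<lambda>\<zeta>. \<gamma> (z + \<zeta> *s k)) ` D \<subseteq> \<kappa> ` (W \<inter> V)"
    and "\<zeta> \<in> D \<Longrightarrow> inv_into W \<kappa> (\<gamma> (z + \<zeta> *s k)) = inv_into U \<phi> (slice_emb (z + \<zeta> *s k))"
    and "\<zeta> \<in> D \<Longrightarrow> deriv (\<lambda>\<zeta>. \<gamma> (z + \<zeta> *s k) $ m) \<zeta> =
      frechet_derivative (\<lambda>z. \<gamma> z $ m) (at (z + \<zeta> *s k)) k"
proof -
  note cc = slice_complex[OF c] and cW = atlas_chart[OF W]
  have o: "open {z. slice_emb z \<in> \<phi> ` (U \<inter> (V \<inter> W))}"
    by (rule slice_open[OF c openin_Int[OF V complex_chartD(1)[OF cW]]])
  have cont: "continuous_on UNIV (\<lambda>\<zeta>. z + \<zeta> *s k)"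
    by (simp add: vector_scalar_mult_def) (intro continuous_intros)
  show "open D" using open_vimage[OF o cont] by (simp add: D_def vimage_def)
  have q: "inv_into U \<phi> (slice_emb (z + \<zeta> *s k)) \<in> U \<inter> Y \<inter> V \<inter> W"
    "\<phi> (inv_into U \<phi> (slice_emb (z + \<zeta> *s k))) = slice_emb (z + \<zeta> *s k)" if "\<zeta> \<in> D" for \<zeta>
  proof -
    have m: "slice_emb (z + \<zeta> *s k) \<in> \<phi> ` (U \<inter> (V \<inter> W))" using that by (simp add: D_def)
    then have m': "slice_emb (z + \<zeta> *s k) \<in> \<phi> ` U" by blast
    show "inv_into U \<phi> (slice_emb (z + \<zeta> *s k)) \<in> U \<inter> Y \<inter> V \<inter> W"
      "\<phi> (inv_into U \<phi> (slice_emb (z + \<zeta> *s k))) = slice_emb (z + \<zeta> *s k)"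
      using slice_inv[OF c m'] m unfolding chart_image_iff[OF cc] by auto
  qed
  have d: "cdiff_at (\<lambda>z. \<gamma> z $ m) (z + \<zeta> *s k)" if "\<zeta> \<in> D" for \<zeta> m
    using slice_param_cdiff(1)[OF c W, of "inv_into U \<phi> (slice_emb (z + \<zeta> *s k))" m] q[OF that]
    by (simp add: \<gamma>_def)
  note der = cdiff_line_derivative[OF d]
  show "(\<lambda>\<zeta>. \<gamma> (z + \<zeta> *s k) $ m) holomorphic_on D"
    unfolding holomorphic_on_def field_differentiable_def
    using der has_field_derivative_at_within by blast
  show "\<zeta> \<in> D \<Longrightarrow> deriv (\<lambda>\<zeta>. \<gamma> (z + \<zeta> *s k) $ m) \<zeta> =
      frechet_derivative (\<lambda>z. \<gamma> z $ m) (at (z + \<zeta> *s k)) k"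
    by (rule DERIV_imp_deriv[OF der])
  show "(\<lambda>\<zeta>. \<gamma> (z + \<zeta> *s k)) ` D \<subseteq> \<kappa> ` (W \<inter> V)"
    using q(1) by (auto simp: \<gamma>_def)
  show "\<zeta> \<in> D \<Longrightarrow> inv_into W \<kappa> (\<gamma> (z + \<zeta> *s k)) = inv_into U \<phi> (slice_emb (z + \<zeta> *s k))"
    unfolding \<gamma>_def using q(1) inv_chart[OF cW] by blast
qed

text \<open>The coordinates \<open>Inl a\<close> of a slice chart parametrize the submanifold, so these are derivatives of
  a constant function.\<close>

lemma wirt_slice_zero:
  assumes c: "slice_chart X A Y (U, \<phi>)" and p: "p \<in> U" "p \<in> Y"
    and f: "(f \<circ> inv_into U \<phi>) differentiable (at (\<phi> p))"
    and B: "openin (top_of_set Y) B" "p \<in> B" "\<forall>q\<in>B. f q = f p"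
  shows "wirt (Inl a) (f \<circ> inv_into U \<phi>) (\<phi> p) = 0"
proof -
  note cc = slice_complex[OF c]
  define z0 where "z0 = slice_proj (\<phi> p)"
  have e0: "slice_emb z0 = \<phi> p" unfolding z0_def by (rule slice_emb_proj[OF c p])
  obtain N where N: "openin (top_of_set X) N" "B = Y \<inter> N" using openin_Y_extend[OF B(1)] by blast
  note ch = wirt_chain[where f = "f \<circ> inv_into U \<phi>" and \<Psi> = slice_emb, OF cdiff_slice_emb, of z0, unfolded e0, OF f]
  have weq: "wirt a (\<lambda>z. slice_emb z $ k) z0 = (if k = Inl a then 1 else 0)" for k
  proof -
    have "frechet_derivative (\<lambda>z. z $ b) (at z0) = (\<lambda>v. v $ b)" for b :: 'd
      by (rule sym, rule frechet_derivative_at, rule bounded_linear_imp_has_derivative, rule bounded_linear_vec_nth)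
    then show ?thesis
      by (cases k) (auto simp: wirt_def axis_def)
  qed
  have "wirt a ((f \<circ> inv_into U \<phi>) \<circ> slice_emb) z0 = wirt (Inl a) (f \<circ> inv_into U \<phi>) (\<phi> p)"
    unfolding ch(2) weq by (simp add: if_distrib cong: if_cong)
  moreover have "wirt a ((f \<circ> inv_into U \<phi>) \<circ> slice_emb) z0 = wirt a (\<lambda>_. f p) z0"
  proof (rule wirt_transform(1)[OF ch(1) slice_open[OF c N(1)]])
    show "z0 \<in> {z. slice_emb z \<in> \<phi> ` (U \<inter> N)}" using e0 p B(2) N(2) by auto
    fix z assume "z \<in> {z. slice_emb z \<in> \<phi> ` (U \<inter> N)}"
    then have m: "slice_emb z \<in> \<phi> ` (U \<inter> N)" by simp
    then have m': "slice_emb z \<in> \<phi> ` U" by blast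
    have "inv_into U \<phi> (slice_emb z) \<in> B"
      using slice_inv(1)[OF c m'] m unfolding chart_image_iff[OF cc] N(2) by blast
    then show "((f \<circ> inv_into U \<phi>) \<circ> slice_emb) z = f p" using B(3) by simp
  qed
  ultimately show ?thesis by (simp add: wirt_def)
qed

end

text \<open>The sign is the one of \<open>ln h(e, e)\<close> for a Hermitian metric of nonnegative curvature. The
  conditions are imposed in the charts of the atlas, where the curvature is given; slice charts need
  not belong to it.\<close>

locale plurisuperharmonic = submanifold X A Y
  for X :: "'x::topological_space set" and A :: "('x, 'd::finite + 'r::finite) chart set" and Y +
  fixes V :: "'x set" and F :: "'x \<Rightarrow> real"
  assumes V_open: "openin (top_of_set X) V"
    and twice: "(W, \<kappa>) \<in> A \<Longrightarrow> twice_diff_on (\<kappa> ` (W \<inter> V)) (\<lambda>x. complex_of_real (F (inv_into W \<kappa> x)))"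
    and levi_neg: "(W, \<kappa>) \<in> A \<Longrightarrow> x \<in> \<kappa> ` (W \<inter> V) \<Longrightarrow>
      - levi (\<lambda>x. complex_of_real (F (inv_into W \<kappa> x))) x v \<in> \<real>\<^sub>\<ge>\<^sub>0"
begin

abbreviation "FC \<equiv> \<lambda>q. complex_of_real (F q)"

lemma V_sub: "V \<subseteq> X"
  using V_open openin_imp_subset by blast

lemma levi_re:
  assumes "(W, \<kappa>) \<in> A" "x \<in> \<kappa> ` (W \<inter> V)"
  shows "Re (levi (\<lambda>x. complex_of_real (F (inv_into W \<kappa> x))) x v) \<le> 0"
    "Im (levi (\<lambda>x. complex_of_real (F (inv_into W \<kappa> x))) x v) = 0"
  using levi_neg[OF assms, of v] by (simp_all add: complex_nonneg_Reals_iff)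

lemma chart_open: "(W, \<kappa>) \<in> A \<Longrightarrow> open (\<kappa> ` (W \<inter> V))"
  using chart_image_open[OF atlas_chart V_open] .

lemma differentiable_in_chart:
  assumes c: "holo_chart X A (U, \<phi>)" and p: "p \<in> U" "p \<in> V"
  shows "(FC \<circ> inv_into U \<phi>) differentiable (at (\<phi> p))"
proof -
  note cc = holo_chart_complex[OF c]
  obtain W \<kappa> where W: "(W, \<kappa>) \<in> A" "p \<in> W" using atlas_cover p V_sub by blast
  note cW = atlas_chart[OF W(1)]
  have "(FC \<circ> inv_into W \<kappa>) differentiable (at (\<kappa> p))"
    using twice[OF W(1)] W(2) p unfolding twice_diff_on_def o_def by blast
  then have "((FC \<circ> inv_into W \<kappa>) \<circ> (\<lambda>x. \<kappa> (inv_into U \<phi> x))) differentiable (at (\<phi> p))"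
    using inv_chart[OF cc p(1)] by (intro wirt_chain(1) transition_cdiff(1)[OF c W(1) p(1) W(2)]) simp
  then show ?thesis
  proof (rule differentiable_transform_open)
    show "open (\<phi> ` (U \<inter> W))" by (rule chart_image_open[OF cc complex_chartD(1)[OF cW]])
  qed (use p W(2) chart_change_eq[OF cc cW] in auto)
qed

lemma continuous_on_chart:
  assumes W: "(W, \<kappa>) \<in> A"
  shows "continuous_on (W \<inter> V) F"
proof -
  have "continuous_on (\<kappa> ` (W \<inter> V)) (\<lambda>x. complex_of_real (F (inv_into W \<kappa> x)))"
    using twice[OF W] unfolding twice_diff_on_def
    by (intro continuous_at_imp_continuous_on ballI differentiable_imp_continuous_within) blast
  then have "continuous_on (\<kappa> ` (W \<inter> V)) (\<lambda>x. Re (complex_of_real (F (inv_into W \<kappa> x))))"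
    by (rule continuous_on_Re)
  then have "continuous_on (\<kappa> ` (W \<inter> V)) (\<lambda>x. F (inv_into W \<kappa> x))" by simp
  moreover have "continuous_on (W \<inter> V) \<kappa>"
    using complex_chartD(4)[OF atlas_chart[OF W]] continuous_on_subset by blast
  ultimately have "continuous_on (W \<inter> V) (\<lambda>q. F (inv_into W \<kappa> (\<kappa> q)))"
    by (rule continuous_on_compose2) auto
  then show ?thesis
    by (rule continuous_on_eq) (use inv_chart[OF atlas_chart[OF W]] in auto)
qed

lemma continuous_F: "continuous_on V F"
proof -
  have "continuous_map (top_of_set V) euclidean F"
  proof (rule pasting_lemma[where I = A and T = "\<lambda>c. fst c \<inter> V" and f = "\<lambda>_. F"])
    fix c assume c: "c \<in> A"
    obtain W \<kappa> where W: "c = (W, \<kappa>)" by (cases c)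
    have "openin (top_of_set X) (W \<inter> V)"
      using complex_chartD(1)[OF atlas_chart] c W V_open by (simp add: openin_Int)
    then show "openin (top_of_set V) (fst c \<inter> V)"
      using W V_sub by (metis fst_conv inf_le2 openin_subset_trans)
    show "continuous_map (subtopology (top_of_set V) (fst c \<inter> V)) euclidean F"
      using continuous_on_chart c W by (simp add: subtopology_subtopology Int_absorb1)
  next
    fix x assume "x \<in> topspace (top_of_set V)"
    then show "\<exists>j. j \<in> A \<and> x \<in> fst j \<inter> V \<and> F x = F x"
      using atlas_cover V_sub by force
  qed simp
  then show ?thesis by simp
qed

text \<open>In a slice chart \<open>-F\<close> is subharmonic along the complex lines in \<open>Y\<close>. If its maximum over a ball of
  radius \<open>R\<close> is attained at the centre, it is constant on the ball of radius \<open>R/2\<close>.\<close>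

lemma local_minimum_principle:
  assumes p: "p \<in> Y" "p \<in> V"
  shows "\<exists>B B'. openin (top_of_set Y) B' \<and> connected B \<and> B \<subseteq> Y \<and> B \<subseteq> V \<and> p \<in> B' \<and> B' \<subseteq> B \<and>
     ((\<forall>q\<in>B. F p \<le> F q) \<longrightarrow> (\<forall>q\<in>B'. F q = F p))"
proof -
  obtain U0 \<phi> where c0: "slice_chart X A Y (U0, \<phi>)" "p \<in> U0" using slice_at[OF p(1)] by blast
  note cc = slice_complex[OF c0(1)]
  define z0 where "z0 = slice_proj (\<phi> p)"
  define S where "S = {z. slice_emb z \<in> \<phi> ` (U0 \<inter> V)}"
  have e0: "slice_emb z0 = \<phi> p" unfolding z0_def by (rule slice_emb_proj[OF c0 p(1)])
  have "open S" unfolding S_def by (rule slice_open[OF c0(1) V_open])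
  moreover have "z0 \<in> S" using e0 c0(2) p(2) by (auto simp: S_def)
  ultimately obtain R where R: "0 < R" "ball z0 R \<subseteq> S" using open_contains_ball by blast
  define P where "P z = inv_into U0 \<phi> (slice_emb z)" for z
  have P: "P z \<in> U0" "P z \<in> Y" "P z \<in> V" "\<phi> (P z) = slice_emb z" if "z \<in> S" for z
  proof -
    have m: "slice_emb z \<in> \<phi> ` (U0 \<inter> V)" using that by (simp add: S_def)
    then have m': "slice_emb z \<in> \<phi> ` U0" by blast
    show "P z \<in> U0" "P z \<in> Y" "\<phi> (P z) = slice_emb z"
      using slice_inv[OF c0(1) m'] by (auto simp: P_def)
    show "P z \<in> V" using m unfolding chart_image_iff[OF cc] P_def by blast
  qed
  have Pz0: "P z0 = p" unfolding P_def e0 by (rule inv_chart[OF cc c0(2)])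
  have contP: "continuous_on S P"
    unfolding P_def using complex_chartD(5)[OF cc]
    by (rule continuous_on_compose2[OF _ continuous_slice_emb]) (auto simp: S_def)
  define B where "B = P ` ball z0 R"
  define B' where "B' = P ` ball z0 (R / 2)"
  have half: "ball z0 (R / 2) \<subseteq> ball z0 R" using R(1) by auto
  have connB: "connected B" unfolding B_def
    using contP R(2) by (intro connected_continuous_image) (auto intro: continuous_on_subset)
  have pB: "p \<in> B'" unfolding B'_def using Pz0 R(1) by (metis centre_in_ball half_gt_zero image_eqI)
  have "B' = U0 \<inter> Y \<inter> (\<lambda>q. slice_proj (\<phi> q)) -` ball z0 (R / 2)"
  proof (intro equalityI subsetI)
    fix q assume "q \<in> B'"
    then obtain z where z: "z \<in> ball z0 (R / 2)" "q = P z" by (auto simp: B'_def)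
    then have "z \<in> S" using half R(2) by blast
    from P[OF this] z show "q \<in> U0 \<inter> Y \<inter> (\<lambda>q. slice_proj (\<phi> q)) -` ball z0 (R / 2)" by simp
  next
    fix q assume q: "q \<in> U0 \<inter> Y \<inter> (\<lambda>q. slice_proj (\<phi> q)) -` ball z0 (R / 2)"
    then have "q = P (slice_proj (\<phi> q))"
      using slice_emb_proj[OF c0(1)] inv_chart[OF cc] by (simp add: P_def)
    then show "q \<in> B'" using q unfolding B'_def by blast
  qed
  moreover have "openin (top_of_set (U0 \<inter> Y)) (U0 \<inter> Y \<inter> (\<lambda>q. slice_proj (\<phi> q)) -` ball z0 (R / 2))"
  proof (rule continuous_openin_preimage_gen[OF _ open_ball])
    have "continuous_on (U0 \<inter> Y) \<phi>" using complex_chartD(4)[OF cc] continuous_on_subset by blast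
    then show "continuous_on (U0 \<inter> Y) (\<lambda>q. slice_proj (\<phi> q))"
      by (rule continuous_on_compose2[OF continuous_slice_proj]) auto
  qed
  moreover have "openin (top_of_set Y) (U0 \<inter> Y)"
    using complex_chartD(1)[OF cc] Y_sub by (auto simp: openin_open)
  ultimately have openB: "openin (top_of_set Y) B'" using openin_trans by metis
  have BV: "B \<subseteq> V" "B \<subseteq> Y" "B' \<subseteq> B" using P(2,3) R(2) half by (auto simp: B_def B'_def)
  have const: "F q = F p" if min: "\<forall>q\<in>B. F p \<le> F q" and q: "q \<in> B'" for q
  proof -
    define u where "u z = - F (P z)" for z
    obtain y where y: "y \<in> ball z0 (R / 2)" "q = P y" using q by (auto simp: B'_def)
    have "u y = u z0"
    proof (rule strong_maximum_principle_ball[OF _ _ _ y(1)])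
      have "continuous_on (ball z0 R) (\<lambda>z. F (P z))"
        by (rule continuous_on_compose2[OF continuous_F continuous_on_subset[OF contP R(2)]])
          (use P(3) R(2) in blast)
      then show "continuous_on (ball z0 R) u" unfolding u_def by (rule continuous_on_minus)
      show "u z \<le> u z0" if "z \<in> ball z0 R" for z
        using min that unfolding u_def Pz0 B_def by auto
      show "laplacian_nonneg_at (\<lambda>\<zeta>. u (z0 + \<zeta> *s k)) \<zeta>" if z: "z0 + \<zeta> *s k \<in> ball z0 R" for k \<zeta>
      proof -
        have zS: "z0 + \<zeta> *s k \<in> S" using z R(2) by blast
        obtain W \<kappa> where W: "(W, \<kappa>) \<in> A" "P (z0 + \<zeta> *s k) \<in> W"
          using atlas_cover P(3)[OF zS] V_sub by blast
        define D where "D = {\<zeta>. slice_emb (z0 + \<zeta> *s k) \<in> \<phi> ` (U0 \<inter> (V \<inter> W))}"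
        define \<gamma> where "\<gamma> z = \<kappa> (inv_into U0 \<phi> (slice_emb z))" for z
        note disc = slice_line_disc[OF c0(1) W(1) V_open, where z = z0 and k = k, folded D_def \<gamma>_def]
        have zD: "\<zeta> \<in> D"
          unfolding D_def mem_Collect_eq chart_image_iff[OF cc]
          using P[OF zS] W(2) unfolding P_def by (metis IntI imageI)
        have "\<gamma> (z0 + \<zeta> *s k) \<in> \<kappa> ` (W \<inter> V)" using disc(3) zD by blast
        then have "laplacian_nonneg_at (\<lambda>\<zeta>. - F (inv_into W \<kappa> (\<gamma> (z0 + \<zeta> *s k)))) \<zeta>"
          by (intro laplacian_along_disc(1)[OF chart_open[OF W(1)] twice[OF W(1)] disc(1) zD disc(2,3)]
              levi_re(1)[OF W(1)])
        then show ?thesis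
          by (rule laplacian_nonneg_cong[OF _ disc(1) zD]) (simp add: disc(4) u_def P_def)
      qed
    qed
    then show ?thesis by (simp add: u_def y Pz0)
  qed
  show ?thesis
    by (rule exI[of _ B], rule exI[of _ B'], intro conjI impI openB connB pB BV) (use const in blast)
qed

text \<open>\<open>F\<close> is constant along discs in \<open>Y\<close>, so its Levi form vanishes on the vectors \<open>a\<close> tangent to \<open>Y\<close>. By
  semi-definiteness they lie in the kernel of the form, that is, the sum of
  \<open>wirt_bar m (wirt i F) * cnj (a $ m)\<close> over \<open>m\<close> is zero. By the chain rule these sums are the
  antiholomorphic derivatives of \<open>wirt i F\<close> along \<open>Y\<close>.\<close>

lemma wirt_holo_along_submanifold:
  assumes const: "\<And>p. p \<in> Y \<inter> V \<Longrightarrow> \<exists>B. openin (top_of_set Y) B \<and> p \<in> B \<and> (\<forall>q\<in>B. F q = F p)"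
    and W: "(W, \<kappa>) \<in> A"
  shows "mholo_on (sub_atlas X A Y) (\<lambda>q. wirt i (FC \<circ> inv_into W \<kappa>) (\<kappa> q)) (Y \<inter> V \<inter> W)"
proof -
  have sub: "Y \<inter> V \<inter> W \<subseteq> Y" by blast
  show ?thesis
    unfolding mholo_sub_iff[OF sub]
  proof (intro allI impI, elim conjE)
    fix U \<phi> p assume c: "slice_chart X A Y (U, \<phi>)" and p: "p \<in> U" "p \<in> Y \<inter> V \<inter> W"
    note cc = slice_complex[OF c] and cW = atlas_chart[OF W]
    define z0 where "z0 = slice_proj (\<phi> p)"
    define \<gamma> where "\<gamma> z = \<kappa> (inv_into U \<phi> (slice_emb z))" for z
    define f where "f = FC \<circ> inv_into W \<kappa>"
    have pYW: "p \<in> Y" "p \<in> W" "p \<in> V" using p by auto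
    have e0: "slice_emb z0 = \<phi> p" unfolding z0_def by (rule slice_emb_proj[OF c p(1) pYW(1)])
    note par = slice_param_cdiff[OF c W p(1) pYW(1,2), folded z0_def]
    have cd: "cdiff_at (\<lambda>z. \<gamma> z $ m) z0" for m using par(1) by (simp add: \<gamma>_def)
    have \<gamma>0: "\<gamma> z0 = \<kappa> p" using par(2) by (simp add: \<gamma>_def)
    have x: "\<kappa> p \<in> \<kappa> ` (W \<inter> V)" using pYW by blast
    have gd: "wirt i f differentiable (at (\<gamma> z0))"
      unfolding \<gamma>0 f_def o_def by (rule wirt_differentiable[OF twice[OF W] x])
    note ch = wirt_chain[where f = "wirt i f", OF cd gd]
    obtain B where B: "openin (top_of_set Y) B" "p \<in> B" "\<forall>q\<in>B. F q = F p" using const pYW by blast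
    obtain N where N: "openin (top_of_set X) N" "B = Y \<inter> N" using openin_Y_extend[OF B(1)] by blast
    have "wirt_bar l (wirt i f \<circ> \<gamma>) z0 = 0" for l
    proof -
      define a where "a = (\<chi> m. wirt l (\<lambda>z. \<gamma> z $ m) z0)"
      have VN: "openin (top_of_set X) (V \<inter> N)" using V_open N(1) by (rule openin_Int)
      define D where "D = {\<zeta>. slice_emb (z0 + \<zeta> *s axis l 1) \<in> \<phi> ` (U \<inter> (V \<inter> N \<inter> W))}"
      note disc = slice_line_disc[OF c W VN, where z = z0 and k = "axis l 1", folded D_def \<gamma>_def]
      have D0: "0 \<in> D" using e0 p(1) pYW B(2) N(2) by (auto simp: D_def)
      have "deriv (\<lambda>\<zeta>. \<gamma> (z0 + \<zeta> *s axis l 1) $ m) 0 = a $ m" for m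
        using disc(5)[OF D0, of m] cdiff_wirt(2)[OF cd, of l] by (simp add: a_def)
      then have aeq: "(\<chi> m. deriv (\<lambda>\<zeta>. \<gamma> (z0 + \<zeta> *s axis l 1) $ m) 0) = a" by (simp add: vec_eq_iff)
      have img: "(\<lambda>\<zeta>. \<gamma> (z0 + \<zeta> *s axis l 1)) ` D \<subseteq> \<kappa> ` (W \<inter> V)" using disc(3) by blast
      have "Re (levi f (\<gamma> (z0 + 0 *s axis l 1)) (\<chi> m. deriv (\<lambda>\<zeta>. \<gamma> (z0 + \<zeta> *s axis l 1) $ m) 0)) = 0"
        unfolding f_def o_def
      proof (rule laplacian_along_disc(2)[OF chart_open[OF W] twice[OF W] disc(1) D0 disc(2) img])
        fix \<zeta> assume z: "\<zeta> \<in> D"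
        then have m: "slice_emb (z0 + \<zeta> *s axis l 1) \<in> \<phi> ` (U \<inter> (V \<inter> N \<inter> W))" by (simp add: D_def)
        then have m': "slice_emb (z0 + \<zeta> *s axis l 1) \<in> \<phi> ` U" by blast
        have "inv_into U \<phi> (slice_emb (z0 + \<zeta> *s axis l 1)) \<in> B"
          using slice_inv(1)[OF c m'] m unfolding chart_image_iff[OF cc] N(2) by blast
        then show "F (inv_into W \<kappa> (\<gamma> (z0 + \<zeta> *s axis l 1))) = F p"
          using B(3) disc(4)[OF z] by auto
      qed
      then have "Re (levi f (\<kappa> p) a) = 0" unfolding aeq by (simp add: \<gamma>0)
      then have lev: "levi f (\<kappa> p) a = 0"
        using levi_re(2)[OF W x, of a] by (simp add: complex_eq_iff f_def o_def)
      have "(\<Sum>m\<in>UNIV. - wirt_bar m (wirt i f) (\<kappa> p) * cnj (a $ m)) = 0"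
      proof (rule psd_form_kernel[where m = "\<lambda>i m. - wirt_bar m (wirt i f) (\<kappa> p)"])
        show "(\<Sum>i\<in>UNIV. \<Sum>j\<in>UNIV. - wirt_bar j (wirt i f) (\<kappa> p) * v $ i * cnj (v $ j)) \<in> \<real>\<^sub>\<ge>\<^sub>0" for v
          using levi_neg[OF W x, of v] by (simp add: levi_def f_def o_def sum_negf)
        show "(\<Sum>i\<in>UNIV. \<Sum>j\<in>UNIV. - wirt_bar j (wirt i f) (\<kappa> p) * a $ i * cnj (a $ j)) = 0"
          using lev by (simp add: levi_def sum_negf)
      qed
      then show ?thesis unfolding ch(3) \<gamma>0 by (simp add: a_def sum_negf)
    qed
    then have "cdiff_at (wirt i f \<circ> \<gamma>) z0" using ch(1) by (simp add: cdiff_iff_wirt_bar)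
    then show "cdiff_at (\<lambda>z. wirt i (FC \<circ> inv_into W \<kappa>) (\<kappa> (inv_into U \<phi> (slice_emb z)))) (slice_proj (\<phi> p))"
      by (simp add: f_def \<gamma>_def o_def z0_def)
  qed
qed

text \<open>The coefficients are holomorphic along \<open>Y\<close> by the preceding lemma. In a slice chart only the
  differentials of the normal coordinates occur, because \<open>F\<close> is locally constant on \<open>Y\<close>.\<close>

lemma del_conormal:
  assumes const: "\<And>p. p \<in> Y \<inter> V \<Longrightarrow> \<exists>B. openin (top_of_set Y) B \<and> p \<in> B \<and> (\<forall>q\<in>B. F q = F p)"
  shows "del A FC \<in> conormal_sheaf X A Y (Y \<inter> V)"
  unfolding conormal_sheaf_iff
proof (intro conjI ballI)
  fix p v assume p: "p \<in> Y \<inter> V" and v: "v \<in> sub_tangent X A Y p"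
  then have pY: "p \<in> Y" by blast
  obtain U \<phi> where c: "slice_chart X A Y (U, \<phi>)" "p \<in> U" using slice_at[OF pY] by blast
  have df: "(FC \<circ> inv_into U \<phi>) differentiable (at (\<phi> p))"
    using differentiable_in_chart[OF slice_holo[OF c(1)] c(2)] p by blast
  obtain B where B: "openin (top_of_set Y) B" "p \<in> B" "\<forall>q\<in>B. F q = F p" using const p by blast
  have zero: "wirt (Inl a) (FC \<circ> inv_into U \<phi>) (\<phi> p) = 0" for a
    by (rule wirt_slice_zero[OF c pY df B(1,2)]) (use B(3) in simp)
  have kill: "(\<Sum>j\<in>UNIV. covec A (\<lambda>q. \<phi> q $ Inr l) p $ j * v $ j) = 0" for l
    using v c unfolding sub_tangent_def by blast
  have "(\<Sum>j\<in>UNIV. del A FC p $ j * v $ j)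
     = (\<Sum>j\<in>UNIV. \<Sum>i\<in>UNIV. wirt i (FC \<circ> inv_into U \<phi>) (\<phi> p) * (covec A (\<lambda>q. \<phi> q $ i) p $ j * v $ j))"
    unfolding del_in_chart[OF slice_holo[OF c(1)] c(2) df] by (simp add: sum_distrib_right mult.assoc)
  also have "\<dots> = (\<Sum>i\<in>UNIV. wirt i (FC \<circ> inv_into U \<phi>) (\<phi> p) * (\<Sum>j\<in>UNIV. covec A (\<lambda>q. \<phi> q $ i) p $ j * v $ j))"
    by (subst sum.swap) (simp add: sum_distrib_left)
  also have "\<dots> = 0"
  proof (intro sum.neutral ballI)
    fix i :: "'d + 'r"
    show "wirt i (FC \<circ> inv_into U \<phi>) (\<phi> p) * (\<Sum>j\<in>UNIV. covec A (\<lambda>q. \<phi> q $ i) p $ j * v $ j) = 0"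
      by (cases i) (simp_all add: zero kill)
  qed
  finally show "(\<Sum>j\<in>UNIV. del A FC p $ j * v $ j) = 0" .
next
  fix p assume p: "p \<in> Y \<inter> V"
  then obtain W \<kappa> where W: "(W, \<kappa>) \<in> A" "p \<in> W" using atlas_cover Y_sub by blast
  have "del A FC q = (\<Sum>i\<in>UNIV. wirt i (FC \<circ> inv_into W \<kappa>) (\<kappa> q) *s covec A (\<lambda>q'. \<kappa> q' $ i) q)"
    if "q \<in> Y \<inter> V \<inter> W" for q
    using that by (intro del_in_chart[OF atlas_holo_chart[OF W(1)]]
        differentiable_in_chart[OF atlas_holo_chart[OF W(1)]]) auto
  moreover have "mholo_on (sub_atlas X A Y) (\<lambda>q. wirt i (FC \<circ> inv_into W \<kappa>) (\<kappa> q)) (Y \<inter> V \<inter> W)" for i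
    by (rule wirt_holo_along_submanifold[OF const W(1)])
  ultimately show "conormal_rep_at (Y \<inter> V) (del A FC) p"
    by (intro conormal_rep_atI[OF atlas_holo_chart[OF W(1)] W(2)])
qed

end

section \<open>Hermitian metrics on line bundles\<close>

locale hermitian_line_bundle = cmanifold X A
  for X :: "'x::topological_space set" and A :: "('x, 'n::finite) chart set" +
  fixes pr :: "'l \<Rightarrow> 'x" and T :: "('x, 'l) triv set" and h :: "'l \<Rightarrow> 'l \<Rightarrow> complex"
  assumes line_bundle: "holo_line_bundle X A pr T" and metric: "hermitian_metric A pr T h"
begin

definition frame_norm :: "('x \<Rightarrow> 'l) \<Rightarrow> 'x \<Rightarrow> complex" where
  "frame_norm e p = h (e p) (e p)"

abbreviation log_norm :: "('x \<Rightarrow> 'l) \<Rightarrow> 'x \<Rightarrow> real" where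
  "log_norm e p \<equiv> ln (Re (frame_norm e p))"

lemma triv_at: "p \<in> X \<Longrightarrow> \<exists>U \<psi>. (U, \<psi>) \<in> T \<and> p \<in> U"
  using line_bundle unfolding holo_line_bundle_def by force

lemma triv_open: "(U, \<psi>) \<in> T \<Longrightarrow> openin (top_of_set X) U"
  using line_bundle unfolding holo_line_bundle_def by blast

lemma triv_change:
  assumes "(U, \<psi>) \<in> T" "(U', \<psi>') \<in> T"
  shows "\<exists>g. (\<forall>x\<in>U \<inter> U'. g x \<noteq> 0) \<and> (\<forall>v. pr v \<in> U \<inter> U' \<longrightarrow> \<psi>' v = g (pr v) * \<psi> v)"
proof -
  have "\<forall>(U, \<psi>)\<in>T. \<forall>(U', \<psi>')\<in>T. \<exists>g. mholo_on A g (U \<inter> U') \<and> (\<forall>x\<in>U \<inter> U'. g x \<noteq> 0) \<and>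
        (\<forall>v. pr v \<in> U \<inter> U' \<longrightarrow> \<psi>' v = g (pr v) * \<psi> v)"
    using line_bundle unfolding holo_line_bundle_def by (elim conjE)
  from bspec[OF bspec[OF this assms(1), unfolded prod.case] assms(2), unfolded prod.case]
  show ?thesis by (elim exE conjE) (intro exI conjI)
qed

lemma frameD:
  assumes "holo_frame X A pr T V e"
  shows "openin (top_of_set X) V" "V \<subseteq> X" "p \<in> V \<Longrightarrow> pr (e p) = p"
    "(U, \<psi>) \<in> T \<Longrightarrow> mholo_on A (\<lambda>p. \<psi> (e p)) (U \<inter> V)"
    "(U, \<psi>) \<in> T \<Longrightarrow> p \<in> U \<Longrightarrow> p \<in> V \<Longrightarrow> \<psi> (e p) \<noteq> 0"
proof -
  show "openin (top_of_set X) V" using assms unfolding holo_frame_def by blast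
  then show "V \<subseteq> X" by (rule openin_imp_subset)
  show "p \<in> V \<Longrightarrow> pr (e p) = p" using assms unfolding holo_frame_def by blast
  show "(U, \<psi>) \<in> T \<Longrightarrow> mholo_on A (\<lambda>p. \<psi> (e p)) (U \<inter> V)"
    "(U, \<psi>) \<in> T \<Longrightarrow> p \<in> U \<Longrightarrow> p \<in> V \<Longrightarrow> \<psi> (e p) \<noteq> 0"
    using assms unfolding holo_frame_def o_def by blast+
qed

lemma section_quot_in_triv:
  assumes U: "(U, \<psi>) \<in> T" "p \<in> U" and s: "pr (s p) = p" "pr (s' p) = p"
  shows "section_quot T s s' p = \<psi> (s p) / \<psi> (s' p)"
proof -
  obtain U' \<psi>' where some: "(SOME c. c \<in> T \<and> p \<in> fst c) = (U', \<psi>')" by (cases "SOME c. c \<in> T \<and> p \<in> fst c")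
  have "\<exists>c. c \<in> T \<and> p \<in> fst c" using U by force
  from someI_ex[OF this] have U': "(U', \<psi>') \<in> T" "p \<in> U'" unfolding some by auto
  obtain g where g: "\<And>x. x \<in> U \<inter> U' \<Longrightarrow> g x \<noteq> 0" "\<And>v. pr v \<in> U \<inter> U' \<Longrightarrow> \<psi>' v = g (pr v) * \<psi> v"
    using triv_change[OF U(1) U'(1)] by blast
  have "\<psi>' (s p) = g p * \<psi> (s p)" "\<psi>' (s' p) = g p * \<psi> (s' p)" "g p \<noteq> 0"
    using g(2)[of "s p"] g(2)[of "s' p"] g(1)[of p] s U(2) U'(2) by auto
  then show ?thesis unfolding section_quot_def some by simp
qed

text \<open>Near each point the quotient can be computed in one fixed trivialization, where it is a
  quotient of holomorphic functions.\<close>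

lemma section_quot_frames:
  assumes e: "holo_frame X A pr T V e" and e': "holo_frame X A pr T V' e'"
  shows "mholo_on A (section_quot T e' e) (V \<inter> V')"
  unfolding mholo_on_def cholo_on_alt
proof (safe)
  fix W \<kappa> p assume W: "(W, \<kappa>) \<in> A" and p: "p \<in> W" "p \<in> V" "p \<in> V'"
  note cW = atlas_chart[OF W]
  obtain U \<psi> where U: "(U, \<psi>) \<in> T" "p \<in> U" using triv_at frameD(2)[OF e] p by blast
  define S where "S = \<kappa> ` (W \<inter> (U \<inter> (V \<inter> V')))"
  have S: "open S" unfolding S_def
    by (intro chart_image_open[OF cW] openin_Int triv_open[OF U(1)] frameD(1)[OF e] frameD(1)[OF e'])
  have x: "\<kappa> p \<in> S" using p U by (auto simp: S_def)
  have "cdiff_at ((\<lambda>p. \<psi> (e' p)) \<circ> inv_into W \<kappa>) (\<kappa> p)" "cdiff_at ((\<lambda>p. \<psi> (e p)) \<circ> inv_into W \<kappa>) (\<kappa> p)"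
    using frameD(4)[OF e' U(1)] frameD(4)[OF e U(1)] W p U(2) unfolding mholo_on_def cholo_on_alt by blast+
  moreover have "\<psi> (e p) \<noteq> 0" using frameD(5)[OF e U(1)] U(2) p by blast
  ultimately have "cdiff_at (\<lambda>x. ((\<lambda>p. \<psi> (e' p)) \<circ> inv_into W \<kappa>) x / ((\<lambda>p. \<psi> (e p)) \<circ> inv_into W \<kappa>) x) (\<kappa> p)"
    by (intro cdiff_divide) (auto simp: inv_chart[OF cW p(1)] o_def)
  then show "cdiff_at (section_quot T e' e \<circ> inv_into W \<kappa>) (\<kappa> p)"
  proof (rule cdiff_transform[OF _ S x])
    fix y assume "y \<in> S"
    then have "inv_into W \<kappa> y \<in> U" "inv_into W \<kappa> y \<in> V" "inv_into W \<kappa> y \<in> V'"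
      unfolding S_def chart_image_iff[OF cW] by auto
    then show "((\<lambda>p. \<psi> (e' p)) \<circ> inv_into W \<kappa>) y / ((\<lambda>p. \<psi> (e p)) \<circ> inv_into W \<kappa>) y
        = (section_quot T e' e \<circ> inv_into W \<kappa>) y"
      using section_quot_in_triv[OF U(1)] frameD(3)[OF e] frameD(3)[OF e'] by simp
  qed
qed

lemma metric_in_triv:
  assumes "(U, \<psi>) \<in> T"
  obtains H :: "'x \<Rightarrow> real" where "msmooth_on A H U" "\<And>x. x \<in> U \<Longrightarrow> H x > 0"
    "\<And>u v. pr u \<in> U \<Longrightarrow> pr v = pr u \<Longrightarrow> h u v = of_real (H (pr u)) * \<psi> u * cnj (\<psi> v)"
proof -
  obtain H :: "'x \<Rightarrow> real" where H: "msmooth_on A H U" "\<forall>x\<in>U. H x > 0"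
    "\<forall>u v. pr u \<in> U \<and> pr v = pr u \<longrightarrow> h u v = of_real (H (pr u)) * \<psi> u * cnj (\<psi> v)"
    using bspec[OF metric[unfolded hermitian_metric_def] assms, unfolded prod.case] by (elim exE conjE)
  show thesis
    by (rule that[OF H(1)]) (use H(2,3) in blast)+
qed

lemma frame_norm_pos:
  assumes e: "holo_frame X A pr T V e" and p: "p \<in> V"
  shows "frame_norm e p = of_real (Re (frame_norm e p))" "0 < Re (frame_norm e p)"
proof -
  obtain U \<psi> where U: "(U, \<psi>) \<in> T" "p \<in> U" using triv_at frameD(2)[OF e] p by blast
  obtain H :: "'x \<Rightarrow> real" where H: "msmooth_on A H U" "\<And>x. x \<in> U \<Longrightarrow> H x > 0"
    "\<And>u v. pr u \<in> U \<Longrightarrow> pr v = pr u \<Longrightarrow> h u v = of_real (H (pr u)) * \<psi> u * cnj (\<psi> v)"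
    by (rule metric_in_triv[OF U(1)]) (rule that)
  have fn: "frame_norm e p = of_real (H p) * \<psi> (e p) * cnj (\<psi> (e p))"
    using H(3)[of "e p" "e p"] U(2) frameD(3)[OF e p] by (simp add: frame_norm_def)
  have eq: "frame_norm e p = of_real (H p * (cmod (\<psi> (e p)))\<^sup>2)"
    unfolding fn by (simp add: mult.assoc complex_norm_square[symmetric])
  show "frame_norm e p = of_real (Re (frame_norm e p))" by (subst (2) eq) (simp add: eq)
  show "0 < Re (frame_norm e p)"
    unfolding eq using H(2)[OF U(2)] frameD(5)[OF e U(1) U(2) p] by simp
qed

lemma frame_norm_change:
  assumes e: "holo_frame X A pr T V e" and e': "holo_frame X A pr T V' e'" and p: "p \<in> V" "p \<in> V'"
  shows "frame_norm e' p = frame_norm e p * section_quot T e' e p * cnj (section_quot T e' e p)"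
proof -
  obtain U \<psi> where U: "(U, \<psi>) \<in> T" "p \<in> U" using triv_at frameD(2)[OF e] p by blast
  obtain H :: "'x \<Rightarrow> real" where H: "msmooth_on A H U" "\<And>x. x \<in> U \<Longrightarrow> H x > 0"
    "\<And>u v. pr u \<in> U \<Longrightarrow> pr v = pr u \<Longrightarrow> h u v = of_real (H (pr u)) * \<psi> u * cnj (\<psi> v)"
    by (rule metric_in_triv[OF U(1)]) (rule that)
  have pr: "pr (e p) = p" "pr (e' p) = p" using frameD(3)[OF e p(1)] frameD(3)[OF e' p(2)] .
  have "\<psi> (e p) \<noteq> 0" using frameD(5)[OF e U p(1)] .
  then show ?thesis
    using H(3)[of "e p" "e p"] H(3)[of "e' p" "e' p"] pr U
    by (simp add: frame_norm_def section_quot_in_triv[OF U])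
qed

lemma frame_norm_twice_diff:
  assumes e: "holo_frame X A pr T V e" and W: "(W, \<kappa>) \<in> A"
  shows "twice_diff_on (\<kappa> ` (W \<inter> V)) (\<lambda>x. frame_norm e (inv_into W \<kappa> x))"
proof -
  note cW = atlas_chart[OF W]
  have "\<exists>S. x \<in> S \<and> twice_diff_on S (\<lambda>x. frame_norm e (inv_into W \<kappa> x))" if "x \<in> \<kappa> ` (W \<inter> V)" for x
  proof -
    obtain p where p: "p \<in> W" "p \<in> V" "x = \<kappa> p" using \<open>x \<in> \<kappa> ` (W \<inter> V)\<close> by blast
    obtain U \<psi> where U: "(U, \<psi>) \<in> T" "p \<in> U" using triv_at frameD(2)[OF e] p by blast
  obtain H :: "'x \<Rightarrow> real" where H: "msmooth_on A H U" "\<And>x. x \<in> U \<Longrightarrow> H x > 0"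
    "\<And>u v. pr u \<in> U \<Longrightarrow> pr v = pr u \<Longrightarrow> h u v = of_real (H (pr u)) * \<psi> u * cnj (\<psi> v)"
    by (rule metric_in_triv[OF U(1)]) (rule that)
    define S where "S = \<kappa> ` (W \<inter> (U \<inter> V))"
    have S: "open S" unfolding S_def
      by (intro chart_image_open[OF cW] openin_Int triv_open[OF U(1)] frameD(1)[OF e])
    define g where "g = (\<lambda>p. \<psi> (e p)) \<circ> inv_into W \<kappa>"
    have "cholo_on g S"
      unfolding g_def S_def using frameD(4)[OF e U(1)] W unfolding mholo_on_def by blast
    then have g: "twice_diff_on S g" by (rule cholo_twice_diff[OF S])
    have "Cinf_on (\<kappa> ` (W \<inter> U)) (H \<circ> inv_into W \<kappa>)" using H(1) W unfolding msmooth_on_def by blast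
    then have "twice_diff_on S (H \<circ> inv_into W \<kappa>)"
      by (rule twice_diff_subset[OF Cinf_twice_diff]) (auto simp: S_def)
    from twice_diff_linear[OF bounded_linear_of_real this S]
    have "twice_diff_on S (\<lambda>x. complex_of_real ((H \<circ> inv_into W \<kappa>) x) * g x * cnj (g x))"
      by (intro twice_diff_mult g S twice_diff_linear[OF bounded_linear_cnj])
    then have "twice_diff_on S (\<lambda>x. frame_norm e (inv_into W \<kappa> x))"
    proof (rule twice_diff_cong[OF _ S])
      fix y assume "y \<in> S"
      then have "inv_into W \<kappa> y \<in> U" "pr (e (inv_into W \<kappa> y)) = inv_into W \<kappa> y"
        unfolding S_def chart_image_iff[OF cW] using frameD(3)[OF e] by auto
      then show "complex_of_real ((H \<circ> inv_into W \<kappa>) y) * g y * cnj (g y) = frame_norm e (inv_into W \<kappa> y)"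
        using H(3) by (simp add: frame_norm_def g_def)
    qed
    moreover have "x \<in> S" using p U(2) by (auto simp: S_def)
    ultimately show ?thesis by blast
  qed
  then show ?thesis unfolding twice_diff_on_def by blast
qed

lemma log_norm_in_chart:
  assumes e: "holo_frame X A pr T V e" and W: "(W, \<kappa>) \<in> A"
  shows "twice_diff_on (\<kappa> ` (W \<inter> V)) (\<lambda>x. complex_of_real (log_norm e (inv_into W \<kappa> x)))"
    and "x \<in> \<kappa> ` (W \<inter> V) \<Longrightarrow> wirt i (\<lambda>x. complex_of_real (log_norm e (inv_into W \<kappa> x))) x
       = wirt i (\<lambda>x. frame_norm e (inv_into W \<kappa> x)) x / frame_norm e (inv_into W \<kappa> x)"
proof -
  note cW = atlas_chart[OF W]
  have op: "open (\<kappa> ` (W \<inter> V))" by (rule chart_image_open[OF cW frameD(1)[OF e]])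
  have V: "inv_into W \<kappa> x \<in> V" if "x \<in> \<kappa> ` (W \<inter> V)" for x
    using that unfolding chart_image_iff[OF cW] by blast
  note L = log_of_twice_diff[OF op frame_norm_twice_diff[OF e W] frame_norm_pos(1)[OF e V] frame_norm_pos(2)[OF e V]]
  show "twice_diff_on (\<kappa> ` (W \<inter> V)) (\<lambda>x. complex_of_real (log_norm e (inv_into W \<kappa> x)))" using L(1) .
  show "x \<in> \<kappa> ` (W \<inter> V) \<Longrightarrow> wirt i (\<lambda>x. complex_of_real (log_norm e (inv_into W \<kappa> x))) x
       = wirt i (\<lambda>x. frame_norm e (inv_into W \<kappa> x)) x / frame_norm e (inv_into W \<kappa> x)" using L(2) .
qed

text \<open>The connection form is the (1,0)-differential of the logarithm of the squared norm.\<close>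

lemma chern_curv_eq:
  assumes e: "holo_frame X A pr T V e" and W: "(W, \<kappa>) \<in> A" and x: "x \<in> \<kappa> ` (W \<inter> V)"
  shows "(\<Sum>i\<in>UNIV. \<Sum>j\<in>UNIV. chern_curv h e (W, \<kappa>) i j x * v $ i * cnj (v $ j))
     = - levi (\<lambda>x. complex_of_real (log_norm e (inv_into W \<kappa> x))) x v"
proof -
  have op: "open (\<kappa> ` (W \<inter> V))" by (rule chart_image_open[OF atlas_chart[OF W] frameD(1)[OF e]])
  note L = log_norm_in_chart[OF e W]
  have conn: "wirt i (\<lambda>x. complex_of_real (log_norm e (inv_into W \<kappa> x))) y = chern_conn h e (W, \<kappa>) i y"
    if "y \<in> \<kappa> ` (W \<inter> V)" for i y
    using L(2)[OF that, of i] by (simp add: chern_conn_def frame_norm_def)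
  have "chern_curv h e (W, \<kappa>) i j x
      = - wirt_bar j (wirt i (\<lambda>x. complex_of_real (log_norm e (inv_into W \<kappa> x)))) x" for i j
    by (simp add: chern_curv_def wirt_transform(2)[OF wirt_differentiable[OF L(1) x] op x conn])
  then show ?thesis by (simp add: levi_def sum_negf)
qed

text \<open>If \<open>g\<close> is the transition function normalized by the unitary constant \<open>t\<close>, the squared norms of the
  frames differ by the factor \<open>g * cnj g\<close>. The antiholomorphic factor does not contribute to
  the (1,0)-differential, and at \<open>p\<close> the logarithmic derivative of \<open>g\<close> is its derivative because \<open>g p = 1\<close>.\<close>

lemma del_log_norm_diff:
  assumes e: "holo_frame X A pr T V e" and e': "holo_frame X A pr T V' e'" and p: "p \<in> V" "p \<in> V'"
    and t: "cmod t = 1" "inverse t * section_quot T e' e p = 1"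
  shows "del A (\<lambda>q. complex_of_real (log_norm e' q)) p - del A (\<lambda>q. complex_of_real (log_norm e q)) p
    = del A (\<lambda>q. inverse t * section_quot T e' e q) p"
proof -
  have pX: "p \<in> X" using frameD(2)[OF e] p by blast
  obtain W \<kappa> where at: "chart_at A p = (W, \<kappa>)" by (cases "chart_at A p")
  note W = chart_at_props[OF pX at]
  note cW = atlas_chart[OF W(1)]
  define x where "x = \<kappa> p"
  define S where "S = \<kappa> ` (W \<inter> (V \<inter> V'))"
  have S: "open S" unfolding S_def
    by (intro chart_image_open[OF cW] openin_Int frameD(1)[OF e] frameD(1)[OF e'])
  have xS: "x \<in> S" "x \<in> \<kappa> ` (W \<inter> V)" "x \<in> \<kappa> ` (W \<inter> V')" using p W(2) by (auto simp: S_def x_def)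
  have inv: "inv_into W \<kappa> x = p" using inv_chart[OF cW W(2)] by (simp add: x_def)
  define K where "K y = frame_norm e (inv_into W \<kappa> y)" for y
  define K' where "K' y = frame_norm e' (inv_into W \<kappa> y)" for y
  define g where "g y = inverse t * section_quot T e' e (inv_into W \<kappa> y)" for y
  have tt: "t * cnj t = 1" using t(1) by (simp add: complex_norm_square[symmetric])
  then have t0: "t \<noteq> 0" by auto
  have gx: "g x = 1" using t(2) by (simp add: g_def inv)
  have "cdiff_at (section_quot T e' e \<circ> inv_into W \<kappa>) x"
    using section_quot_frames[OF e e'] W(1) xS(1) unfolding mholo_on_def cholo_on_alt S_def by blast
  then have cg: "cdiff_at g x"
    unfolding g_def using cdiff_mult[OF cdiff_const, of "section_quot T e' e \<circ> inv_into W \<kappa>" x "inverse t"]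
    by (simp add: o_def)
  have Kd: "K differentiable (at x)"
    using frame_norm_twice_diff[OF e W(1)] xS(2) unfolding K_def twice_diff_on_def by blast
  have K'eq: "K y * g y * cnj (g y) = K' y" if "y \<in> S" for y
  proof -
    have "inv_into W \<kappa> y \<in> V" "inv_into W \<kappa> y \<in> V'" using that unfolding S_def chart_image_iff[OF cW] by auto
    from frame_norm_change[OF e e' this]
    have "K' y = K y * (t * g y) * cnj (t * g y)" using t0 by (simp add: K_def K'_def g_def)
    also have "\<dots> = (t * cnj t) * (K y * g y * cnj (g y))" by simp
    finally show ?thesis unfolding tt by simp
  qed
  have dK: "(K has_derivative frechet_derivative K (at x)) (at x)"
    using Kd frechet_derivative_works by blast
  have dg: "(g has_derivative frechet_derivative g (at x)) (at x)"
    using cdiff_imp_differentiable[OF cg] frechet_derivative_works by blast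
  have dK': "(K' has_derivative (\<lambda>v. K x * g x * cnj (frechet_derivative g (at x) v)
      + (K x * frechet_derivative g (at x) v + frechet_derivative K (at x) v * g x) * cnj (g x))) (at x)"
    by (rule has_derivative_transform_within_open[OF
          has_derivative_mult[OF has_derivative_mult[OF dK dg] has_derivative_cnj[OF dg]] S xS(1) K'eq])
  have gi: "frechet_derivative g (at x) (axis i \<i>) = \<i> * frechet_derivative g (at x) (axis i 1)" for i
    unfolding axis_ii by (rule cdiff_frechet[OF cg])
  have w: "wirt i K' x = wirt i K x + K x * wirt i g x" for i
    unfolding wirt_of_derivative(1)[OF dK'] cdiff_wirt(2)[OF cg] wirt_def[of i K] gi gx
    by (simp add: field_simps)
  have "K' x = K x" using K'eq[OF xS(1)] gx by simp
  moreover have "K x \<noteq> 0"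
    using frame_norm_pos(2)[OF e p(1)] unfolding K_def inv by auto
  ultimately have "wirt i K' x / K' x - wirt i K x / K x = wirt i g x" for i
    unfolding w by (simp add: field_simps)
  then show ?thesis
    using log_norm_in_chart(2)[OF e W(1) xS(2)] log_norm_in_chart(2)[OF e' W(1) xS(3)]
    by (simp add: vec_eq_iff del_def at o_def x_def[symmetric] K_def[abs_def] K'_def[abs_def] g_def[abs_def])
qed

end

section \<open>The obstruction cocycle as a coboundary\<close>

text \<open>On the axis of the coordinate \<open>l\<close> only the multi-indices supported in \<open>l\<close> contribute, and what
  remains is a power series in one variable.\<close>

lemma derivative_of_multiindex_series_on_axis:
  fixes a :: "('r::finite \<Rightarrow> nat) \<Rightarrow> complex" and G :: "complex \<Rightarrow> complex"
  assumes \<delta>: "0 < \<delta>"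
    and G: "\<And>\<tau>. cmod \<tau> < \<delta> \<Longrightarrow>
      ((\<lambda>\<alpha>. a \<alpha> * (\<Prod>m\<in>UNIV. (if m = l then \<tau> else 0) ^ \<alpha> m)) has_sum (G \<tau> - 1)) {\<alpha>. (\<Sum>m\<in>UNIV. \<alpha> m) \<ge> 1}"
  shows "(G has_field_derivative a (\<lambda>m. of_bool (m = l))) (at 0)"
proof -
  define e :: "nat \<Rightarrow> 'r \<Rightarrow> nat" where "e n = (\<lambda>m. if m = l then n else 0)" for n
  define c where "c n = (if n = 0 then 0 else a (e n))" for n
  have inj: "inj_on e {1..}"
    by (rule inj_onI) (auto simp: e_def fun_eq_iff dest: spec[of _ l])
  have prod: "(\<Prod>m\<in>UNIV. (if m = l then \<tau> else 0) ^ e n m) = \<tau> ^ n" for \<tau> :: complex and n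
  proof -
    have "(\<Prod>m\<in>UNIV. (if m = l then \<tau> else 0) ^ e n m) = (\<Prod>m\<in>UNIV. if m = l then \<tau> ^ n else 1)"
      by (intro prod.cong) (auto simp: e_def)
    then show ?thesis by simp
  qed
  have sums: "(\<lambda>n. c n * \<tau> ^ n) sums (G \<tau> - 1)" if \<tau>: "cmod \<tau> < \<delta>" for \<tau>
  proof -
    have "((\<lambda>\<alpha>. a \<alpha> * (\<Prod>m\<in>UNIV. (if m = l then \<tau> else 0) ^ \<alpha> m)) has_sum (G \<tau> - 1)) (e ` {1..})"
    proof (subst has_sum_cong_neutral[where S = "e ` {1..}" and T = "{\<alpha>. (\<Sum>m\<in>UNIV. \<alpha> m) \<ge> 1}"])
      fix \<alpha> assume al: "\<alpha> \<in> {\<alpha>. (\<Sum>m\<in>UNIV. \<alpha> m) \<ge> 1} - e ` {1..}"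
      have "\<exists>m. m \<noteq> l \<and> \<alpha> m \<noteq> 0"
      proof (rule ccontr)
        assume "\<not> (\<exists>m. m \<noteq> l \<and> \<alpha> m \<noteq> 0)"
        then have "\<alpha> = e (\<alpha> l)" by (auto simp: e_def fun_eq_iff)
        moreover have "\<alpha> l \<ge> 1"
        proof -
          have "(\<Sum>m\<in>UNIV. \<alpha> m) = (\<Sum>m\<in>UNIV. if m = l then \<alpha> l else 0)"
            using \<open>\<not> (\<exists>m. m \<noteq> l \<and> \<alpha> m \<noteq> 0)\<close> by (intro sum.cong) auto
          then show ?thesis using al by simp
        qed
        ultimately show False using al by blast
      qed
      then obtain m where "m \<noteq> l" "\<alpha> m \<noteq> 0" by blast
      then have "(\<Prod>m\<in>UNIV. (if m = l then \<tau> else 0) ^ \<alpha> m) = 0"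
        by (intro prod_zero) (auto intro!: bexI[of _ m])
      then show "a \<alpha> * (\<Prod>m\<in>UNIV. (if m = l then \<tau> else 0) ^ \<alpha> m) = 0" by simp
    next
      fix \<alpha> assume "\<alpha> \<in> e ` {1..} - {\<alpha>. (\<Sum>m\<in>UNIV. \<alpha> m) \<ge> 1}"
      then show "a \<alpha> * (\<Prod>m\<in>UNIV. (if m = l then \<tau> else 0) ^ \<alpha> m) = 0" by (auto simp: e_def)
    qed (use G[OF \<tau>] in auto)
    then have "((\<lambda>n. a (e n) * \<tau> ^ n) has_sum (G \<tau> - 1)) {1..}"
      unfolding has_sum_reindex[OF inj] by (simp add: o_def prod)
    then have "((\<lambda>n. c n * \<tau> ^ n) has_sum (G \<tau> - 1)) UNIV"
      by (subst has_sum_cong_neutral[where T = "{1..}" and g = "\<lambda>n. a (e n) * \<tau> ^ n"]) (auto simp: c_def)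
    then show ?thesis by (rule has_sum_imp_sums)
  qed
  have "((\<lambda>\<tau>. \<Sum>n. c n * \<tau> ^ n) has_field_derivative (\<Sum>n. diffs c n * 0 ^ n)) (at 0)"
    by (rule termdiffs_strong'[where K = \<delta>]) (use sums \<delta> in \<open>auto simp: sums_iff\<close>)
  moreover have "(\<Sum>n. diffs c n * 0 ^ n) = a (\<lambda>m. of_bool (m = l))"
  proof -
    have "e (Suc 0) = (\<lambda>m. of_bool (m = l))" by (auto simp: e_def fun_eq_iff)
    then show ?thesis unfolding powser_zero by (simp add: diffs_def c_def)
  qed
  ultimately have "((\<lambda>\<tau>. 1 + (\<Sum>n. c n * \<tau> ^ n)) has_field_derivative a (\<lambda>m. of_bool (m = l))) (at 0)"
    by (auto intro!: derivative_eq_intros)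
  then show ?thesis
  proof (rule has_field_derivative_transform_within_open)
    show "open (ball (0::complex) \<delta>)" by simp
    show "1 + (\<Sum>n. c n * \<tau> ^ n) = G \<tau>" if "\<tau> \<in> ball 0 \<delta>" for \<tau>
      using sums[of \<tau>] that by (simp add: sums_iff)
  qed (use \<delta> in auto)
qed

locale hermitian_line_bundle_near_submanifold =
  submanifold X A Y + hermitian_line_bundle X A pr T h
  for X :: "'x::topological_space set" and A :: "('x, 'd::finite + 'r::finite) chart set" and Y
    and pr :: "'l \<Rightarrow> 'x" and T h +
  fixes D :: "('x, 'l, 'd, 'r) u1_choice"
  assumes admissible: "admissible_u1_choice X A Y pr T D"
begin

text \<open>The coordinates given by \<open>z\<close>, composed with the retraction, and \<open>w\<close>.\<close>

definition adapted :: "nat \<Rightarrow> 'x \<Rightarrow> complex^('d + 'r)" where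
  "adapted j p = (\<chi> i. case i of Inl a \<Rightarrow> zco D j (retr D j p) $ a | Inr l \<Rightarrow> wfun D j p $ l)"

lemma adapted_nth [simp]:
  "adapted j p $ Inl a = zco D j (retr D j p) $ a" "adapted j p $ Inr l = wfun D j p $ l"
  by (simp_all add: adapted_def)

lemma cover_Y: "finite_open_cover Y (num D) (covY D)"
  using admissible unfolding admissible_u1_choice_def by (elim conjE)

lemma choiceD:
  assumes "j < num D"
  shows "holo_chart Y (sub_atlas X A Y) (covY D j, zco D j)"
    and "covX D j \<inter> Y = covY D j"
    and "p \<in> covY D j \<Longrightarrow> retr D j p = p"
    and "{p\<in>covX D j. wfun D j p = 0} = covY D j"
    and "holo_chart X A (covX D j, adapted j)"
    and "holo_frame X A pr T (covX D j) (frm D j)"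
proof -
  have "\<forall>j<num D. \<forall>p\<in>covY D j. retr D j p = p"
    and a: "holo_chart Y (sub_atlas X A Y) (covY D j, zco D j) \<and> covX D j \<inter> Y = covY D j \<and>
        {p\<in>covX D j. wfun D j p = 0} = covY D j \<and>
        holo_chart X A (covX D j, adapted j) \<and> holo_frame X A pr T (covX D j) (frm D j)"
    using admissible assms unfolding admissible_u1_choice_def adapted_def[abs_def] by simp_all
  then show "p \<in> covY D j \<Longrightarrow> retr D j p = p" using assms by blast
  show "holo_chart Y (sub_atlas X A Y) (covY D j, zco D j)" "covX D j \<inter> Y = covY D j"
    "{p\<in>covX D j. wfun D j p = 0} = covY D j"
    "holo_chart X A (covX D j, adapted j)" "holo_frame X A pr T (covX D j) (frm D j)"
    using a by simp_all
qed

definition transition :: "nat \<Rightarrow> nat \<Rightarrow> 'x \<Rightarrow> complex" where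
  "transition j k q = inverse (tcon D j k) * section_quot T (frm D k) (frm D j) q"

lemma overlapD:
  assumes "j < num D" "k < num D"
  shows "cmod (tcon D j k) = 1"
    and "p \<in> covY D j \<inter> covY D k \<Longrightarrow> transition j k p = 1"
    and "\<exists>W. openin (top_of_set X) W \<and> covY D j \<inter> covY D k \<subseteq> W \<and>
             W \<subseteq> covX D j \<inter> covX D k \<and> retr D j ` W \<subseteq> covY D j \<inter> covY D k \<and>
             (\<forall>p\<in>W. ((\<lambda>\<alpha>. coef D k j \<alpha> (retr D j p) * (\<Prod>l\<in>UNIV. wfun D j p $ l ^ \<alpha> l)) has_sum
                       (transition j k p - 1)) {\<alpha>. (\<Sum>l\<in>UNIV. \<alpha> l) \<ge> 1})"
proof -
  note a = admissible[unfolded admissible_u1_choice_def, THEN conjunct2, THEN conjunct2,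
      rule_format, OF assms, folded transition_def]
  show "cmod (tcon D j k) = 1" using a by (elim conjE)
  show "p \<in> covY D j \<inter> covY D k \<Longrightarrow> transition j k p = 1"
    using a by (elim conjE) (erule (1) bspec)
  show "\<exists>W. openin (top_of_set X) W \<and> covY D j \<inter> covY D k \<subseteq> W \<and>
             W \<subseteq> covX D j \<inter> covX D k \<and> retr D j ` W \<subseteq> covY D j \<inter> covY D k \<and>
             (\<forall>p\<in>W. ((\<lambda>\<alpha>. coef D k j \<alpha> (retr D j p) * (\<Prod>l\<in>UNIV. wfun D j p $ l ^ \<alpha> l)) has_sum
                       (transition j k p - 1)) {\<alpha>. (\<Sum>l\<in>UNIV. \<alpha> l) \<ge> 1})"
    using a by (elim conjE)
qed

lemma adapted_slice_chart:
  assumes j: "j < num D"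
  shows "slice_chart X A Y (covX D j, adapted j)"
proof -
  have "covX D j \<inter> Y = {p \<in> covX D j. wfun D j p = 0}" using choiceD(2,4)[OF j] by simp
  also have "\<dots> = {p \<in> covX D j. \<forall>l. adapted j p $ Inr l = 0}" by (auto simp: vec_eq_iff)
  finally show ?thesis using choiceD(5)[OF j] by (simp add: slice_chart_def)
qed

text \<open>The retraction maps the points with coordinates \<open>(z(p), \<tau> e_l)\<close> to \<open>p\<close>, so along them the given
  expansion has constant coefficients.\<close>

lemma transition_normal_derivative:
  assumes j: "j < num D" and k: "k < num D" and p: "p \<in> covY D j \<inter> covY D k"
  defines "g \<equiv> transition j k"
  shows "cdiff_at (g \<circ> inv_into (covX D j) (adapted j)) (adapted j p)"
    and "wirt (Inr l) (g \<circ> inv_into (covX D j) (adapted j)) (adapted j p) = coef D k j (\<lambda>m. of_bool (m = l)) p"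
proof -
  let ?U = "covX D j" and ?\<phi> = "adapted j"
  note c = choiceD(5)[OF j]
  note cc = holo_chart_complex[OF c]
  define G where "G = g \<circ> inv_into ?U ?\<phi>"
  have pU: "p \<in> ?U" "p \<in> covX D k" using p choiceD(2)[OF j] choiceD(2)[OF k] by auto
  note ej = choiceD(6)[OF j] and ek = choiceD(6)[OF k]
  have "mholo_on A g (?U \<inter> covX D k)"
    unfolding g_def transition_def[abs_def] by (intro mholo_on_mult mholo_on_const section_quot_frames[OF ej ek])
  from mholo_on_holo_chart[OF this openin_Int[OF frameD(1)[OF ej] frameD(1)[OF ek]] c]
  have cd: "cdiff_at G (?\<phi> p)" unfolding cholo_on_alt G_def using pU by blast
  then show "cdiff_at (g \<circ> inv_into ?U ?\<phi>) (?\<phi> p)" unfolding G_def .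
  obtain W where W: "openin (top_of_set X) W" "covY D j \<inter> covY D k \<subseteq> W" "W \<subseteq> ?U \<inter> covX D k"
      "retr D j ` W \<subseteq> covY D j \<inter> covY D k"
    and sum: "\<And>q. q \<in> W \<Longrightarrow> ((\<lambda>\<alpha>. coef D k j \<alpha> (retr D j q) * (\<Prod>l\<in>UNIV. wfun D j q $ l ^ \<alpha> l)) has_sum (g q - 1))
                     {\<alpha>. (\<Sum>l\<in>UNIV. \<alpha> l) \<ge> 1}"
    using overlapD(3)[OF j k] unfolding g_def by blast
  define L where "L \<tau> = ?\<phi> p + \<tau> *s axis (Inr l) 1" for \<tau>
  have "open (?\<phi> ` (?U \<inter> W))" by (rule chart_image_open[OF cc W(1)])
  moreover have "?\<phi> p \<in> ?\<phi> ` (?U \<inter> W)" using pU p W(2) by blast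
  ultimately obtain \<delta> where \<delta>: "0 < \<delta>" "ball (?\<phi> p) \<delta> \<subseteq> ?\<phi> ` (?U \<inter> W)"
    using open_contains_ball by blast
  have wp: "wfun D j p = 0" using choiceD(4)[OF j] p by blast
  have rp: "retr D j p = p" using choiceD(3)[OF j] p by blast
  have series: "((\<lambda>\<alpha>. coef D k j \<alpha> p * (\<Prod>m\<in>UNIV. (if m = l then \<tau> else 0) ^ \<alpha> m)) has_sum (G (L \<tau>) - 1))
      {\<alpha>. (\<Sum>m\<in>UNIV. \<alpha> m) \<ge> 1}" if \<tau>: "cmod \<tau> < \<delta>" for \<tau>
  proof -
    have "norm (axis (Inr l) 1 :: complex^('d + 'r)) = 1" by (simp add: norm_eq_sqrt_inner inner_axis_axis)
    then have "L \<tau> \<in> ball (?\<phi> p) \<delta>" using \<tau> by (simp add: L_def dist_norm norm_cscale)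
    then obtain q where q: "q \<in> ?U" "q \<in> W" "L \<tau> = ?\<phi> q" using \<delta>(2) by blast
    have w: "wfun D j q $ m = (if m = l then \<tau> else 0)" for m
      using arg_cong[OF q(3), of "\<lambda>x. x $ Inr m"] wp by (auto simp: L_def axis_def)
    have "zco D j (retr D j q) $ a = zco D j p $ a" for a
      using arg_cong[OF q(3), of "\<lambda>x. x $ Inl a"] rp by (simp add: L_def axis_def)
    then have "zco D j (retr D j q) = zco D j p" by (simp add: vec_eq_iff)
    moreover have "inj_on (zco D j) (covY D j)"
      using choiceD(1)[OF j] complex_chartD(3) unfolding holo_chart_def by blast
    ultimately have "retr D j q = p" using W(4) q(2) p by (meson IntD1 image_subset_iff inj_onD)
    moreover have "G (L \<tau>) = g q" using q inv_chart[OF cc q(1)] by (simp add: G_def)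
    ultimately show ?thesis using sum[OF q(2)] by (simp add: w)
  qed
  have "((\<lambda>\<tau>. G (L \<tau>)) has_field_derivative coef D k j (\<lambda>m. of_bool (m = l)) p) (at 0)"
    by (rule derivative_of_multiindex_series_on_axis[OF \<delta>(1) series])
  moreover have "((\<lambda>\<tau>. G (L \<tau>)) has_field_derivative frechet_derivative G (at (?\<phi> p)) (axis (Inr l) 1)) (at 0)"
    using cdiff_line_derivative[of G "?\<phi> p" 0 "axis (Inr l) 1"] cd by (simp add: L_def)
  ultimately have "frechet_derivative G (at (?\<phi> p)) (axis (Inr l) 1) = coef D k j (\<lambda>m. of_bool (m = l)) p"
    using DERIV_unique by blast
  then show "wirt (Inr l) (g \<circ> inv_into ?U ?\<phi>) (?\<phi> p) = coef D k j (\<lambda>m. of_bool (m = l)) p"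
    using cdiff_wirt(2)[OF cd] by (simp add: G_def)
qed

text \<open>The normalized transition function equals \<open>1\<close> on \<open>Y\<close>. Hence only its normal derivatives contribute
  to its differential along \<open>Y\<close>, and these are the first order coefficients of the expansion.\<close>

lemma u1_cocycle_eq_del:
  assumes j: "j < num D" and k: "k < num D" and p: "p \<in> covY D j \<inter> covY D k"
  shows "u1_cocycle A D j k p = del A (transition j k) p"
proof -
  let ?U = "covX D j" and ?\<phi> = "adapted j"
  define g where "g = transition j k"
  note t = transition_normal_derivative[OF j k p, folded g_def]
  note df = cdiff_imp_differentiable[OF t(1)]
  have pU: "p \<in> ?U" "p \<in> Y" using p choiceD(2)[OF j] by auto
  have "openin (top_of_set Y) (covY D j \<inter> covY D k)"
    using cover_Y j k unfolding finite_open_cover_def by (intro openin_Int) auto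
  moreover have "\<forall>q\<in>covY D j \<inter> covY D k. g q = g p"
    using overlapD(2)[OF j k] p by (simp add: g_def)
  ultimately have zero: "wirt (Inl a) (g \<circ> inv_into ?U ?\<phi>) (?\<phi> p) = 0" for a
    by (rule wirt_slice_zero[OF adapted_slice_chart[OF j] pU df _ p])
  have "del A g p = (\<Sum>i\<in>UNIV. wirt i (g \<circ> inv_into ?U ?\<phi>) (?\<phi> p) *s covec A (\<lambda>q. ?\<phi> q $ i) p)"
    by (rule del_in_chart[OF choiceD(5)[OF j] pU(1) df])
  also have "\<dots> = (\<Sum>i\<in>range Inr. wirt i (g \<circ> inv_into ?U ?\<phi>) (?\<phi> p) *s covec A (\<lambda>q. ?\<phi> q $ i) p)"
  proof (rule sum.mono_neutral_right)
    show "\<forall>i\<in>UNIV - range Inr. wirt i (g \<circ> inv_into ?U ?\<phi>) (?\<phi> p) *s covec A (\<lambda>q. ?\<phi> q $ i) p = 0"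
    proof
      fix i :: "'d + 'r" assume "i \<in> UNIV - range Inr"
      then obtain a where "i = Inl a" by (cases i) auto
      then show "wirt i (g \<circ> inv_into ?U ?\<phi>) (?\<phi> p) *s covec A (\<lambda>q. ?\<phi> q $ i) p = 0" by (simp add: zero)
    qed
  qed auto
  also have "\<dots> = u1_cocycle A D j k p"
    by (subst sum.reindex) (auto simp: u1_cocycle_def t(2) intro: inj_Inr)
  finally show ?thesis by (simp add: g_def)
qed

lemma log_norm_agree:
  assumes j: "j < num D" and k: "k < num D" and p: "p \<in> covY D j \<inter> covY D k"
  shows "log_norm (frm D k) p = log_norm (frm D j) p"
proof -
  let ?t = "tcon D j k" and ?q = "section_quot T (frm D k) (frm D j) p"
  have t: "cmod ?t = 1" "inverse ?t * ?q = 1"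
    using overlapD(1)[OF j k] overlapD(2)[OF j k p] by (simp_all add: transition_def)
  then have "?t \<noteq> 0" by auto
  then have "?q = ?t" using t(2) by (simp add: field_simps)
  moreover have "?t * cnj ?t = 1" using t(1) by (simp add: complex_norm_square[symmetric])
  moreover have "p \<in> covX D j" "p \<in> covX D k" using p choiceD(2)[OF j] choiceD(2)[OF k] by auto
  ultimately show ?thesis
    using frame_norm_change[OF choiceD(6)[OF j] choiceD(6)[OF k], of p] by (simp add: mult.assoc)
qed

text \<open>The cocycle is the coboundary of the sections \<open>del (ln h(e_j, e_j))\<close> of the conormal sheaf.\<close>

theorem u1_class_zero_if_curvature_nonneg:
  assumes Y: "compact Y"
    and curv: "\<And>V e W \<kappa> x v. holo_frame X A pr T V e \<Longrightarrow> (W, \<kappa>) \<in> A \<Longrightarrow> x \<in> \<kappa> ` (W \<inter> V) \<Longrightarrow>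
      (\<Sum>i\<in>UNIV. \<Sum>j\<in>UNIV. chern_curv h e (W, \<kappa>) i j x * v $ i * cnj (v $ j)) \<in> \<real>\<^sub>\<ge>\<^sub>0"
  shows "u1_class X A Y D = H1_zero Y (conormal_sheaf X A Y)"
proof -
  define F where "F j = log_norm (frm D j)" for j
  have psh: "plurisuperharmonic X A Y (covX D j) (F j)" if j: "j < num D" for j
  proof
    note e = choiceD(6)[OF j]
    show "openin (top_of_set X) (covX D j)" by (rule frameD(1)[OF e])
    fix W \<kappa> assume W: "(W, \<kappa>) \<in> A"
    show "twice_diff_on (\<kappa> ` (W \<inter> covX D j)) (\<lambda>x. complex_of_real (F j (inv_into W \<kappa> x)))"
      unfolding F_def by (rule log_norm_in_chart(1)[OF e W])
    fix x v assume x: "x \<in> \<kappa> ` (W \<inter> covX D j)"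
    show "- levi (\<lambda>x. complex_of_real (F j (inv_into W \<kappa> x))) x v \<in> \<real>\<^sub>\<ge>\<^sub>0"
      using curv[OF e W x, of v] unfolding F_def chern_curv_eq[OF e W x] .
  qed
  have covY: "openin (top_of_set Y) (covY D j)" "covY D j \<subseteq> Y" "Y \<inter> covX D j = covY D j" if "j < num D" for j
    using cover_Y that choiceD(2)[OF that] unfolding finite_open_cover_def by auto
  have covered: "\<exists>j. j < num D \<and> p \<in> covY D j" if "p \<in> Y" for p
    using cover_Y that unfolding finite_open_cover_def by blast
  \<comment> \<open>On \<open>Y\<close> the local functions agree, since the frames differ by unitary constants there.\<close>
  define FY where "FY p = F (SOME j. j < num D \<and> p \<in> covY D j) p" for p
  have FY: "FY p = F j p" if "j < num D" "p \<in> covY D j" for j p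
  proof -
    have "(SOME j. j < num D \<and> p \<in> covY D j) < num D \<and> p \<in> covY D (SOME j. j < num D \<and> p \<in> covY D j)"
      by (rule someI[of _ j]) (use that in simp)
    then show ?thesis unfolding FY_def F_def using that by (intro log_norm_agree) auto
  qed
  have cont: "continuous_on Y FY"
  proof -
    have "continuous_map (top_of_set Y) euclidean FY"
    proof (rule pasting_lemma[where I = "{..<num D}" and T = "covY D" and f = F])
      fix j assume "j \<in> {..<num D}"
      then have j: "j < num D" by simp
      interpret psh: plurisuperharmonic X A Y "covX D j" "F j" by (rule psh[OF j])
      show "openin (top_of_set Y) (covY D j)" by (rule covY(1)[OF j])
      have "continuous_on (covY D j) (F j)"
        using psh.continuous_F by (rule continuous_on_subset) (use covY(3)[OF j] in blast)
      then show "continuous_map (subtopology (top_of_set Y) (covY D j)) euclidean (F j)"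
        using covY(2)[OF j] by (simp add: subtopology_subtopology Int_absorb1)
    next
      fix i j x assume "i \<in> {..<num D}" "j \<in> {..<num D}" "x \<in> topspace (top_of_set Y) \<inter> covY D i \<inter> covY D j"
      then show "F i x = F j x" using FY[of i x] FY[of j x] by simp
    next
      fix x assume "x \<in> topspace (top_of_set Y)"
      then show "\<exists>j. j \<in> {..<num D} \<and> x \<in> covY D j \<and> FY x = F j x" using covered[of x] FY by auto
    qed
    then show ?thesis by simp
  qed
  have loc: "\<exists>B. openin (top_of_set Y) B \<and> p \<in> B \<and> (\<forall>q\<in>B. FY q = FY p)" if p: "p \<in> Y" for p
  proof (rule locally_constant_if_local_minimum_principle[OF Y cont _ p])
    fix p assume p: "p \<in> Y"
    then obtain j where j: "j < num D" "p \<in> covY D j" using covered by blast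
    interpret psh: plurisuperharmonic X A Y "covX D j" "F j" by (rule psh[OF j(1)])
    have "p \<in> covX D j" using j covY(3) by blast
    from psh.local_minimum_principle[OF p this]
    obtain B B' where B: "openin (top_of_set Y) B'" "connected B" "B \<subseteq> Y" "B \<subseteq> covX D j" "p \<in> B'" "B' \<subseteq> B"
      "(\<forall>q\<in>B. F j p \<le> F j q) \<longrightarrow> (\<forall>q\<in>B'. F j q = F j p)" by (elim exE conjE)
    have eq: "FY q = F j q" if "q \<in> B" for q
      by (rule FY[OF j(1)]) (use that B(3,4) covY(3)[OF j(1)] in blast)
    have pB: "p \<in> B" using B(5,6) by blast
    have min: "(\<forall>q\<in>B. FY p \<le> FY q) \<longrightarrow> (\<forall>q\<in>B'. FY q = FY p)"
    proof
      assume "\<forall>q\<in>B. FY p \<le> FY q"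
      then have "\<forall>q\<in>B. F j p \<le> F j q" using eq pB by simp
      then have "\<forall>q\<in>B'. F j q = F j p" using B(7) by blast
      then show "\<forall>q\<in>B'. FY q = FY p" using eq pB B(6) by (simp add: subset_iff)
    qed
    show "\<exists>B B'. openin (top_of_set Y) B' \<and> connected B \<and> B \<subseteq> Y \<and> p \<in> B' \<and> B' \<subseteq> B \<and>
       ((\<forall>q\<in>B. FY p \<le> FY q) \<longrightarrow> (\<forall>q\<in>B'. FY q = FY p))"
      by (rule exI[of _ B], rule exI[of _ B'], intro conjI B(1,2,3,5,6) min)
  qed
  define \<zeta> where "\<zeta> j = del A (\<lambda>q. complex_of_real (F j q))" for j
  have \<zeta>: "\<zeta> j \<in> conormal_sheaf X A Y (covY D j)" if j: "j < num D" for j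
  proof -
    interpret psh: plurisuperharmonic X A Y "covX D j" "F j" by (rule psh[OF j])
    have "\<zeta> j \<in> conormal_sheaf X A Y (Y \<inter> covX D j)"
      unfolding \<zeta>_def
    proof (rule psh.del_conormal)
      fix p assume "p \<in> Y \<inter> covX D j"
      then have p: "p \<in> Y" "p \<in> covY D j" using covY(3)[OF j] by auto
      obtain B where B: "openin (top_of_set Y) B" "p \<in> B" "\<forall>q\<in>B. FY q = FY p" using loc[OF p(1)] by blast
      have eqB: "\<forall>q\<in>B \<inter> covY D j. F j q = F j p"
        using B(3) FY[OF j] p(2) by (metis IntD1 IntD2)
      show "\<exists>B. openin (top_of_set Y) B \<and> p \<in> B \<and> (\<forall>q\<in>B. F j q = F j p)"
        by (rule exI[of _ "B \<inter> covY D j"], intro conjI openin_Int IntI B(1,2) covY(1)[OF j] p(2) eqB)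
    qed
    then show ?thesis by (simp add: covY(3)[OF j])
  qed
  have cob: "u1_cocycle A D j k p = \<zeta> k p - \<zeta> j p"
    if jk: "j < num D" "k < num D" and p: "p \<in> covY D j \<inter> covY D k" for j k p
  proof -
    have "p \<in> covX D j" "p \<in> covX D k" using p covY(3)[OF jk(1)] covY(3)[OF jk(2)] by auto
    from del_log_norm_diff[OF choiceD(6)[OF jk(1)] choiceD(6)[OF jk(2)] this overlapD(1)[OF jk] overlapD(2)[OF jk p, unfolded transition_def]]
    show ?thesis unfolding u1_cocycle_eq_del[OF jk p] \<zeta>_def F_def transition_def[abs_def] by simp
  qed
  show ?thesis
    unfolding u1_class_def
  proof (rule H1_class_coboundary[where \<zeta> = \<zeta>])
    show "\<xi> \<in> conormal_sheaf X A Y V" if "\<xi> \<in> conormal_sheaf X A Y U" "V \<subseteq> U" for U V \<xi>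
      using conormal_sheaf_restrict[OF that] .
    show "\<eta> \<in> conormal_sheaf X A Y U"
      if "\<xi> \<in> conormal_sheaf X A Y U" "\<And>p. p \<in> U \<Longrightarrow> \<xi> p = \<eta> p" for U \<xi> \<eta>
      using conormal_sheaf_cong[OF that] .
    show "(\<lambda>p. \<xi> p - \<eta> p) \<in> conormal_sheaf X A Y U"
      if "U \<subseteq> Y" "\<xi> \<in> conormal_sheaf X A Y U" "\<eta> \<in> conormal_sheaf X A Y U" for U \<xi> \<eta>
      using conormal_sheaf_diff[OF that(2,3,1)] .
    show "(\<lambda>_. 0) \<in> conormal_sheaf X A Y Y" by (rule conormal_sheaf_zero) simp
  qed (fact cover_Y \<zeta> cob)+
qed

end

theorem theorem1p4:
  fixes X Y :: "'x::{t2_space, second_countable_topology} set"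
    and A :: "('x, 'd::finite + 'r::finite) chart set"
    and pr :: "'l \<Rightarrow> 'x" and T :: "('x, 'l) triv set"
    and D :: "('x, 'l, 'd, 'r) u1_choice"
  assumes "complex_manifold X A"
    and "complex_submanifold X A Y"
    and "compact Y"
    and "kaehler_manifold Y (sub_atlas X A Y)"
    and "holo_line_bundle X A pr T"
    and "topologically_trivial_on Y pr T"
    and "admissible_u1_choice X A Y pr T D"
    and "u1_class X A Y D \<noteq> H1_zero Y (conormal_sheaf X A Y)"
  shows "\<not> semi_positive X A pr T"
proof
  assume "semi_positive X A pr T"
  then obtain h where h: "hermitian_metric A pr T h"
    and curv: "\<forall>V e. holo_frame X A pr T V e \<longrightarrow>
           (\<forall>c\<in>A. \<forall>x\<in>snd c ` (fst c \<inter> V). \<forall>v.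
              (\<Sum>i\<in>UNIV. \<Sum>j\<in>UNIV. chern_curv h e c i j x * v $ i * cnj (v $ j)) \<in> \<real>\<^sub>\<ge>\<^sub>0)"
    unfolding semi_positive_def by (elim exE conjE)
  interpret hermitian_line_bundle_near_submanifold X A Y pr T h D
    by unfold_locales (fact assms h)+
  have "u1_class X A Y D = H1_zero Y (conormal_sheaf X A Y)"
  proof (rule u1_class_zero_if_curvature_nonneg[OF assms(3)])
    fix V e W \<kappa> x v
    assume e: "holo_frame X A pr T V e" and W: "(W, \<kappa>) \<in> A" "x \<in> \<kappa> ` (W \<inter> V)"
    show "(\<Sum>i\<in>UNIV. \<Sum>j\<in>UNIV. chern_curv h e (W, \<kappa>) i j x * v $ i * cnj (v $ j)) \<in> \<real>\<^sub>\<ge>\<^sub>0"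
      by (rule curv[rule_format, OF e W(1)]) (use W(2) in simp)
  qed
  with assms(8) show False by contradiction
qed

end
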